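(* Let $t$ be a seed with vertex set $I$ and $t^{\mathrm{prin}}$ the associated principal coefficient seed with vertex set $I\sqcup I'$. Let $\mathcal S(t^{\mathrm{prin}})=\{S_m(t^{\mathrm{prin}})\mid m\in\mathbb{Z}^{I\sqcup I'}\}\subset\mathcal U^A(t^{\mathrm{prin}})$ be such that the sets $\mathcal S(\boldsymbol\mu^{-1}t^{\mathrm{prin}}):=(\boldsymbol\mu^A)^*\mathcal S(t^{\mathrm{prin}})\subset\mathcal U^A(\boldsymbol\mu^{-1}t^{\mathrm{prin}})$, for all mutation sequences $\boldsymbol\mu$, satisfy the basis assumption on the $A$-side. Let $\mathcal Z(t)=\{Z_n(t)\mid n\in\mathbb{Z}^I\}$, $Z_n(t)=X(t)^n\cdot F_n$, where $F_n$ is the $F$-polynomial of $S_m(t^{\mathrm{prin}})$ for $m=\binom{B(t)n}{n}$. If $p^*\mathcal U^X(t^{\mathrm{prin}})$ is contained in the free $\Bbbk$-module $\bigoplus_m\Bbbk S_m(t^{\mathrm{prin}})\subset\mathcal U^A(t^{\mathrm{prin}})$, then $\mathcal Z(t)$ is a $\Bbbk$-basis of $\mathcal U^X(t)$. In particular, when $\mathcal S(t^{\mathrm{prin}})$ is a basis of $\mathcal U^A(t^{\mathrm{prin}})$, $\mathcal Z(t)$ is a basis of $\mathcal U^X(t)$.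
   Context: Seeds. A seed $s$ on a finite vertex set $J=J_{\mathrm{uf}}\sqcup J_{\mathrm f}$ (unfrozen, frozen) with integers $d_i>0$ ($i\in J$) has indeterminates $(A_i)_{i\in J}$, $(X_i)_{i\in J}$ and an integer matrix $B(s)=(b_{ij})_{i,j\in J}$ with $\frac1{d_i}b_{ij}=-\frac1{d_j}b_{ji}$. $N(s)=\mathbb{Z}^J$ has basis $\mathbf e_i$, $\mathbf f_i=\frac1{d_i}\mathbf e_i^*$, $M^\circ(s)=\bigoplus_i\mathbb{Z}\mathbf f_i\simeq\mathbb{Z}^J$, $M^\circ_{\mathrm f}(s)=\bigoplus_{j\in J_{\mathrm f}}\mathbb{Z}\mathbf f_j$. $p^*:N(s)\to M^\circ(s)$, $p^*\mathbf e_j=\sum_ib_{ij}\mathbf f_i$. $\omega(\mathbf e_i,\mathbf e_j)=\frac1{d_j}b_{ji}$ on $N(s)$. A compatible Poisson structure is a $\mathbb{Q}$-valued skew-symmetric form $\lambda$ on $M^\circ(s)$ with $\lambda(\mathbf f_i,p^*\mathbf e_k)=-\delta_{ik}\frac1{d_k}$ ($i\in J$, $k\in J_{\mathrm{uf}}$). $\mathrm{pr}$ is the projection $\mathbb{Z}^J\to\mathbb{Z}^{J_{\mathrm{uf}}}$ and $(\sigma w)_{\sigma k}=w_k$ for a permutation $\sigma$ of $J_{\mathrm{uf}}$. Principal coefficient seed. Given $t$ on $I=I_{\mathrm{uf}}\sqcup I_{\mathrm f}$, $t^{\mathrm{prin}}$ is the seed on $I\sqcup I'$, where $I'=\{i'\mid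 i\in I\}$ is a copy of $I$ consisting of extra frozen vertices, $d_{i'}=d_i$, unfrozen vertices $I_{\mathrm{uf}}$, and $B(t^{\mathrm{prin}})=\begin{pmatrix}B(t)&-\mathrm{Id}\\ \mathrm{Id}&0\end{pmatrix}$. Base ring. Classical case: $\Bbbk=\mathbb{Z}$, $v=1$. Quantum case: $\Bbbk=\mathbb{Z}[v^{\pm1/d'}]$, $d'$ sufficiently divisible, with a chosen compatible Poisson structure on $t^{\mathrm{prin}}$. $\mathcal{LP}^A(s)=\Bbbk[A_i^{\pm1}]$, $\mathcal{LP}^X(s)=\Bbbk[X_i^{\pm1}]$ have products $A^m*A^{m'}=v^{\lambda(m,m')}A^{m+m'}$, $X^n*X^{n'}=v^{-\omega(n,n')}X^{n+n'}$; $\cdot$ is the commutative product; $\mathcal F^\bullet(s)$ is the (skew-)field of fractions. $p^*:\mathcal{LP}^X(s)\to\mathcal{LP}^A(s)$ is the $\Bbbk$-linear map $X^n\mapsto A^{p^*n}$; it maps $\mathcal U^X(s)$ to $\mathcal U^A(s)$. Mutation at unfrozen $k$: $\mu_ks$ has $b'_{ij}=-b_{ij}$ if $k\in\{i,j\}$, $b'_{ij}=b_{ij}+b_{ik}[b_{kj}]_++[-b_{ik}]_+b_{kj}$ otherwise ($[x]_+=\max(x,0)$); $\lambda$ is transported by $M^\circ(\mu_ks)\to M^\circ(s)$, $\mathbf f'_i\mapsto\mathbf f_i$ ($i\ne k$), $\mathbf f'_k\mapsto-\mathbf f_k+\sum_j[-b_{jk}]_+\mathbf f_j$. $(\mu_k^\bullet)^*:\mathcal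 F^\bullet(\mu_ks)\to\mathcal F^\bullet(s)$: $A'_i\mapsto A_i$ ($i\ne k$), $A'_k\mapsto A^{-\mathbf f_k+\sum_j[-b_{jk}]_+\mathbf f_j}+A^{-\mathbf f_k+\sum_j[b_{jk}]_+\mathbf f_j}$; $X'_k\mapsto X_k^{-1}$, and for $i\ne k$, $X_i'\mapsto\sum_{r=0}^{-b_{ki}}\binom{-b_{ki}}{r}_{v_k}X_i\cdot X_k^r$ if $b_{ki}\le0$, $X'_i\mapsto\big(\sum_{r=0}^{b_{ki}}\binom{b_{ki}}{r}_{v_k}X_i^{-1}\cdot X_k^{r-b_{ki}}\big)^{-1}$ if $b_{ki}>0$, with $v_k=v^{1/d_k}$ and $\binom ab_q$ the symmetric quantum binomial built from $[a]_q=\frac{q^a-q^{-a}}{q-q^{-1}}$ (ordinary binomial if $v=1$). For $\boldsymbol\mu=\mu_{k_l}\cdots\mu_{k_1}$: $\boldsymbol\mu^*=\mu_{k_1}^*\cdots\mu_{k_l}^*$, $\boldsymbol\mu^{-1}=\mu_{k_1}\cdots\mu_{k_l}$; so $(\boldsymbol\mu^\bullet)^*:\mathcal F^\bullet(s)\to\mathcal F^\bullet(\boldsymbol\mu^{-1}s)$. $\mathcal U^\bullet(s)=\bigcap_{\boldsymbol\nu}\boldsymbol\nu^*\mathcal{LP}^\bullet(\boldsymbol\nu s)$ over all mutation sequences. Basis assumption on the $A$-side. For every seed $s$ obtained from $t^{\mathrm{prin}}$ by mutations, $\mathcal S(s)=\{S_m(s)\mid m\in\mathbb{Z}^{I\sqcup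 I'}\}$ with $S_m(s)=A(s)^m\cdot F_m(s)|_{X(s)^n\mapsto A(s)^{p^*n}}$ where $F_m(s)=\sum_{n\in\mathbb{N}^{I_{\mathrm{uf}}}}c_n(m;s)X(s)^n$ is a polynomial with $c_0(m;s)=1$, $c_n(m;s)\in\Bbbk$ (the $F$-polynomial of $S_m(s)$), such that: (i) $\boldsymbol\mu^*\mathcal S(s')=\mathcal S(s)$ whenever $s'=\boldsymbol\mu s$; (ii) $F_{m'}(s)=F_m(s)$ if $m'-m\in M^\circ_{\mathrm f}(s)$; and if $s,s'$ are similar up to $\sigma$ (i.e. $b_{ij}(s)=b_{\sigma i,\sigma j}(s')$, $d_i=d_{\sigma i}$ for $i,j\in I_{\mathrm{uf}}$) and $\mathrm{pr}\,m'=\sigma\,\mathrm{pr}\,m$, then $c_{\sigma n}(m';s')=c_n(m;s)$ for all $n$. *)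

theory Defs
  imports
    Complex_Main
    "HOL-Combinatorics.Permutations"
    "HOL-Library.Function_Algebras"
    "HOL-Library.Poly_Mapping"
    "HOL-Algebra.Ring"
begin

section \<open>Seeds\<close>

text \<open>
  The vertex set is a finite type \<open>'j\<close>. Both lattices \<open>N(s)\<close> (basis \<open>e_i\<close>) and \<open>M\<degree>(s)\<close> (basis
  \<open>f_i\<close>) are represented by coordinate vectors in \<open>'j \<Rightarrow> int\<close>, with pointwise operations.
\<close>

record 'j seed =
  unfrozen :: "'j set"
  dvec :: "'j \<Rightarrow> int"
  Bmat :: "'j \<Rightarrow> 'j \<Rightarrow> int"

type_synonym 'j lattice = "'j \<Rightarrow> int"

definition valid_seed :: "'j seed \<Rightarrow> bool" where
  "valid_seed s \<longleftrightarrow>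
     (\<forall>i. dvec s i > 0) \<and>
     (\<forall>i j. (of_int (Bmat s i j) / of_int (dvec s i) :: rat)
              = - (of_int (Bmat s j i) / of_int (dvec s j)))"

definition evec :: "'j \<Rightarrow> 'j lattice" where
  "evec i = (\<lambda>j. if j = i then 1 else 0)"

definition pos_part :: "int \<Rightarrow> int" where
  "pos_part x = max x 0"

definition pstar :: "('j::finite) seed \<Rightarrow> 'j lattice \<Rightarrow> 'j lattice" where
  "pstar s n = (\<lambda>i. \<Sum>j\<in>UNIV. Bmat s i j * n j)"

definition omega :: "('j::finite) seed \<Rightarrow> 'j lattice \<Rightarrow> 'j lattice \<Rightarrow> rat" where
  "omega s n n' =
     (\<Sum>i\<in>UNIV. \<Sum>j\<in>UNIV.
        of_int (n i) * of_int (n' j) * (of_int (Bmat s j i) / of_int (dvec s j)))"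

text \<open>A form \<open>\<lambda>\<close> on \<open>M\<degree>(s)\<close> is given by its matrix \<open>\<lambda>(f_i, f_j)\<close>.\<close>

definition form :: "(('j::finite) \<Rightarrow> 'j \<Rightarrow> rat) \<Rightarrow> 'j lattice \<Rightarrow> 'j lattice \<Rightarrow> rat" where
  "form lam m m' = (\<Sum>i\<in>UNIV. \<Sum>j\<in>UNIV. of_int (m i) * of_int (m' j) * lam i j)"

definition compatible :: "('j::finite) seed \<Rightarrow> ('j \<Rightarrow> 'j \<Rightarrow> rat) \<Rightarrow> bool" where
  "compatible s lam \<longleftrightarrow>
     (\<forall>i j. lam i j = - lam j i) \<and>
     (\<forall>i. \<forall>k\<in>unfrozen s.
        form lam (evec i) (pstar s (evec k)) = (if i = k then - (1 / of_int (dvec s k)) else 0))"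

definition prin :: "'i seed \<Rightarrow> ('i + 'i) seed" where
  "prin t =
     \<lparr> unfrozen = Inl ` unfrozen t,
       dvec = case_sum (dvec t) (dvec t),
       Bmat = (\<lambda>x y. case (x, y) of
           (Inl i, Inl j) \<Rightarrow> Bmat t i j
         | (Inl i, Inr j) \<Rightarrow> (if i = j then - 1 else 0)
         | (Inr i, Inl j) \<Rightarrow> (if i = j then 1 else 0)
         | (Inr i, Inr j) \<Rightarrow> 0) \<rparr>"


section \<open>Mutation of seeds\<close>

definition mut :: "'j \<Rightarrow> 'j seed \<Rightarrow> 'j seed" where
  "mut k s = s\<lparr> Bmat := (\<lambda>i j.
     if k = i \<or> k = j then - Bmat s i j
     else Bmat s i j + Bmat s i k * pos_part (Bmat s k j)
          + pos_part (- Bmat s i k) * Bmat s k j) \<rparr>"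

text \<open>On the \<open>A\<close>-side a seed carries in addition a form on \<open>M\<degree>(s)\<close>.\<close>

type_synonym 'j pseed = "'j seed \<times> ('j \<Rightarrow> 'j \<Rightarrow> rat)"

definition mut_basis :: "'j seed \<Rightarrow> 'j \<Rightarrow> 'j \<Rightarrow> 'j lattice" where
  "mut_basis s k i =
     (if i = k then (\<lambda>j. - evec k j + pos_part (- Bmat s j k)) else evec i)"

definition pmut :: "('j::finite) \<Rightarrow> 'j pseed \<Rightarrow> 'j pseed" where
  "pmut k sl = (case sl of (s, lam) \<Rightarrow>
     (mut k s, \<lambda>i j. form lam (mut_basis s k i) (mut_basis s k j)))"

text \<open>
  A list \<open>[k1, \<dots>, kl]\<close> of unfrozen vertices stands for the mutation sequence \<open>\<mu>_kl \<cdots> \<mu>_k1\<close>,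
  i.e. \<open>k1\<close> is applied first.
\<close>

definition mut_seq :: "'j list \<Rightarrow> 'j seed \<Rightarrow> 'j seed" where
  "mut_seq ks s = fold mut ks s"

definition pmut_seq :: "('j::finite) list \<Rightarrow> 'j pseed \<Rightarrow> 'j pseed" where
  "pmut_seq ks sl = fold pmut ks sl"

definition reachable :: "('j::finite) pseed \<Rightarrow> 'j pseed set" where
  "reachable sl = {pmut_seq ks sl | ks. set ks \<subseteq> unfrozen (fst sl)}"


section \<open>Base ring\<close>

text \<open>
  The base ring is the whole type \<open>'k\<close>, and \<open>v a\<close> stands for the power \<open>v^a\<close> with rational
  exponent \<open>a\<close>. Laurent polynomials over the integers in one variable are \<open>int \<Rightarrow>\<^sub>0 int\<close>, so
  \<open>quantum_base D v\<close> says that \<open>'k\<close> is the ring of Laurent polynomials in \<open>v^(1/D)\<close>; values of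
  \<open>v\<close> outside \<open>(1/D)\<int>\<close> are irrelevant.
\<close>

definition classical_base :: "(rat \<Rightarrow> 'k::comm_ring_1) \<Rightarrow> bool" where
  "classical_base v \<longleftrightarrow> bij (of_int :: int \<Rightarrow> 'k) \<and> v = (\<lambda>_. 1)"

definition quantum_base :: "int \<Rightarrow> (rat \<Rightarrow> 'k::comm_ring_1) \<Rightarrow> bool" where
  "quantum_base D v \<longleftrightarrow> D > 0 \<and>
     (\<exists>\<phi> :: (int \<Rightarrow>\<^sub>0 int) \<Rightarrow> 'k.
        bij \<phi> \<and> \<phi> 1 = 1 \<and>
        (\<forall>x y. \<phi> (x + y) = \<phi> x + \<phi> y) \<and> (\<forall>x y. \<phi> (x * y) = \<phi> x * \<phi> y) \<and>
        (\<forall>a. v (of_int a / of_int D) = \<phi> (Poly_Mapping.single a 1)))"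

text \<open>
  Under these conditions all exponents of \<open>v\<close> that occur (values of \<open>\<lambda>\<close> and \<open>\<omega>\<close>, and multiples of
  \<open>1/d_k\<close>), for \<open>s\<close> and for all seeds obtained from it by mutation, lie in \<open>(1/D)\<int>\<close>.
\<close>

definition sufficiently_divisible ::
    "int \<Rightarrow> 'j seed \<Rightarrow> ('j \<Rightarrow> 'j \<Rightarrow> rat) \<Rightarrow> bool" where
  "sufficiently_divisible D s lam \<longleftrightarrow>
     (\<forall>i. dvec s i dvd D) \<and> (\<forall>i j. of_int D * lam i j \<in> \<int>)"

text \<open>In the classical case no Poisson structure is chosen; we then put \<open>\<lambda> = 0\<close>.\<close>

definition base_setup ::
    "(rat \<Rightarrow> 'k::comm_ring_1) \<Rightarrow> ('j::finite) seed \<Rightarrow> ('j \<Rightarrow> 'j \<Rightarrow> rat) \<Rightarrow> bool" where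
  "base_setup v s lam \<longleftrightarrow>
     (classical_base v \<and> lam = (\<lambda>_ _. 0)) \<or>
     (compatible s lam \<and> (\<exists>D. quantum_base D v \<and> sufficiently_divisible D s lam))"

text \<open>
  Symmetric quantum integers and binomials at \<open>q = v^x\<close>:
  \<open>[a]_q = (q^a - q^(-a)) / (q - q^(-1)) = q^(a-1) + q^(a-3) + \<cdots> + q^(1-a)\<close>, which also makes
  sense (and equals \<open>a\<close>) at \<open>v = 1\<close>.
\<close>

definition qint :: "(rat \<Rightarrow> 'k::comm_ring_1) \<Rightarrow> rat \<Rightarrow> nat \<Rightarrow> 'k" where
  "qint v x a = (\<Sum>i<a. v (x * (of_nat a - 1 - 2 * of_nat i)))"

definition qfact :: "(rat \<Rightarrow> 'k::comm_ring_1) \<Rightarrow> rat \<Rightarrow> nat \<Rightarrow> 'k" where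
  "qfact v x a = (\<Prod>i=1..a. qint v x i)"

definition qbinom :: "(rat \<Rightarrow> 'k::comm_ring_1) \<Rightarrow> rat \<Rightarrow> nat \<Rightarrow> nat \<Rightarrow> 'k" where
  "qbinom v x a b = (THE c. c * (qfact v x b * qfact v x (a - b)) = qfact v x a)"


section \<open>Quantum tori and their skew-fields of fractions\<close>

text \<open>
  Elements of \<open>LP\<close> are finitely supported coefficient functions on the lattice. The multiplication
  \<open>*\<close> of the type \<open>'j lattice \<Rightarrow>\<^sub>0 'k\<close> is the commutative product, while
  \<open>twisted_mult\<close> is the product \<open>X^m X^m' = v^\<beta>(m,m') X^(m+m')\<close>.
\<close>

type_synonym ('j, 'k) laurent = "('j \<Rightarrow> int) \<Rightarrow>\<^sub>0 'k"

definition twisted_mult ::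
    "(rat \<Rightarrow> 'k::comm_ring_1) \<Rightarrow> ('j lattice \<Rightarrow> 'j lattice \<Rightarrow> rat) \<Rightarrow>
     ('j, 'k) laurent \<Rightarrow> ('j, 'k) laurent \<Rightarrow> ('j, 'k) laurent" where
  "twisted_mult v \<beta> f g =
     (\<Sum>m\<in>Poly_Mapping.keys f. \<Sum>m'\<in>Poly_Mapping.keys g.
        Poly_Mapping.single (m + m')
          (v (\<beta> m m') * Poly_Mapping.lookup f m * Poly_Mapping.lookup g m'))"

definition quantum_torus ::
    "(rat \<Rightarrow> 'k::comm_ring_1) \<Rightarrow> ('j lattice \<Rightarrow> 'j lattice \<Rightarrow> rat) \<Rightarrow>
     ('j, 'k) laurent ring" where
  "quantum_torus v \<beta> =
     \<lparr> carrier = UNIV, mult = twisted_mult v \<beta>, one = Poly_Mapping.single 0 1,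
       zero = 0, add = (+) \<rparr>"

definition LPA :: "(rat \<Rightarrow> 'k::comm_ring_1) \<Rightarrow> ('j::finite) pseed \<Rightarrow> ('j, 'k) laurent ring" where
  "LPA v sl = quantum_torus v (form (snd sl))"

definition LPX :: "(rat \<Rightarrow> 'k::comm_ring_1) \<Rightarrow> ('j::finite) seed \<Rightarrow> ('j, 'k) laurent ring" where
  "LPX v s = quantum_torus v (\<lambda>n n'. - omega s n n')"

text \<open>
  The skew-field of fractions of a right Ore domain \<open>R\<close>. The class \<open>ore_class R a b\<close> represents
  the right fraction \<open>a b^(-1)\<close>; two fractions agree iff they agree after expansion to a common
  denominator. For the product, \<open>b^(-1) c = u w^(-1)\<close> as soon as \<open>b u = c w\<close>.
\<close>

definition ore_class :: "('a, 'm) ring_scheme \<Rightarrow> 'a \<Rightarrow> 'a \<Rightarrow> ('a \<times> 'a) set" where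
  "ore_class R a b =
     {(c, d). c \<in> carrier R \<and> d \<in> carrier R - {\<zero>\<^bsub>R\<^esub>} \<and>
        (\<exists>u\<in>carrier R - {\<zero>\<^bsub>R\<^esub>}. \<exists>w\<in>carrier R - {\<zero>\<^bsub>R\<^esub>}.
           a \<otimes>\<^bsub>R\<^esub> u = c \<otimes>\<^bsub>R\<^esub> w \<and> b \<otimes>\<^bsub>R\<^esub> u = d \<otimes>\<^bsub>R\<^esub> w)}"

definition ore_mult :: "('a, 'm) ring_scheme \<Rightarrow> ('a \<times> 'a) set \<Rightarrow> ('a \<times> 'a) set \<Rightarrow> ('a \<times> 'a) set" where
  "ore_mult R P Q =
     \<Union> {ore_class R (a \<otimes>\<^bsub>R\<^esub> u) (d \<otimes>\<^bsub>R\<^esub> w) | a b c d u w.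
          (a, b) \<in> P \<and> (c, d) \<in> Q \<and> u \<in> carrier R \<and> w \<in> carrier R - {\<zero>\<^bsub>R\<^esub>} \<and>
          b \<otimes>\<^bsub>R\<^esub> u = c \<otimes>\<^bsub>R\<^esub> w}"

definition ore_add :: "('a, 'm) ring_scheme \<Rightarrow> ('a \<times> 'a) set \<Rightarrow> ('a \<times> 'a) set \<Rightarrow> ('a \<times> 'a) set" where
  "ore_add R P Q =
     \<Union> {ore_class R ((a \<otimes>\<^bsub>R\<^esub> u) \<oplus>\<^bsub>R\<^esub> (c \<otimes>\<^bsub>R\<^esub> w)) (b \<otimes>\<^bsub>R\<^esub> u) | a b c d u w.
          (a, b) \<in> P \<and> (c, d) \<in> Q \<and>
          u \<in> carrier R - {\<zero>\<^bsub>R\<^esub>} \<and> w \<in> carrier R - {\<zero>\<^bsub>R\<^esub>} \<and>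
          b \<otimes>\<^bsub>R\<^esub> u = d \<otimes>\<^bsub>R\<^esub> w}"

definition ore_frac :: "('a, 'm) ring_scheme \<Rightarrow> (('a \<times> 'a) set) ring" where
  "ore_frac R =
     \<lparr> carrier = {ore_class R a b | a b. a \<in> carrier R \<and> b \<in> carrier R - {\<zero>\<^bsub>R\<^esub>}},
       mult = ore_mult R, one = ore_class R \<one>\<^bsub>R\<^esub> \<one>\<^bsub>R\<^esub>,
       zero = ore_class R \<zero>\<^bsub>R\<^esub> \<one>\<^bsub>R\<^esub>, add = ore_add R \<rparr>"

definition ore_embed :: "('a, 'm) ring_scheme \<Rightarrow> 'a \<Rightarrow> ('a \<times> 'a) set" where
  "ore_embed R a = ore_class R a \<one>\<^bsub>R\<^esub>"

type_synonym ('j, 'k) frac = "(('j, 'k) laurent \<times> ('j, 'k) laurent) set"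

definition FA :: "(rat \<Rightarrow> 'k::comm_ring_1) \<Rightarrow> ('j::finite) pseed \<Rightarrow> ('j, 'k) frac ring" where
  "FA v sl = ore_frac (LPA v sl)"

definition FX :: "(rat \<Rightarrow> 'k::comm_ring_1) \<Rightarrow> ('j::finite) seed \<Rightarrow> ('j, 'k) frac ring" where
  "FX v s = ore_frac (LPX v s)"

definition embA :: "(rat \<Rightarrow> 'k::comm_ring_1) \<Rightarrow> ('j::finite) pseed \<Rightarrow> ('j, 'k) laurent \<Rightarrow> ('j, 'k) frac" where
  "embA v sl = ore_embed (LPA v sl)"

definition embX :: "(rat \<Rightarrow> 'k::comm_ring_1) \<Rightarrow> ('j::finite) seed \<Rightarrow> ('j, 'k) laurent \<Rightarrow> ('j, 'k) frac" where
  "embX v s = ore_embed (LPX v s)"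


section \<open>Mutation maps\<close>

definition mutA_image :: "'j seed \<Rightarrow> 'j \<Rightarrow> 'j \<Rightarrow> ('j, 'k::comm_ring_1) laurent" where
  "mutA_image s k i =
     (if i = k then
        Poly_Mapping.single (\<lambda>j. - evec k j + pos_part (- Bmat s j k)) 1
        + Poly_Mapping.single (\<lambda>j. - evec k j + pos_part (Bmat s j k)) 1
      else Poly_Mapping.single (evec i) 1)"

text \<open>
  \<open>mutA v sl k\<close> is the homomorphism of \<open>\<k>\<close>-algebras \<open>(\<mu>_k^A)^* : F^A(\<mu>_k s) \<rightarrow> F^A(s)\<close> with the
  prescribed values on the \<open>A'_i\<close>; these conditions determine it on the carrier of \<open>F^A(\<mu>_k s)\<close>, the
  only place where it is used.
\<close>

definition mutA ::
    "(rat \<Rightarrow> 'k::comm_ring_1) \<Rightarrow> ('j::finite) pseed \<Rightarrow> 'j \<Rightarrow> ('j, 'k) frac \<Rightarrow> ('j, 'k) frac" where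
  "mutA v sl k = (SOME \<phi>. \<phi> \<in> ring_hom (FA v (pmut k sl)) (FA v sl) \<and>
     (\<forall>c. \<phi> (embA v (pmut k sl) (Poly_Mapping.single 0 c)) = embA v sl (Poly_Mapping.single 0 c)) \<and>
     (\<forall>i. \<phi> (embA v (pmut k sl) (Poly_Mapping.single (evec i) 1))
            = embA v sl (mutA_image (fst sl) k i)))"

definition mutX_image ::
    "(rat \<Rightarrow> 'k::comm_ring_1) \<Rightarrow> ('j::finite) seed \<Rightarrow> 'j \<Rightarrow> 'j \<Rightarrow> ('j, 'k) frac" where
  "mutX_image v s k i =
     (let b = Bmat s k i; x = 1 / of_int (dvec s k) in
      if i = k then embX v s (Poly_Mapping.single (\<lambda>j. - evec k j) 1)
      else if b \<le> 0 then
        embX v s (\<Sum>r\<le>nat (- b).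
          Poly_Mapping.single (\<lambda>j. evec i j + int r * evec k j) (qbinom v x (nat (- b)) r))
      else
        m_inv (FX v s) (embX v s (\<Sum>r\<le>nat b.
          Poly_Mapping.single (\<lambda>j. - evec i j + (int r - b) * evec k j) (qbinom v x (nat b) r))))"

definition mutX ::
    "(rat \<Rightarrow> 'k::comm_ring_1) \<Rightarrow> ('j::finite) seed \<Rightarrow> 'j \<Rightarrow> ('j, 'k) frac \<Rightarrow> ('j, 'k) frac" where
  "mutX v s k = (SOME \<phi>. \<phi> \<in> ring_hom (FX v (mut k s)) (FX v s) \<and>
     (\<forall>c. \<phi> (embX v (mut k s) (Poly_Mapping.single 0 c)) = embX v s (Poly_Mapping.single 0 c)) \<and>
     (\<forall>i. \<phi> (embX v (mut k s) (Poly_Mapping.single (evec i) 1)) = mutX_image v s k i))"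

text \<open>\<open>mutA_seq v ks s : F^A(\<mu> s) \<rightarrow> F^A(s)\<close> is \<open>\<mu>_k1^* \<circ> \<cdots> \<circ> \<mu>_kl^*\<close> for \<open>ks = [k1, \<dots>, kl]\<close>.\<close>

fun mutA_seq ::
    "(rat \<Rightarrow> 'k::comm_ring_1) \<Rightarrow> 'j list \<Rightarrow> ('j::finite) pseed \<Rightarrow> ('j, 'k) frac \<Rightarrow> ('j, 'k) frac" where
  "mutA_seq v [] sl = id"
| "mutA_seq v (k # ks) sl = mutA v sl k \<circ> mutA_seq v ks (pmut k sl)"

fun mutX_seq ::
    "(rat \<Rightarrow> 'k::comm_ring_1) \<Rightarrow> 'j list \<Rightarrow> ('j::finite) seed \<Rightarrow> ('j, 'k) frac \<Rightarrow> ('j, 'k) frac" where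
  "mutX_seq v [] s = id"
| "mutX_seq v (k # ks) s = mutX v s k \<circ> mutX_seq v ks (mut k s)"


section \<open>Upper cluster algebras\<close>

text \<open>
  The intersection over all mutation sequences \<open>\<nu>\<close> contains the term \<open>LP(s)\<close> of the empty sequence,
  so it is taken as a subset of \<open>LP(s)\<close>.
\<close>

definition UA :: "(rat \<Rightarrow> 'k::comm_ring_1) \<Rightarrow> ('j::finite) pseed \<Rightarrow> ('j, 'k) laurent set" where
  "UA v sl = {f. \<forall>ks. set ks \<subseteq> unfrozen (fst sl) \<longrightarrow>
     embA v sl f \<in> mutA_seq v ks sl ` embA v (pmut_seq ks sl) ` carrier (LPA v (pmut_seq ks sl))}"

definition UX :: "(rat \<Rightarrow> 'k::comm_ring_1) \<Rightarrow> ('j::finite) seed \<Rightarrow> ('j, 'k) laurent set" where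
  "UX v s = {f. \<forall>ks. set ks \<subseteq> unfrozen s \<longrightarrow>
     embX v s f \<in> mutX_seq v ks s ` embX v (mut_seq ks s) ` carrier (LPX v (mut_seq ks s))}"

definition pstar_map ::
    "('j::finite) seed \<Rightarrow> ('j, 'k::comm_ring_1) laurent \<Rightarrow> ('j, 'k) laurent" where
  "pstar_map s f =
     (\<Sum>n\<in>Poly_Mapping.keys f. Poly_Mapping.single (pstar s n) (Poly_Mapping.lookup f n))"


section \<open>Modules over the base ring\<close>

definition lscale :: "'k::comm_ring_1 \<Rightarrow> ('j, 'k) laurent \<Rightarrow> ('j, 'k) laurent" where
  "lscale c f = Poly_Mapping.map ((*) c) f"

abbreviation lspan :: "('j, 'k::comm_ring_1) laurent set \<Rightarrow> ('j, 'k) laurent set" where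
  "lspan \<equiv> module.span lscale"

definition is_basis ::
    "('j, 'k::comm_ring_1) laurent set \<Rightarrow> ('j, 'k) laurent set \<Rightarrow> bool" where
  "is_basis U Z \<longleftrightarrow> \<not> module.dependent lscale Z \<and> lspan Z = U"


section \<open>The basis assumption\<close>

text \<open>
  An \<open>F\<close>-polynomial \<open>\<Sum> c_n X^n\<close> is an element of \<open>LP^X\<close>; the substitution \<open>X^n \<mapsto> A^(p^* n)\<close> is
  \<open>pstar_map\<close>. A family \<open>Fp\<close> assigns to a seed \<open>s\<close> (with form) and a degree \<open>m\<close> the polynomial
  \<open>F_m(s)\<close>.
\<close>

definition S_elt ::
    "('j::finite) seed \<Rightarrow> ('j lattice \<Rightarrow> ('j, 'k::comm_ring_1) laurent) \<Rightarrow>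
     'j lattice \<Rightarrow> ('j, 'k) laurent" where
  "S_elt s F m = Poly_Mapping.single m 1 * pstar_map s (F m)"

definition S_set ::
    "('j::finite) pseed \<Rightarrow> ('j pseed \<Rightarrow> 'j lattice \<Rightarrow> ('j, 'k::comm_ring_1) laurent) \<Rightarrow>
     ('j, 'k) laurent set" where
  "S_set sl Fp = S_elt (fst sl) (Fp sl) ` UNIV"

definition nonneg_unfrozen :: "'j seed \<Rightarrow> 'j lattice set" where
  "nonneg_unfrozen s = {n. (\<forall>i. n i \<ge> 0) \<and> (\<forall>i. i \<notin> unfrozen s \<longrightarrow> n i = 0)}"

text \<open>\<open>(\<sigma> w)_(\<sigma> k) = w_k\<close>\<close>

definition perm_act :: "('j \<Rightarrow> 'j) \<Rightarrow> 'j lattice \<Rightarrow> 'j lattice" where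
  "perm_act \<sigma> w = (\<lambda>i. w (inv_into UNIV \<sigma> i))"

definition similar_via :: "('j \<Rightarrow> 'j) \<Rightarrow> 'j seed \<Rightarrow> 'j seed \<Rightarrow> bool" where
  "similar_via \<sigma> s s' \<longleftrightarrow> \<sigma> permutes unfrozen s \<and>
     (\<forall>i\<in>unfrozen s. \<forall>j\<in>unfrozen s. Bmat s i j = Bmat s' (\<sigma> i) (\<sigma> j)) \<and>
     (\<forall>i\<in>unfrozen s. dvec s i = dvec s' (\<sigma> i))"

text \<open>
  In the second conjunct, taking \<open>\<mu> s\<close> to be the initial seed \<open>sl0\<close> gives
  \<open>S(\<mu>^(-1) sl0) = \<mu>^* S(sl0)\<close>.
\<close>

definition basis_assumption ::
    "(rat \<Rightarrow> 'k::comm_ring_1) \<Rightarrow> ('j::finite) pseed \<Rightarrow>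
     ('j pseed \<Rightarrow> 'j lattice \<Rightarrow> ('j, 'k) laurent) \<Rightarrow> bool" where
  "basis_assumption v sl0 Fp \<longleftrightarrow>
     (\<forall>sl\<in>reachable sl0. \<forall>m.
        Poly_Mapping.keys (Fp sl m) \<subseteq> nonneg_unfrozen (fst sl) \<and>
        Poly_Mapping.lookup (Fp sl m) 0 = 1) \<and>
     (\<forall>sl\<in>reachable sl0. \<forall>ks. set ks \<subseteq> unfrozen (fst sl) \<longrightarrow>
        mutA_seq v ks sl ` embA v (pmut_seq ks sl) ` S_set (pmut_seq ks sl) Fp
          = embA v sl ` S_set sl Fp) \<and>
     (\<forall>sl\<in>reachable sl0. \<forall>m m'.
        (\<forall>i\<in>unfrozen (fst sl). (m' - m) i = 0) \<longrightarrow> Fp sl m' = Fp sl m) \<and>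
     (\<forall>sl\<in>reachable sl0. \<forall>sl'\<in>reachable sl0. \<forall>\<sigma> m m'.
        similar_via \<sigma> (fst sl) (fst sl') \<and>
        (\<forall>k\<in>unfrozen (fst sl). m' (\<sigma> k) = m k) \<longrightarrow>
        (\<forall>n\<in>nonneg_unfrozen (fst sl).
           Poly_Mapping.lookup (Fp sl' m') (perm_act \<sigma> n) = Poly_Mapping.lookup (Fp sl m) n))"


section \<open>The elements \<open>Z_n(t)\<close>\<close>

text \<open>The degree \<open>(B(t) n, n)\<close> in \<open>\<int>^(I \<squnion> I')\<close>.\<close>

definition prin_degree :: "('i::finite) seed \<Rightarrow> 'i lattice \<Rightarrow> ('i + 'i) lattice" where
  "prin_degree t n = case_sum (pstar t n) n"

text \<open>
  \<open>F\<close>-polynomials for \<open>prin t\<close> only involve variables \<open>X_i\<close> with \<open>i\<close> in \<open>I_uf \<subseteq> I\<close>; \<open>restrict_poly\<close>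
  reads such a polynomial as an element of \<open>LP^X(t)\<close>.
\<close>

definition restrict_poly :: "('i + 'i, 'k::comm_ring_1) laurent \<Rightarrow> ('i, 'k) laurent" where
  "restrict_poly F =
     (\<Sum>n\<in>Poly_Mapping.keys F. Poly_Mapping.single (n \<circ> Inl) (Poly_Mapping.lookup F n))"

definition Z_elt ::
    "('i::finite) seed \<Rightarrow> (('i + 'i) lattice \<Rightarrow> ('i + 'i, 'k::comm_ring_1) laurent) \<Rightarrow>
     'i lattice \<Rightarrow> ('i, 'k) laurent" where
  "Z_elt t F n = Poly_Mapping.single n 1 * restrict_poly (F (prin_degree t n))"

definition Z_set ::
    "('i::finite) seed \<Rightarrow> (('i + 'i) lattice \<Rightarrow> ('i + 'i, 'k::comm_ring_1) laurent) \<Rightarrow>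
     ('i, 'k) laurent set" where
  "Z_set t F = Z_elt t F ` UNIV"

end

(*
  On monomials, mutation has the same shape on both sides: X'^m is sent to
  X^(tau m) * prod_{i >= h(tau m)} (1 + q^(2i+1) X^e) / prod_{i >= 0} (1 + q^(2i+1) X^e),
  with e = e_k, h(n) = (p^* n)_k on the X-side and e = p^* e_k, h(m) = m_k on the A-side. Cutting both
  products off at a large N shows that a mutation map takes a / b to num_N(a) / num_N(b) for an
  explicit linear map num_N between quantum tori.

  The map q = p^* restricted to N(t) in N(t^prin) commutes with num_N for all pairs of seeds obtained
  from t and t^prin by the same mutations. It is not multiplicative, but it preserves products with
  one factor in the unfrozen variables, and denominators stay there. So every f in U^X(t) has
  q f in U^A(t^prin), and q Z_n(t) = S_m(t^prin). Conversely, the cokernel of q is torsion-free and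
  grades the A-side torus compatibly with mutation. If S_m = mu^* S_m' has degree 0 then so does S_m', hence
  S_m' = q z, and Z_n(t) = mu^* z by injectivity of q: this gives Z_n(t) in U^X(t). Projecting an
  expansion of q f in the S_m to degree 0 expands f in the Z_n(t), which are independent because
  their F-polynomials have constant term 1.
*)

theory Submission
  imports
    Defs
    "HOL-Algebra.RingHom"
begin

section \<open>Ore localization\<close>

text \<open>The mutation maps are given only as some homomorphism with prescribed values on
  generators, so they say nothing until such a homomorphism is known to exist and to be unique.
  Existence needs a genuine skew-field of fractions with its universal property, hence the Ore
  localization and, for the Ore condition, a count of unknowns in boxes of exponents. The cut-off is
  harmless because raising it multiplies numerator and denominator by the same right factor.

  The map q need not be multiplicative because compatibility controls the form against
  \<open>p^* e_k\<close> for unfrozen \<open>k\<close> only. It therefore need not extend to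
  fractions, and numerators and denominators are transported separately, through equations f b = a
  in which the denominator b is the right factor. The identity block of \<open>prin t\<close> makes
  q injective even if the matrix of \<open>t\<close> is singular. This allows equations to be pulled
  back, and it also keeps \<open>p^* e_k\<close> nonzero at every mutated seed, without which the
  A-side factors would degenerate to constants.\<close>

lemma (in monoid) inv_mult_Units:
  assumes "x \<in> Units G" "y \<in> Units G"
  shows "inv (x \<otimes> y) = inv y \<otimes> inv x"
proof (rule inv_unique'[symmetric])
  have c: "x \<in> carrier G" "y \<in> carrier G" "inv x \<in> carrier G" "inv y \<in> carrier G"
    using assms by auto
  have "x \<otimes> y \<otimes> (inv y \<otimes> inv x) = x \<otimes> (y \<otimes> inv y) \<otimes> inv x"
    using c by (simp only: m_assoc m_closed)
  then show "x \<otimes> y \<otimes> (inv y \<otimes> inv x) = \<one>"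
    using assms c by simp
  have "inv y \<otimes> inv x \<otimes> (x \<otimes> y) = inv y \<otimes> (inv x \<otimes> x) \<otimes> y"
    using c by (simp only: m_assoc m_closed)
  then show "inv y \<otimes> inv x \<otimes> (x \<otimes> y) = \<one>"
    using assms c by simp
qed (use assms in auto)

locale ore_domain = ring R for R (structure) +
  assumes one_not_zero: "\<one> \<noteq> \<zero>"
    and integral: "\<lbrakk>a \<in> carrier R; b \<in> carrier R; a \<otimes> b = \<zero>\<rbrakk> \<Longrightarrow> a = \<zero> \<or> b = \<zero>"
    and ore_condition: "\<lbrakk>a \<in> carrier R; b \<in> carrier R - {\<zero>}\<rbrakk> \<Longrightarrow>
      \<exists>u\<in>carrier R. \<exists>w\<in>carrier R - {\<zero>}. b \<otimes> u = a \<otimes> w"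
begin

abbreviation nz where "nz \<equiv> carrier R - {\<zero>}"

lemma nz_mult: "a \<in> nz \<Longrightarrow> b \<in> nz \<Longrightarrow> a \<otimes> b \<in> nz"
  using integral by auto

lemma nz_one: "\<one> \<in> nz"
  using one_not_zero by auto

lemma cancel_left:
  assumes "a \<in> nz" "b \<in> carrier R" "c \<in> carrier R" "a \<otimes> b = a \<otimes> c"
  shows "b = c"
proof -
  have "a \<otimes> (b \<ominus> c) = \<zero>"
    using assms by (simp add: minus_eq r_distr r_minus r_neg)
  then have "b \<ominus> c = \<zero>"
    using assms integral by blast
  then show ?thesis
    using assms(2,3) by (metis a_inv_closed minus_equality minus_eq minus_minus r_neg a_comm)
qed

lemma cancel_right:
  assumes "a \<in> nz" "b \<in> carrier R" "c \<in> carrier R" "b \<otimes> a = c \<otimes> a"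
  shows "b = c"
proof -
  have "(b \<ominus> c) \<otimes> a = \<zero>"
    using assms by (simp add: minus_eq l_distr l_minus r_neg)
  then have "b \<ominus> c = \<zero>"
    using assms integral by blast
  then show ?thesis
    using assms(2,3) by (metis a_inv_closed minus_equality minus_eq minus_minus r_neg a_comm)
qed

lemma common_multiple:
  assumes "a \<in> nz" "b \<in> nz"
  obtains u w where "u \<in> nz" "w \<in> nz" "b \<otimes> u = a \<otimes> w"
proof -
  obtain u w where uw: "u \<in> carrier R" "w \<in> nz" "b \<otimes> u = a \<otimes> w"
    using ore_condition[of a b] assms by auto
  moreover have "u \<noteq> \<zero>"
  proof
    assume "u = \<zero>"
    then have "a \<otimes> w = \<zero>"
      using uw assms by simp
    then show False
      using nz_mult[of a w] uw assms by auto
  qed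
  ultimately show ?thesis
    using that by auto
qed

section \<open>Equality and arithmetic of right fractions\<close>

definition eqv where
  "eqv a b c d \<longleftrightarrow> (\<exists>u\<in>nz. \<exists>w\<in>nz. a \<otimes> u = c \<otimes> w \<and> b \<otimes> u = d \<otimes> w)"

lemma eqv_refl: "a \<in> carrier R \<Longrightarrow> b \<in> nz \<Longrightarrow> eqv a b a b"
  unfolding eqv_def using nz_one by blast

lemma eqv_sym: "eqv a b c d \<Longrightarrow> eqv c d a b"
  unfolding eqv_def by metis

text \<open>Turns the existential in \<open>eqv\<close> into a test on any multipliers that equalise
  the denominators. A common right multiple of \<open>u\<close> and the witness \<open>x\<close>
  compares the two expansions; cancelling \<open>d\<close> on the left transfers the comparison to
  the numerators.\<close>

lemma eqv_test:
  assumes ac: "a \<in> carrier R" "c \<in> carrier R" "b \<in> nz" "d \<in> nz"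
    and e: "eqv a b c d" and uw: "u \<in> carrier R" "w \<in> carrier R" "b \<otimes> u = d \<otimes> w"
  shows "a \<otimes> u = c \<otimes> w"
proof (cases "u = \<zero>")
  case True
  then have "d \<otimes> w = \<zero>"
    using uw ac by simp
  then have "w = \<zero>"
    using integral ac uw by blast
  then show ?thesis
    using True ac by simp
next
  case False
  then have u: "u \<in> nz"
    using uw by auto
  obtain x y where xy: "x \<in> nz" "y \<in> nz" "a \<otimes> x = c \<otimes> y" "b \<otimes> x = d \<otimes> y"
    using e unfolding eqv_def by blast
  obtain p q where pq: "p \<in> nz" "q \<in> nz" "u \<otimes> p = x \<otimes> q"
    using common_multiple[of x u] xy u by blast
  have "d \<otimes> (w \<otimes> p) = d \<otimes> w \<otimes> p"
    using uw ac pq by (simp add: m_assoc)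
  also have "\<dots> = b \<otimes> (u \<otimes> p)"
    unfolding uw(3)[symmetric] using pq ac uw(1) by (simp add: m_assoc)
  also have "\<dots> = b \<otimes> x \<otimes> q"
    unfolding pq(3) using pq(1,2) xy(1,2) ac by (simp add: m_assoc)
  also have "\<dots> = d \<otimes> (y \<otimes> q)"
    unfolding xy(4) using pq(1,2) xy(1,2) ac by (simp add: m_assoc)
  finally have wp: "w \<otimes> p = y \<otimes> q"
    by (rule cancel_left[OF ac(4), rotated 2]) (use uw pq xy in auto)
  have "a \<otimes> u \<otimes> p = a \<otimes> (u \<otimes> p)"
    using pq ac uw by (simp add: m_assoc)
  also have "\<dots> = a \<otimes> x \<otimes> q"
    unfolding pq(3) using pq(1,2) xy(1,2) ac by (simp add: m_assoc)
  also have "\<dots> = c \<otimes> (y \<otimes> q)"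
    unfolding xy(3) using pq(1,2) xy(1,2) ac by (simp add: m_assoc)
  also have "\<dots> = c \<otimes> w \<otimes> p"
    unfolding wp[symmetric] using pq(1,2) ac uw(2) by (simp add: m_assoc)
  finally show ?thesis
    by (rule cancel_right[OF pq(1), rotated 2]) (use ac uw in auto)
qed

lemma eqv_trans:
  assumes "a \<in> carrier R" "c \<in> carrier R" "e \<in> carrier R" "b \<in> nz" "d \<in> nz" "f \<in> nz"
    and "eqv a b c d" "eqv c d e f"
  shows "eqv a b e f"
proof -
  obtain u w where uw: "u \<in> nz" "w \<in> nz" "b \<otimes> u = d \<otimes> w"
    using common_multiple[of d b] assms by blast
  obtain p q where pq: "p \<in> nz" "q \<in> nz" "d \<otimes> w \<otimes> p = f \<otimes> q"
    using common_multiple[OF assms(6) nz_mult[OF assms(5) uw(2)]] by blast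
  have 1: "a \<otimes> u = c \<otimes> w"
    using eqv_test[of a c b d] assms uw by auto
  have 2: "c \<otimes> (w \<otimes> p) = e \<otimes> q"
    using eqv_test[of c e d f "w \<otimes> p" q] assms uw pq by (auto simp: m_assoc)
  have "a \<otimes> (u \<otimes> p) = e \<otimes> q" "b \<otimes> (u \<otimes> p) = f \<otimes> q"
    using 1 2 uw pq assms by (simp_all add: m_assoc[symmetric])
  then show ?thesis
    unfolding eqv_def using nz_mult uw pq by metis
qed

lemma ore_class_mem:
  "(c, d) \<in> ore_class R a b \<longleftrightarrow> c \<in> carrier R \<and> d \<in> nz \<and> eqv a b c d"
  unfolding ore_class_def eqv_def by auto

lemma ore_class_eq_iff:
  assumes "a \<in> carrier R" "c \<in> carrier R" "b \<in> nz" "d \<in> nz"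
  shows "ore_class R a b = ore_class R c d \<longleftrightarrow> eqv a b c d"
proof
  assume "ore_class R a b = ore_class R c d"
  then have "(c, d) \<in> ore_class R a b"
    using assms eqv_refl ore_class_mem by simp
  then show "eqv a b c d"
    using ore_class_mem by simp
next
  assume e: "eqv a b c d"
  have "eqv a b x y \<longleftrightarrow> eqv c d x y" if xy: "x \<in> carrier R" "y \<in> nz" for x y
  proof
    show "eqv c d x y" if "eqv a b x y"
      by (rule eqv_trans[OF assms(2,1) xy(1) assms(4,3) xy(2) eqv_sym[OF e] that])
    show "eqv a b x y" if "eqv c d x y"
      by (rule eqv_trans[OF assms(1,2) xy(1) assms(3,4) xy(2) e that])
  qed
  then show "ore_class R a b = ore_class R c d"
    using ore_class_mem by (auto simp: set_eq_iff simp del: Diff_iff)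
qed

lemma ore_class_eqI:
  assumes "a \<in> carrier R" "c \<in> carrier R" "b \<in> nz" "d \<in> nz" "u \<in> nz" "w \<in> nz"
    "a \<otimes> u = c \<otimes> w" "b \<otimes> u = d \<otimes> w"
  shows "ore_class R a b = ore_class R c d"
  using assms(5-8) unfolding ore_class_eq_iff[OF assms(1-4)] eqv_def by blast

lemma ore_class_expand:
  assumes "a \<in> carrier R" "b \<in> nz" "u \<in> nz"
  shows "ore_class R (a \<otimes> u) (b \<otimes> u) = ore_class R a b"
  using assms nz_one nz_mult by (intro ore_class_eqI[of _ _ _ _ \<one> u]) auto

lemma ore_class_same_denominator:
  assumes "a \<in> carrier R" "c \<in> carrier R" "b \<in> nz" "ore_class R a b = ore_class R c b"
  shows "a = c"
  using assms eqv_test[of a c b b \<one> \<one>] ore_class_eq_iff by auto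

text \<open>\<open>ore_mult\<close> is a union over all representatives and all Ore multipliers, so
  it is a fraction again once every choice yields the same class. A common multiple of two resulting
  denominators together with \<open>eqv_test\<close> shows this; addition is treated in the same
  way.\<close>

lemma ore_mult_class:
  assumes "a \<in> carrier R" "c \<in> carrier R" "b \<in> nz" "d \<in> nz"
    and "u \<in> carrier R" "w \<in> nz" "b \<otimes> u = c \<otimes> w"
  shows "ore_mult R (ore_class R a b) (ore_class R c d) = ore_class R (a \<otimes> u) (d \<otimes> w)"
proof -
  have "ore_class R (a' \<otimes> u') (d' \<otimes> w') = ore_class R (a \<otimes> u) (d \<otimes> w)"
    if "(a', b') \<in> ore_class R a b" "(c', d') \<in> ore_class R c d"
      "u' \<in> carrier R" "w' \<in> nz" "b' \<otimes> u' = c' \<otimes> w'" for a' b' c' d' u' w'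
  proof -
    have ab: "a' \<in> carrier R" "b' \<in> nz" "eqv a b a' b'"
      and cd: "c' \<in> carrier R" "d' \<in> nz" "eqv c d c' d'"
      using that ore_class_mem by auto
    have w': "d' \<otimes> w' \<in> nz"
      using nz_mult[OF cd(2) that(4)] .
    obtain p q where pq: "p \<in> nz" "q \<in> nz" "d \<otimes> w \<otimes> p = d' \<otimes> w' \<otimes> q"
      using common_multiple[OF w' nz_mult[OF assms(4,6)]] by blast
    have "c \<otimes> (w \<otimes> p) = c' \<otimes> (w' \<otimes> q)"
      using eqv_test[of c c' d d' "w \<otimes> p" "w' \<otimes> q"] assms cd pq that by (auto simp: m_assoc)
    then have "b \<otimes> (u \<otimes> p) = b' \<otimes> (u' \<otimes> q)"
      using assms pq that ab cd by (simp add: m_assoc[symmetric])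
    then have "a \<otimes> (u \<otimes> p) = a' \<otimes> (u' \<otimes> q)"
      using eqv_test[of a a' b b' "u \<otimes> p" "u' \<otimes> q"] assms ab pq that by auto
    then show ?thesis
      using assms ab cd pq that nz_mult
      by (intro ore_class_eqI[of _ _ _ _ q p]) (auto simp: m_assoc)
  qed
  note wd = this
  have mem: "(a, b) \<in> ore_class R a b" "(c, d) \<in> ore_class R c d"
    using assms eqv_refl ore_class_mem by auto
  have "{ore_class R (a' \<otimes> u') (d' \<otimes> w') | a' b' c' d' u' w'.
      (a', b') \<in> ore_class R a b \<and> (c', d') \<in> ore_class R c d \<and> u' \<in> carrier R \<and> w' \<in> nz \<and>
      b' \<otimes> u' = c' \<otimes> w'} = {ore_class R (a \<otimes> u) (d \<otimes> w)}" (is "?S = _")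
  proof
    show "?S \<subseteq> {ore_class R (a \<otimes> u) (d \<otimes> w)}"
      using wd by blast
    show "{ore_class R (a \<otimes> u) (d \<otimes> w)} \<subseteq> ?S"
      using mem assms by blast
  qed
  then show ?thesis
    unfolding ore_mult_def by simp
qed

lemma ore_add_class:
  assumes "a \<in> carrier R" "c \<in> carrier R" "b \<in> nz"
  shows "ore_add R (ore_class R a b) (ore_class R c b) = ore_class R (a \<oplus> c) b"
proof -
  have wd: "ore_class R (a' \<otimes> u' \<oplus> c' \<otimes> w') (b' \<otimes> u') = ore_class R (a \<oplus> c) b"
    if "(a', b') \<in> ore_class R a b" "(c', d') \<in> ore_class R c b"
      "u' \<in> nz" "w' \<in> nz" "b' \<otimes> u' = d' \<otimes> w'" for a' b' c' d' u' w'
  proof -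
    have ab: "a' \<in> carrier R" "b' \<in> nz" "eqv a b a' b'"
      and cd: "c' \<in> carrier R" "d' \<in> nz" "eqv c b c' d'"
      using that ore_class_mem by auto
    have u': "b' \<otimes> u' \<in> nz"
      using nz_mult[OF ab(2) that(3)] .
    obtain p q where pq: "p \<in> nz" "q \<in> nz" "b \<otimes> p = b' \<otimes> u' \<otimes> q"
        using common_multiple[OF u' assms(3)] by blast
    have 1: "a \<otimes> p = a' \<otimes> (u' \<otimes> q)"
    proof (rule eqv_test[OF assms(1) ab(1) assms(3) ab(2,3)])
      show "b \<otimes> p = b' \<otimes> (u' \<otimes> q)"
        unfolding pq(3) using ab pq(2) that(3) by (simp add: m_assoc)
    qed (use that pq in auto)
    have "b \<otimes> p = d' \<otimes> (w' \<otimes> q)"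
      unfolding pq(3) that(5) using cd pq(2) that(4) by (simp add: m_assoc)
    then have 2: "c \<otimes> p = c' \<otimes> (w' \<otimes> q)"
      using eqv_test[of c c' b d' p "w' \<otimes> q"] assms cd pq that by auto
    show ?thesis
    proof (rule ore_class_eqI[of _ _ _ _ q p])
      show "(a' \<otimes> u' \<oplus> c' \<otimes> w') \<otimes> q = (a \<oplus> c) \<otimes> p"
        using assms ab cd pq that 1 2 by (simp add: m_assoc l_distr)
    qed (use assms ab cd pq that nz_mult in \<open>auto simp: m_assoc\<close>)
  qed
  have mem: "(a, b) \<in> ore_class R a b" "(c, b) \<in> ore_class R c b"
    using assms eqv_refl ore_class_mem by auto
  have "{ore_class R (a' \<otimes> u' \<oplus> c' \<otimes> w') (b' \<otimes> u') | a' b' c' d' u' w'.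
      (a', b') \<in> ore_class R a b \<and> (c', d') \<in> ore_class R c b \<and> u' \<in> nz \<and> w' \<in> nz \<and>
      b' \<otimes> u' = d' \<otimes> w'} = {ore_class R (a \<oplus> c) b}" (is "?S = _")
  proof
    show "?S \<subseteq> {ore_class R (a \<oplus> c) b}"
      using wd by blast
    have "ore_class R (a \<otimes> \<one> \<oplus> c \<otimes> \<one>) (b \<otimes> \<one>) \<in> ?S"
      using mem nz_one by blast
    then show "{ore_class R (a \<oplus> c) b} \<subseteq> ?S"
      using assms by simp
  qed
  then show ?thesis
    unfolding ore_add_def by simp
qed

abbreviation F where "F \<equiv> ore_frac R"

lemma F_simps:
  "carrier F = {ore_class R a b | a b. a \<in> carrier R \<and> b \<in> nz}"
  "mult F = ore_mult R" "one F = ore_class R \<one> \<one>" "zero F = ore_class R \<zero> \<one>"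
  "add F = ore_add R"
  by (simp_all add: ore_frac_def)

lemma ore_class_closed [intro, simp]:
  "a \<in> carrier R \<Longrightarrow> b \<in> nz \<Longrightarrow> ore_class R a b \<in> carrier F"
  by (auto simp: F_simps)

lemma F_mult:
  assumes "a \<in> carrier R" "c \<in> carrier R" "b \<in> nz" "d \<in> nz"
    and "u \<in> carrier R" "w \<in> nz" "b \<otimes> u = c \<otimes> w"
  shows "ore_class R a b \<otimes>\<^bsub>F\<^esub> ore_class R c d = ore_class R (a \<otimes> u) (d \<otimes> w)"
  using ore_mult_class[OF assms] by (simp add: F_simps)

lemma F_add:
  assumes "a \<in> carrier R" "c \<in> carrier R" "b \<in> nz"
  shows "ore_class R a b \<oplus>\<^bsub>F\<^esub> ore_class R c b = ore_class R (a \<oplus> c) b"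
  using ore_add_class[OF assms] by (simp add: F_simps)

lemma F_cases:
  assumes "x \<in> carrier F"
  obtains a b where "a \<in> carrier R" "b \<in> nz" "x = ore_class R a b"
  using assms by (auto simp: F_simps)

lemma common_denominator:
  assumes "a \<in> carrier R" "b \<in> nz" "c \<in> carrier R" "d \<in> nz"
  obtains a' c' e where "a' \<in> carrier R" "c' \<in> carrier R" "e \<in> nz"
    "ore_class R a b = ore_class R a' e" "ore_class R c d = ore_class R c' e"
proof -
  obtain u w where uw: "u \<in> nz" "w \<in> nz" "b \<otimes> u = d \<otimes> w"
    using common_multiple[of d b] assms by blast
  show ?thesis
  proof (rule that[of "a \<otimes> u" "c \<otimes> w" "b \<otimes> u"])
    show "ore_class R a b = ore_class R (a \<otimes> u) (b \<otimes> u)"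
      using ore_class_expand[of a b u] assms uw by simp
    show "ore_class R c d = ore_class R (c \<otimes> w) (b \<otimes> u)"
      using ore_class_expand[of c d w] assms uw by simp
  qed (use assms uw nz_mult in auto)
qed

lemma F_cases2:
  assumes "x \<in> carrier F" "y \<in> carrier F"
  obtains a c e where "a \<in> carrier R" "c \<in> carrier R" "e \<in> nz"
    "x = ore_class R a e" "y = ore_class R c e"
proof -
  obtain a b where 1: "a \<in> carrier R" "b \<in> nz" "x = ore_class R a b"
    using F_cases[OF assms(1)] .
  obtain c d where 2: "c \<in> carrier R" "d \<in> nz" "y = ore_class R c d"
    using F_cases[OF assms(2)] .
  show ?thesis
    using common_denominator[OF 1(1,2) 2(1,2)] that 1(3) 2(3) by metis
qed

lemma F_cases3:
  assumes "x \<in> carrier F" "y \<in> carrier F" "z \<in> carrier F"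
  obtains a c d e where "a \<in> carrier R" "c \<in> carrier R" "d \<in> carrier R" "e \<in> nz"
    "x = ore_class R a e" "y = ore_class R c e" "z = ore_class R d e"
proof -
  obtain a c e where 1: "a \<in> carrier R" "c \<in> carrier R" "e \<in> nz"
    "x = ore_class R a e" "y = ore_class R c e"
    using F_cases2[OF assms(1,2)] .
  obtain d f where 2: "d \<in> carrier R" "f \<in> nz" "z = ore_class R d f"
    using F_cases[OF assms(3)] by blast
  obtain u w where uw: "u \<in> nz" "w \<in> nz" "e \<otimes> u = f \<otimes> w"
    using common_multiple[of f e] 1 2 by blast
  show ?thesis
  proof (rule that[of "a \<otimes> u" "c \<otimes> u" "d \<otimes> w" "e \<otimes> u"])
    show "x = ore_class R (a \<otimes> u) (e \<otimes> u)" "y = ore_class R (c \<otimes> u) (e \<otimes> u)"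
      using ore_class_expand[of _ e u] 1 uw by simp_all
    show "z = ore_class R (d \<otimes> w) (e \<otimes> u)"
      using ore_class_expand[of d f w] 2 uw by simp
  qed (use 1 2 uw nz_mult in auto)
qed

lemma F_one: "b \<in> nz \<Longrightarrow> ore_class R b b = \<one>\<^bsub>F\<^esub>"
  unfolding F_simps using nz_one by (intro ore_class_eqI[of _ _ _ _ \<one> b]) auto

lemma F_zero: "b \<in> nz \<Longrightarrow> ore_class R \<zero> b = \<zero>\<^bsub>F\<^esub>"
  unfolding F_simps using nz_one by (intro ore_class_eqI[of _ _ _ _ \<one> b]) auto

lemma F_eq_zero_iff:
  "a \<in> carrier R \<Longrightarrow> b \<in> nz \<Longrightarrow> ore_class R a b = \<zero>\<^bsub>F\<^esub> \<longleftrightarrow> a = \<zero>"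
  using F_zero[of b] ore_class_same_denominator[of a \<zero> b] by auto

lemma F_mult_closed:
  assumes "x \<in> carrier F" "y \<in> carrier F"
  shows "x \<otimes>\<^bsub>F\<^esub> y \<in> carrier F"
proof -
  obtain a b where 1: "a \<in> carrier R" "b \<in> nz" "x = ore_class R a b"
    using F_cases[OF assms(1)] .
  obtain c d where 2: "c \<in> carrier R" "d \<in> nz" "y = ore_class R c d"
    using F_cases[OF assms(2)] .
  obtain u w where uw: "u \<in> carrier R" "w \<in> nz" "b \<otimes> u = c \<otimes> w"
    using ore_condition[of c b] 1 2 by blast
  show ?thesis
    using F_mult[OF 1(1) 2(1) 1(2) 2(2) uw] 1 2 uw nz_mult[of d w] by simp
qed

lemma F_mult_assoc:
  assumes "x \<in> carrier F" "y \<in> carrier F" "z \<in> carrier F"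
  shows "(x \<otimes>\<^bsub>F\<^esub> y) \<otimes>\<^bsub>F\<^esub> z = x \<otimes>\<^bsub>F\<^esub> (y \<otimes>\<^bsub>F\<^esub> z)"
proof -
  obtain a b where 1: "a \<in> carrier R" "b \<in> nz" "x = ore_class R a b"
    using F_cases[OF assms(1)] .
  obtain c d where 2: "c \<in> carrier R" "d \<in> nz" "y = ore_class R c d"
    using F_cases[OF assms(2)] .
  obtain e f where 3: "e \<in> carrier R" "f \<in> nz" "z = ore_class R e f"
    using F_cases[OF assms(3)] by blast
  obtain u w where uw: "u \<in> carrier R" "w \<in> nz" "b \<otimes> u = c \<otimes> w"
    using ore_condition[of c b] 1 2 by blast
  have dw: "d \<otimes> w \<in> nz"
    using nz_mult 2 uw by blast
  obtain p q where pq: "p \<in> carrier R" "q \<in> nz" "d \<otimes> w \<otimes> p = e \<otimes> q"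
    using ore_condition[of e "d \<otimes> w"] 3 dw by blast
  have fq: "f \<otimes> q \<in> nz"
    using nz_mult 3 pq by blast
  have "x \<otimes>\<^bsub>F\<^esub> y = ore_class R (a \<otimes> u) (d \<otimes> w)"
    using F_mult[OF 1(1) 2(1) 1(2) 2(2) uw] 1 2 by simp
  then have L: "(x \<otimes>\<^bsub>F\<^esub> y) \<otimes>\<^bsub>F\<^esub> z = ore_class R (a \<otimes> u \<otimes> p) (f \<otimes> q)"
    using F_mult[of "a \<otimes> u" e "d \<otimes> w" f p q] 1 2 3 uw pq dw by simp
  have "y \<otimes>\<^bsub>F\<^esub> z = ore_class R (c \<otimes> (w \<otimes> p)) (f \<otimes> q)"
    using F_mult[of c e d f "w \<otimes> p" q] 2 3 uw pq by (simp add: m_assoc)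
  moreover have "ore_class R a b \<otimes>\<^bsub>F\<^esub> ore_class R (c \<otimes> (w \<otimes> p)) (f \<otimes> q)
      = ore_class R (a \<otimes> (u \<otimes> p)) (f \<otimes> q \<otimes> \<one>)"
  proof (rule F_mult)
    have "b \<otimes> (u \<otimes> p) = b \<otimes> u \<otimes> p"
      using 1 uw(1) pq(1) by (simp add: m_assoc)
    then show "b \<otimes> (u \<otimes> p) = c \<otimes> (w \<otimes> p) \<otimes> \<one>"
      unfolding uw(3) using 2 uw(2) pq(1) by (simp add: m_assoc)
  qed (use 1 2 uw pq fq nz_one in auto)
  ultimately have "x \<otimes>\<^bsub>F\<^esub> (y \<otimes>\<^bsub>F\<^esub> z) = ore_class R (a \<otimes> (u \<otimes> p)) (f \<otimes> q)"
    using 1 3 pq by simp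
  then show ?thesis
    using L 1 uw pq by (simp add: m_assoc)
qed

lemma F_l_one: "x \<in> carrier F \<Longrightarrow> \<one>\<^bsub>F\<^esub> \<otimes>\<^bsub>F\<^esub> x = x"
proof (elim F_cases)
  fix a b assume 1: "a \<in> carrier R" "b \<in> nz" "x = ore_class R a b"
  then show "\<one>\<^bsub>F\<^esub> \<otimes>\<^bsub>F\<^esub> x = x"
    using F_mult[of \<one> a \<one> b a \<one>] nz_one F_one[of \<one>] by simp
qed

lemma F_r_one: "x \<in> carrier F \<Longrightarrow> x \<otimes>\<^bsub>F\<^esub> \<one>\<^bsub>F\<^esub> = x"
proof (elim F_cases)
  fix a b assume 1: "a \<in> carrier R" "b \<in> nz" "x = ore_class R a b"
  then show "x \<otimes>\<^bsub>F\<^esub> \<one>\<^bsub>F\<^esub> = x"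
    using F_mult[of a \<one> b \<one> \<one> b] nz_one F_one[of \<one>] by simp
qed

lemma F_l_distr:
  assumes "x \<in> carrier F" "y \<in> carrier F" "z \<in> carrier F"
  shows "(x \<oplus>\<^bsub>F\<^esub> y) \<otimes>\<^bsub>F\<^esub> z = x \<otimes>\<^bsub>F\<^esub> z \<oplus>\<^bsub>F\<^esub> y \<otimes>\<^bsub>F\<^esub> z"
proof -
  obtain a a' b where 1: "a \<in> carrier R" "a' \<in> carrier R" "b \<in> nz" "x = ore_class R a b" "y = ore_class R a' b"
    using F_cases2[OF assms(1,2)] .
  obtain c d where 2: "c \<in> carrier R" "d \<in> nz" "z = ore_class R c d"
    using F_cases[OF assms(3)] by blast
  obtain u w where uw: "u \<in> carrier R" "w \<in> nz" "b \<otimes> u = c \<otimes> w"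
    using ore_condition[of c b] 1 2 by blast
  have "x \<otimes>\<^bsub>F\<^esub> z = ore_class R (a \<otimes> u) (d \<otimes> w)" "y \<otimes>\<^bsub>F\<^esub> z = ore_class R (a' \<otimes> u) (d \<otimes> w)"
      "(x \<oplus>\<^bsub>F\<^esub> y) \<otimes>\<^bsub>F\<^esub> z = ore_class R ((a \<oplus> a') \<otimes> u) (d \<otimes> w)"
    using F_mult[of _ c b d u w] 1 2 uw F_add by auto
  then show ?thesis
    using F_add[of "a \<otimes> u" "a' \<otimes> u" "d \<otimes> w"] nz_mult[of d w] 1 2 uw by (simp add: l_distr)
qed

lemma F_r_distr:
  assumes "x \<in> carrier F" "y \<in> carrier F" "z \<in> carrier F"
  shows "z \<otimes>\<^bsub>F\<^esub> (x \<oplus>\<^bsub>F\<^esub> y) = z \<otimes>\<^bsub>F\<^esub> x \<oplus>\<^bsub>F\<^esub> z \<otimes>\<^bsub>F\<^esub> y"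
proof -
  obtain c c' d where 1: "c \<in> carrier R" "c' \<in> carrier R" "d \<in> nz" "x = ore_class R c d" "y = ore_class R c' d"
    using F_cases2[OF assms(1,2)] .
  obtain a b where 2: "a \<in> carrier R" "b \<in> nz" "z = ore_class R a b"
    using F_cases[OF assms(3)] by blast
  obtain u w where uw: "u \<in> carrier R" "w \<in> nz" "b \<otimes> u = c \<otimes> w"
    using ore_condition[of c b] 1 2 by blast
  obtain u' w' where uw': "u' \<in> carrier R" "w' \<in> nz" "b \<otimes> u' = c' \<otimes> w'"
    using ore_condition[of c' b] 1 2 by blast
  \<comment> \<open>The products with \<open>x\<close> and with \<open>y\<close> come with different
    multipliers; a common multiple of \<open>w\<close> and \<open>w'\<close> puts both over the
    denominator \<open>d W\<close>.\<close>
  obtain p q where pq: "p \<in> nz" "q \<in> nz" "w \<otimes> p = w' \<otimes> q"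
    using common_multiple[of w' w] uw uw' by blast
  define W where "W = w \<otimes> p"
  have W: "W \<in> nz" "W = w' \<otimes> q"
    using nz_mult[OF uw(2) pq(1)] pq(3) W_def by auto
  have e: "b \<otimes> (u \<otimes> p) = c \<otimes> W"
    unfolding W_def using 2(1,2) 1(1) uw pq(1) by (simp flip: m_assoc)
  have e': "b \<otimes> (u' \<otimes> q) = c' \<otimes> W"
    unfolding W(2) using 2(1,2) 1(2) uw' pq(2) by (simp flip: m_assoc)
  have "z \<otimes>\<^bsub>F\<^esub> x = ore_class R (a \<otimes> (u \<otimes> p)) (d \<otimes> W)"
    using F_mult[of a c b d "u \<otimes> p" W] 1 2 uw pq W e by auto
  moreover have "z \<otimes>\<^bsub>F\<^esub> y = ore_class R (a \<otimes> (u' \<otimes> q)) (d \<otimes> W)"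
    using F_mult[of a c' b d "u' \<otimes> q" W] 1 2 uw' pq W e' by auto
  moreover have "z \<otimes>\<^bsub>F\<^esub> (x \<oplus>\<^bsub>F\<^esub> y) = ore_class R (a \<otimes> (u \<otimes> p \<oplus> u' \<otimes> q)) (d \<otimes> W)"
    using F_mult[of a "c \<oplus> c'" b d "u \<otimes> p \<oplus> u' \<otimes> q" W] F_add[of c c' d] 1 2 uw uw' pq W e e'
    by (simp add: l_distr r_distr)
  ultimately show ?thesis
    using F_add[of "a \<otimes> (u \<otimes> p)" "a \<otimes> (u' \<otimes> q)" "d \<otimes> W"] nz_mult[of d W] 1 2 uw uw' pq W
    by (simp add: r_distr)
qed

lemma F_ring: "ring F"
proof (rule ringI)
  show "abelian_group F"
  proof (rule abelian_groupI)
    fix x y assume "x \<in> carrier F" "y \<in> carrier F"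
    then obtain a c e where e: "a \<in> carrier R" "c \<in> carrier R" "e \<in> nz"
      "x = ore_class R a e" "y = ore_class R c e"
      by (rule F_cases2)
    show "x \<oplus>\<^bsub>F\<^esub> y \<in> carrier F" "x \<oplus>\<^bsub>F\<^esub> y = y \<oplus>\<^bsub>F\<^esub> x"
      unfolding e(4,5) F_add[OF e(1-3)] F_add[OF e(2,1,3)]
      using e a_comm[of a c] ore_class_closed[of "a \<oplus> c" e] by simp_all
  next
    show "\<zero>\<^bsub>F\<^esub> \<in> carrier F"
      unfolding F_simps(4) by (rule ore_class_closed[OF zero_closed nz_one])
  next
    fix x y z assume "x \<in> carrier F" "y \<in> carrier F" "z \<in> carrier F"
    then obtain a c d e where e: "a \<in> carrier R" "c \<in> carrier R" "d \<in> carrier R" "e \<in> nz"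
      "x = ore_class R a e" "y = ore_class R c e" "z = ore_class R d e"
      by (rule F_cases3)
    then show "x \<oplus>\<^bsub>F\<^esub> y \<oplus>\<^bsub>F\<^esub> z = x \<oplus>\<^bsub>F\<^esub> (y \<oplus>\<^bsub>F\<^esub> z)"
      by (simp add: F_add a_assoc)
  next
    fix x assume "x \<in> carrier F"
    then obtain a b where ab: "a \<in> carrier R" "b \<in> nz" "x = ore_class R a b"
      by (rule F_cases)
    show "\<zero>\<^bsub>F\<^esub> \<oplus>\<^bsub>F\<^esub> x = x"
      using F_zero[OF ab(2)] F_add[of \<zero> a b] ab by simp
    show "\<exists>y\<in>carrier F. y \<oplus>\<^bsub>F\<^esub> x = \<zero>\<^bsub>F\<^esub>"
      using F_zero[OF ab(2)] F_add[of "\<ominus> a" a b] ab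
      by (intro bexI[of _ "ore_class R (\<ominus> a) b"]) (simp_all add: l_neg)
  qed
  show "monoid F"
  proof (rule monoidI)
    show "\<one>\<^bsub>F\<^esub> \<in> carrier F"
      unfolding F_simps(3) by (rule ore_class_closed[OF one_closed nz_one])
  qed (fact F_mult_closed F_mult_assoc F_l_one F_r_one)+
qed (fact F_l_distr F_r_distr)+

lemma F_inverse:
  assumes "a \<in> nz" "b \<in> nz"
  shows "ore_class R a b \<otimes>\<^bsub>F\<^esub> ore_class R b a = \<one>\<^bsub>F\<^esub>"
  using F_mult[of a b b a \<one> \<one>] F_one[of a] assms nz_one by auto

lemma F_Units: "Units F = carrier F - {\<zero>\<^bsub>F\<^esub>}"
proof -
  interpret F: ring F
    by (rule F_ring)
  have *: "x \<in> Units F" if x: "x \<in> carrier F - {\<zero>\<^bsub>F\<^esub>}" for x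
  proof -
    obtain a b where ab: "a \<in> carrier R" "b \<in> nz" "x = ore_class R a b"
      using DiffD1[OF x] by (rule F_cases)
    then have a: "a \<in> nz"
      using x F_zero[of b] by (cases "a = \<zero>") simp_all
    show ?thesis
      unfolding Units_def mem_Collect_eq
    proof (intro conjI bexI)
      show "x \<in> carrier F" using that by simp
      show "ore_class R b a \<otimes>\<^bsub>F\<^esub> x = \<one>\<^bsub>F\<^esub>" "x \<otimes>\<^bsub>F\<^esub> ore_class R b a = \<one>\<^bsub>F\<^esub>"
        unfolding ab(3) by (rule F_inverse[OF ab(2) a] F_inverse[OF a ab(2)])+
      show "ore_class R b a \<in> carrier F"
        using a ab(2) by (intro ore_class_closed) auto
    qed
  qed
  have "\<zero>\<^bsub>F\<^esub> \<notin> Units F"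
  proof
    assume "\<zero>\<^bsub>F\<^esub> \<in> Units F"
    then obtain x where "x \<in> carrier F" "\<zero>\<^bsub>F\<^esub> \<otimes>\<^bsub>F\<^esub> x = \<one>\<^bsub>F\<^esub>"
      by (metis F.Units_inv_closed F.Units_r_inv)
    then have "\<zero>\<^bsub>F\<^esub> = \<one>\<^bsub>F\<^esub>"
      by simp
    then show False
      using F_one[of \<one>] F_eq_zero_iff[of \<one> \<one>] nz_one by auto
  qed
  then show ?thesis
    using * F.Units_closed by blast
qed

lemma F_inv:
  assumes "a \<in> nz" "b \<in> nz"
  shows "inv\<^bsub>F\<^esub> (ore_class R a b) = ore_class R b a"
proof -
  interpret F: ring F by (rule F_ring)
  show ?thesis
  proof (rule F.inv_unique'[symmetric])
    show "ore_class R a b \<otimes>\<^bsub>F\<^esub> ore_class R b a = \<one>\<^bsub>F\<^esub>"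
      by (rule F_inverse[OF assms])
    show "ore_class R b a \<otimes>\<^bsub>F\<^esub> ore_class R a b = \<one>\<^bsub>F\<^esub>"
      by (rule F_inverse[OF assms(2,1)])
  qed (use assms in auto)
qed

end

locale division_ring = ring D for D (structure) +
  assumes Units_eq: "Units D = carrier D - {\<zero>}"

lemma (in ore_domain) F_division_ring: "division_ring F"
  using F_ring F_Units by (simp add: division_ring_def division_ring_axioms_def)

section \<open>Universal property of the skew-field of fractions\<close>

context ore_domain
begin

lemma embed_hom: "ore_embed R \<in> ring_hom R F"
proof (rule ring_hom_memI)
  fix x y assume xy: "x \<in> carrier R" "y \<in> carrier R"
  show "ore_embed R x \<in> carrier F"
    using xy nz_one by (simp add: ore_embed_def)
  show "ore_embed R (x \<otimes> y) = ore_embed R x \<otimes>\<^bsub>F\<^esub> ore_embed R y"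
    using F_mult[of x y \<one> \<one> y \<one>] xy nz_one by (simp add: ore_embed_def)
  show "ore_embed R (x \<oplus> y) = ore_embed R x \<oplus>\<^bsub>F\<^esub> ore_embed R y"
    using F_add[of x y \<one>] xy nz_one by (simp add: ore_embed_def)
qed (simp add: ore_embed_def F_simps)

lemma class_as_quotient:
  assumes "a \<in> carrier R" "b \<in> nz"
  shows "ore_class R a b = ore_embed R a \<otimes>\<^bsub>F\<^esub> inv\<^bsub>F\<^esub> (ore_embed R b)"
proof -
  have "inv\<^bsub>F\<^esub> (ore_embed R b) = ore_class R \<one> b"
    using F_inv[of b \<one>] assms nz_one by (simp add: ore_embed_def)
  then show ?thesis
    using F_mult[of a \<one> \<one> b \<one> \<one>] assms nz_one by (simp add: ore_embed_def)
qed

lemma embed_eq_class_iff: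
  assumes "f \<in> carrier R" "a \<in> carrier R" "b \<in> nz"
  shows "ore_embed R f = ore_class R a b \<longleftrightarrow> f \<otimes> b = a"
  using ore_class_expand[of f \<one> b] ore_class_same_denominator[of "f \<otimes> b" a b] assms nz_one
  by (auto simp: ore_embed_def)

text \<open>Universal property of right fractions: the only obstruction to inverting the images of
  denominators in \<open>D\<close> is a nonzero element that is sent to zero.\<close>

lemma extend_hom:
  assumes "division_ring D" "\<phi> \<in> ring_hom R D"
    and inj: "\<And>a. a \<in> nz \<Longrightarrow> \<phi> a \<noteq> \<zero>\<^bsub>D\<^esub>"
  obtains \<Phi> where "\<Phi> \<in> ring_hom F D"
    "\<And>a b. a \<in> carrier R \<Longrightarrow> b \<in> nz \<Longrightarrow> \<Phi> (ore_class R a b) = \<phi> a \<otimes>\<^bsub>D\<^esub> inv\<^bsub>D\<^esub> (\<phi> b)"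
proof -
  interpret D: division_ring D by fact
  interpret phi: ring_hom_ring R D \<phi>
    using assms(2) by (intro ring_hom_ringI2) (auto intro: ring_axioms D.ring_axioms)
  have unit: "\<phi> b \<in> Units D" if "b \<in> nz" for b
    using that inj D.Units_eq by auto
  have expand: "\<phi> (a \<otimes> u) \<otimes>\<^bsub>D\<^esub> inv\<^bsub>D\<^esub> (\<phi> (b \<otimes> u)) = \<phi> a \<otimes>\<^bsub>D\<^esub> inv\<^bsub>D\<^esub> (\<phi> b)"
    if "a \<in> carrier R" "b \<in> nz" "u \<in> nz" for a b u
  proof -
    have "inv\<^bsub>D\<^esub> (\<phi> (b \<otimes> u)) = inv\<^bsub>D\<^esub> (\<phi> u) \<otimes>\<^bsub>D\<^esub> inv\<^bsub>D\<^esub> (\<phi> b)"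
      using that unit D.inv_mult_Units by auto
    moreover have "\<phi> u \<otimes>\<^bsub>D\<^esub> (inv\<^bsub>D\<^esub> (\<phi> u) \<otimes>\<^bsub>D\<^esub> inv\<^bsub>D\<^esub> (\<phi> b)) = inv\<^bsub>D\<^esub> (\<phi> b)"
      using unit[of u] unit[of b] that by (simp add: D.m_assoc[symmetric])
    ultimately show ?thesis
      using that unit[of u] unit[of b] by (simp add: D.m_assoc)
  qed
  have wd: "\<phi> a \<otimes>\<^bsub>D\<^esub> inv\<^bsub>D\<^esub> (\<phi> b) = \<phi> c \<otimes>\<^bsub>D\<^esub> inv\<^bsub>D\<^esub> (\<phi> d)"
    if "a \<in> carrier R" "b \<in> nz" and cd: "(c, d) \<in> ore_class R a b" for a b c d
  proof -
    obtain u w where "c \<in> carrier R" "d \<in> nz" "u \<in> nz" "w \<in> nz" "a \<otimes> u = c \<otimes> w" "b \<otimes> u = d \<otimes> w"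
      using cd unfolding ore_class_mem eqv_def by blast
    then show ?thesis
      using expand[of a b u] expand[of c d w] that by simp
  qed
  define \<Phi> where "\<Phi> P = (SOME y. \<exists>(c, d)\<in>P. y = \<phi> c \<otimes>\<^bsub>D\<^esub> inv\<^bsub>D\<^esub> (\<phi> d))" for P
  have val: "\<Phi> (ore_class R a b) = \<phi> a \<otimes>\<^bsub>D\<^esub> inv\<^bsub>D\<^esub> (\<phi> b)" if "a \<in> carrier R" "b \<in> nz" for a b
  proof -
    have "(a, b) \<in> ore_class R a b"
      using that eqv_refl by (simp add: ore_class_mem)
    show ?thesis
        unfolding \<Phi>_def
    proof (rule some_equality)
      show "\<exists>(c, d)\<in>ore_class R a b. \<phi> a \<otimes>\<^bsub>D\<^esub> inv\<^bsub>D\<^esub> (\<phi> b) = \<phi> c \<otimes>\<^bsub>D\<^esub> inv\<^bsub>D\<^esub> (\<phi> d)"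
        using \<open>(a, b) \<in> ore_class R a b\<close> by blast
      show "y = \<phi> a \<otimes>\<^bsub>D\<^esub> inv\<^bsub>D\<^esub> (\<phi> b)"
        if "\<exists>(c, d)\<in>ore_class R a b. y = \<phi> c \<otimes>\<^bsub>D\<^esub> inv\<^bsub>D\<^esub> (\<phi> d)" for y
        using that wd[OF \<open>a \<in> carrier R\<close> \<open>b \<in> nz\<close>] by auto
    qed
  qed
  have "\<Phi> \<in> ring_hom F D"
  proof (rule ring_hom_memI)
    fix x assume "x \<in> carrier F"
    then show "\<Phi> x \<in> carrier D"
      using val unit by (elim F_cases) auto
  next
    fix x y assume "x \<in> carrier F" "y \<in> carrier F"
    then obtain a c e where "a \<in> carrier R" "c \<in> carrier R" "e \<in> nz"
      "x = ore_class R a e" "y = ore_class R c e"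
      by (rule F_cases2)
    then show "\<Phi> (x \<oplus>\<^bsub>F\<^esub> y) = \<Phi> x \<oplus>\<^bsub>D\<^esub> \<Phi> y"
      using val F_add unit by (simp add: D.l_distr)
  next
    fix x y assume xy: "x \<in> carrier F" "y \<in> carrier F"
    obtain a b where 1: "a \<in> carrier R" "b \<in> nz" "x = ore_class R a b"
      using F_cases[OF xy(1)] .
    obtain c d where 2: "c \<in> carrier R" "d \<in> nz" "y = ore_class R c d"
      using F_cases[OF xy(2)] .
    obtain u w where uw: "u \<in> carrier R" "w \<in> nz" "b \<otimes> u = c \<otimes> w"
      using ore_condition[of c b] 1 2 by blast
    have e: "\<phi> b \<otimes>\<^bsub>D\<^esub> \<phi> u = \<phi> c \<otimes>\<^bsub>D\<^esub> \<phi> w"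
      using uw 1 2 phi.hom_mult by (metis Diff_iff)
    \<comment> \<open>The Ore relation \<open>b u = c w\<close> becomes
      \<open>\<phi> u (\<phi> w)^(-1) = (\<phi> b)^(-1) \<phi> c\<close>, which is what
      multiplicativity requires in the middle of the product.\<close>
    have "\<phi> u \<otimes>\<^bsub>D\<^esub> inv\<^bsub>D\<^esub> (\<phi> w) = inv\<^bsub>D\<^esub> (\<phi> b) \<otimes>\<^bsub>D\<^esub> (\<phi> b \<otimes>\<^bsub>D\<^esub> \<phi> u) \<otimes>\<^bsub>D\<^esub> inv\<^bsub>D\<^esub> (\<phi> w)"
      using unit[of b] 1 uw by (simp add: D.m_assoc[symmetric])
    also have "\<dots> = inv\<^bsub>D\<^esub> (\<phi> b) \<otimes>\<^bsub>D\<^esub> \<phi> c"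
      unfolding e using unit[of b] unit[of w] 1 2 uw by (simp add: D.m_assoc)
    finally have k: "\<phi> u \<otimes>\<^bsub>D\<^esub> inv\<^bsub>D\<^esub> (\<phi> w) = inv\<^bsub>D\<^esub> (\<phi> b) \<otimes>\<^bsub>D\<^esub> \<phi> c" .
    have inv: "inv\<^bsub>D\<^esub> (\<phi> (d \<otimes> w)) = inv\<^bsub>D\<^esub> (\<phi> w) \<otimes>\<^bsub>D\<^esub> inv\<^bsub>D\<^esub> (\<phi> d)"
      using 2 uw unit D.inv_mult_Units by auto
    have "\<Phi> (x \<otimes>\<^bsub>F\<^esub> y) = \<phi> (a \<otimes> u) \<otimes>\<^bsub>D\<^esub> inv\<^bsub>D\<^esub> (\<phi> (d \<otimes> w))"
      using F_mult[OF 1(1) 2(1) 1(2) 2(2) uw] val[of "a \<otimes> u" "d \<otimes> w"] 1 2 uw nz_mult[of d w] by simp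
    also have "\<dots> = \<phi> a \<otimes>\<^bsub>D\<^esub> (\<phi> u \<otimes>\<^bsub>D\<^esub> inv\<^bsub>D\<^esub> (\<phi> w)) \<otimes>\<^bsub>D\<^esub> inv\<^bsub>D\<^esub> (\<phi> d)"
      using inv 1 2 uw unit[of w] unit[of d] by (simp add: D.m_assoc)
    also have "\<dots> = \<Phi> x \<otimes>\<^bsub>D\<^esub> \<Phi> y"
      unfolding k using val 1 2 unit[of b] unit[of d] by (simp add: D.m_assoc)
    finally show "\<Phi> (x \<otimes>\<^bsub>F\<^esub> y) = \<Phi> x \<otimes>\<^bsub>D\<^esub> \<Phi> y" .
  next
    show "\<Phi> \<one>\<^bsub>F\<^esub> = \<one>\<^bsub>D\<^esub>"
      using val[of \<one> \<one>] F_one[of \<one>] nz_one unit[of \<one>] by simp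
  qed
  then show ?thesis
    using that val by blast
qed

text \<open>A ring homomorphism preserves inverses, so on fractions it is determined by its values
  on \<open>R\<close>; this is one half of the uniqueness of mutation maps.\<close>

lemma frac_hom_class:
  assumes "division_ring D" "\<Phi> \<in> ring_hom F D" "a \<in> carrier R" "b \<in> nz"
  shows "\<Phi> (ore_class R a b) = \<Phi> (ore_embed R a) \<otimes>\<^bsub>D\<^esub> inv\<^bsub>D\<^esub> (\<Phi> (ore_embed R b))"
proof -
  interpret D: division_ring D by fact
  interpret F: ring F by (rule F_ring)
  interpret phi: ring_hom_ring F D \<Phi>
    using assms(2) by (intro ring_hom_ringI2) (auto intro: F.ring_axioms D.ring_axioms)
  have b: "ore_embed R b \<in> Units F" "ore_embed R a \<in> carrier F"
    using F_Units F_eq_zero_iff[of b \<one>] assms nz_one by (auto simp: ore_embed_def)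
  have "\<Phi> (inv\<^bsub>F\<^esub> (ore_embed R b)) \<otimes>\<^bsub>D\<^esub> \<Phi> (ore_embed R b) = \<one>\<^bsub>D\<^esub>"
    "\<Phi> (ore_embed R b) \<otimes>\<^bsub>D\<^esub> \<Phi> (inv\<^bsub>F\<^esub> (ore_embed R b)) = \<one>\<^bsub>D\<^esub>"
    by (use b in \<open>simp_all flip: phi.hom_mult add: F.Units_closed\<close>)
  then have "inv\<^bsub>D\<^esub> (\<Phi> (ore_embed R b)) = \<Phi> (inv\<^bsub>F\<^esub> (ore_embed R b))"
     "\<Phi> (ore_embed R b) \<in> Units D"
    using b by (auto intro!: D.inv_char simp: Units_def) (metis b(1) F.Units_closed F.Units_inv_closed phi.hom_closed)+
  then show ?thesis
    using class_as_quotient[of a b] assms b D.Units_eq by auto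
qed

end

section \<open>Twisted Laurent polynomial rings\<close>

text \<open>
  Induction over Laurent polynomials eta-expands lattice vectors, which these rules would then
  evaluate pointwise.
\<close>

lemmas lattice_apply = plus_fun_apply zero_fun_apply

declare lattice_apply [simp del]

abbreviation keys :: "('a \<Rightarrow>\<^sub>0 'b::zero) \<Rightarrow> 'a set" where "keys \<equiv> Poly_Mapping.keys"
abbreviation lookup :: "('a \<Rightarrow>\<^sub>0 'b::zero) \<Rightarrow> 'a \<Rightarrow> 'b" where "lookup \<equiv> Poly_Mapping.lookup"
abbreviation single :: "'a \<Rightarrow> 'b \<Rightarrow> 'a \<Rightarrow>\<^sub>0 'b::zero" where "single \<equiv> Poly_Mapping.single"

abbreviation cst :: "'k \<Rightarrow> ('j, 'k::comm_ring_1) laurent" where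
  "cst \<equiv> single 0"

lemma lookup_cst_mult: "lookup (cst c * f) m = c * lookup f m"
  by (simp flip: mult_map_scale_conv_mult add: Poly_Mapping.map.rep_eq when_def)

lemma lscale_eq: "lscale c f = cst c * f"
  by (simp add: lscale_def mult_map_scale_conv_mult)

lemma cst_mult_single: "cst c * single m d = single m (c * d)"
  by (simp add: mult_single)

lemma cst_mult_cst: "cst c * (cst d * f) = cst (c * d) * f"
  by (simp add: mult_single flip: mult.assoc)

lemma keys_cst_mult: "keys (cst c * f) \<subseteq> keys f"
  by (auto simp: in_keys_iff lookup_cst_mult)

lemma laurent_expand:
  "f = (\<Sum>m\<in>keys f. single m (lookup f m))"
  by (rule poly_mapping_eqI) (auto simp: lookup_sum lookup_single when_def in_keys_iff)

lemma laurent_induct [case_names single add]: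
  assumes "\<And>m c. P (single m c)" "\<And>f g. P f \<Longrightarrow> P g \<Longrightarrow> P (f + g)"
  shows "P (f :: ('j, 'k::comm_ring_1) laurent)"
proof -
  have "P (\<Sum>m\<in>A. single m (lookup f m))" if "finite A" for A
    using that by induction (use assms assms(1)[of 0 0] in auto)
  from this[of "keys f"] show ?thesis
    by (simp flip: laurent_expand)
qed

lemma keys_sum_subset:
  "(\<And>i. i \<in> I \<Longrightarrow> keys (f i) \<subseteq> S) \<Longrightarrow> keys (\<Sum>i\<in>I. f i) \<subseteq> S"
  by (induction I rule: infinite_finite_induct) (use Poly_Mapping.keys_add in fastforce)+

text \<open>The linear map that sends \<open>X^m\<close> to \<open>G m\<close>. Pushforward along a
  map of lattices, twisted multiplication, the numerators of mutations and the projection to degree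
  0 are all of this form.\<close>

definition linext ::
    "('i lattice \<Rightarrow> ('j, 'k::comm_ring_1) laurent) \<Rightarrow> ('i, 'k) laurent \<Rightarrow> ('j, 'k) laurent" where
  "linext G f = (\<Sum>m\<in>keys f. cst (lookup f m) * G m)"

lemma linext_superset:
  assumes "finite A" "keys f \<subseteq> A"
  shows "linext G f = (\<Sum>m\<in>A. cst (lookup f m) * G m)"
  unfolding linext_def using assms
  by (intro sum.mono_neutral_left) (auto simp: in_keys_iff)

lemma linext_zero [simp]: "linext G 0 = 0"
  by (simp add: linext_def)

lemma linext_single [simp]: "linext G (single m c) = cst c * G m"
  by (simp add: linext_superset[of "{m}"])

lemma linext_add: "linext G (f + g) = linext G f + linext G g"
proof -
  let ?A = "keys f \<union> keys g"
  show ?thesis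
    using Poly_Mapping.keys_add[of f g]
    by (simp add: linext_superset[of ?A] lookup_add single_add distrib_right sum.distrib)
qed

lemma linext_cst_mult: "linext G (cst c * f) = cst c * linext G f"
  by (induction f rule: laurent_induct) (simp_all add: linext_add distrib_left cst_mult_single cst_mult_cst)

lemma linext_cong: "(\<And>m. m \<in> keys f \<Longrightarrow> G m = H m) \<Longrightarrow> linext G f = linext H f"
  by (simp add: linext_def)

lemma linext_linext: "linext G (linext H f) = linext (\<lambda>m. linext G (H m)) f"
  by (induction f rule: laurent_induct) (simp_all add: linext_add linext_cst_mult)

lemma keys_linext:
  "(\<And>m. m \<in> keys f \<Longrightarrow> keys (G m) \<subseteq> S) \<Longrightarrow> keys (linext G f) \<subseteq> S"
  unfolding linext_def using keys_cst_mult by (intro keys_sum_subset) blast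

abbreviation push :: "('i lattice \<Rightarrow> 'j lattice) \<Rightarrow> ('i, 'k::comm_ring_1) laurent \<Rightarrow> ('j, 'k) laurent" where
  "push \<theta> \<equiv> linext (\<lambda>m. single (\<theta> m) 1)"

lemma push_single: "push \<theta> (single m c) = single (\<theta> m) c"
  by (simp add: cst_mult_single)

lemma push_push: "push \<theta> (push \<eta> f) = push (\<lambda>m. \<theta> (\<eta> m)) f"
  by (simp add: linext_linext)

lemma keys_push: "keys (push \<theta> f) \<subseteq> \<theta> ` keys f"
  by (intro keys_linext) auto

lemma lookup_push:
  assumes "inj \<theta>"
  shows "lookup (push \<theta> f) (\<theta> m) = lookup f m"
  by (induction f rule: laurent_induct)
     (use assms in \<open>simp_all add: linext_add lookup_add cst_mult_single lookup_single when_def inj_eq\<close>)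

lemma push_eq_iff: "inj \<theta> \<Longrightarrow> push \<theta> f = push \<theta> g \<longleftrightarrow> f = g"
  by (metis lookup_push poly_mapping_eqI)

lemma push_eq_0_iff: "inj \<theta> \<Longrightarrow> push \<theta> f = 0 \<longleftrightarrow> f = 0"
  using push_eq_iff[of \<theta> f 0] by simp

lemma push_mult:
  assumes "\<And>m n. \<theta> (m + n) = \<theta> m + \<theta> n"
  shows "push \<theta> (f * g) = push \<theta> f * push \<theta> g"
proof (induction f rule: laurent_induct)
  case (single m c)
  show ?case
    by (induction g rule: laurent_induct)
       (simp_all add: assms mult_single linext_add distrib_left)
qed (simp add: linext_add distrib_right)

text \<open>The twist is a ring-valued function instead of \<open>v\<close> to the power of a form,
  so that the classical case and both sides of the theory become instances of one product.\<close>

definition tm :: "('j lattice \<Rightarrow> 'j lattice \<Rightarrow> 'k::comm_ring_1) \<Rightarrow>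
    ('j, 'k) laurent \<Rightarrow> ('j, 'k) laurent \<Rightarrow> ('j, 'k) laurent" where
  "tm \<chi> f g = linext (\<lambda>m. linext (\<lambda>n. single (m + n) (\<chi> m n)) g) f"

lemma twisted_mult_eq: "twisted_mult v \<beta> = tm (\<lambda>m n. v (\<beta> m n))"
  by (intro ext)
     (simp add: twisted_mult_def tm_def linext_def sum_distrib_left cst_mult_single
       cst_mult_cst mult.commute mult.left_commute)

lemma tm_add_left: "tm \<chi> (f + g) h = tm \<chi> f h + tm \<chi> g h"
  by (simp add: tm_def linext_add)

lemma tm_single_left:
  "tm \<chi> (single m c) g = cst c * linext (\<lambda>n. single (m + n) (\<chi> m n)) g"
  by (simp add: tm_def)

lemma tm_add_right: "tm \<chi> f (g + h) = tm \<chi> f g + tm \<chi> f h"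
  by (induction f rule: laurent_induct)
     (simp_all add: tm_single_left tm_add_left linext_add distrib_left)

lemma tm_single_single:
  "tm \<chi> (single m c) (single n d) = single (m + n) (\<chi> m n * c * d)"
  by (simp add: tm_single_left cst_mult_single mult_ac)

lemma tm_cst_left: "tm \<chi> (cst c * f) g = cst c * tm \<chi> f g"
  by (simp add: tm_def linext_cst_mult)

lemma tm_cst_right: "tm \<chi> f (cst c * g) = cst c * tm \<chi> f g"
  by (induction f rule: laurent_induct)
     (simp_all add: tm_single_left tm_add_left linext_cst_mult distrib_left mult.left_commute)

lemma tm_zero [simp]: "tm \<chi> 0 f = 0" "tm \<chi> f 0 = 0"
  using tm_cst_left[of \<chi> 0 f f] tm_cst_right[of \<chi> f 0 f] by simp_all

lemma tm_linext_left: "tm \<chi> (linext G f) g = linext (\<lambda>m. tm \<chi> (G m) g) f"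
  by (induction f rule: laurent_induct) (simp_all add: linext_add tm_add_left tm_cst_left)

lemma tm_linext_right: "tm \<chi> f (linext G g) = linext (\<lambda>m. tm \<chi> f (G m)) g"
  by (induction g rule: laurent_induct) (simp_all add: linext_add tm_add_right tm_cst_right)

lemma keys_tm:
  "keys (tm \<chi> f g) \<subseteq> {m + n | m n. m \<in> keys f \<and> n \<in> keys g}"
  unfolding tm_def by (intro keys_linext) (auto split: if_splits)

lemma lookup_tm:
  "lookup (tm \<chi> f g) p =
     (\<Sum>(m, n)\<in>keys f \<times> keys g.
        if m + n = p then \<chi> m n * lookup f m * lookup g n else 0)"
proof -
  have "lookup (tm \<chi> f g) p = (\<Sum>m\<in>keys f. \<Sum>n\<in>keys g.
      if m + n = p then \<chi> m n * lookup f m * lookup g n else 0)"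
    by (simp add: tm_def linext_def lookup_sum lookup_cst_mult lookup_single
        sum_distrib_left when_def if_distrib mult_ac cong: if_cong)
  then show ?thesis
    by (simp add: sum.cartesian_product)
qed

text \<open>No cancellation can occur at an exponent with a single decomposition; lowest exponents
  are of this kind.\<close>

lemma lookup_tm_unique:
  assumes "m0 \<in> keys f" "n0 \<in> keys g"
    and "\<And>m n. \<lbrakk>m \<in> keys f; n \<in> keys g; m + n = m0 + n0\<rbrakk> \<Longrightarrow> m = m0 \<and> n = n0"
  shows "lookup (tm \<chi> f g) (m0 + n0) =
    \<chi> m0 n0 * lookup f m0 * lookup g n0"
proof -
  have "lookup (tm \<chi> f g) (m0 + n0) =
    (\<Sum>(m, n)\<in>{(m0, n0)}. if m + n = m0 + n0 then \<chi> m n * lookup f m * lookup g n else 0)"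
    unfolding lookup_tm
  proof (intro sum.mono_neutral_right ballI)
    fix p assume "p \<in> keys f \<times> keys g - {(m0, n0)}"
    then obtain m n where "p = (m, n)" "m \<in> keys f" "n \<in> keys g" "m + n \<noteq> m0 + n0"
      using assms(3) by blast
    then show "(case p of (m, n) \<Rightarrow> if m + n = m0 + n0
        then \<chi> m n * lookup f m * lookup g n else 0) = 0"
      by simp
  qed (use assms(1,2) in simp_all)
  then show ?thesis
    by simp
qed

definition torus :: "('j lattice \<Rightarrow> 'j lattice \<Rightarrow> 'k::comm_ring_1) \<Rightarrow> ('j, 'k) laurent ring" where
  "torus \<chi> = \<lparr> carrier = UNIV, mult = tm \<chi>, one = cst 1, zero = 0, add = (+) \<rparr>"

lemma torus_simps [simp]:
  "carrier (torus \<chi>) = UNIV" "mult (torus \<chi>) = tm \<chi>" "one (torus \<chi>) = cst 1"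
  "zero (torus \<chi>) = 0" "add (torus \<chi>) = (+)"
  by (simp_all add: torus_def)

lemma quantum_torus_eq: "quantum_torus v \<beta> = torus (\<lambda>m n. v (\<beta> m n))"
  by (simp add: quantum_torus_def torus_def twisted_mult_eq)


subsection \<open>Orderings of the lattice\<close>

text \<open>The positive elements of a translation-invariant total order on the lattice,
  \<open>m < n\<close> meaning \<open>n - m \<in> P\<close>. Such an order gives every nonzero
  Laurent polynomial a lowest term.\<close>

definition pos_cone :: "'j lattice set \<Rightarrow> bool" where
  "pos_cone P \<longleftrightarrow> 0 \<notin> P \<and> (\<forall>m\<in>P. \<forall>n\<in>P. m + n \<in> P) \<and> (\<forall>m. m = 0 \<or> m \<in> P \<or> - m \<in> P)"

text \<open>A lexicographic order of the coordinates, or its opposite.\<close>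

lemma pos_cone_ex:
  assumes "e \<noteq> (0 :: ('j::finite) lattice)"
  obtains P where "pos_cone P" "e \<in> P"
proof -
  obtain r :: "'j \<Rightarrow> nat" where r: "inj r"
    using finite_imp_inj_to_nat_seg[of "UNIV :: 'j set"] by auto
  define P where "P = {m :: 'j lattice. \<exists>i. m i > 0 \<and> (\<forall>j. r j < r i \<longrightarrow> m j = 0)}"
  have "m = 0 \<or> m \<in> P \<or> - m \<in> P" for m
  proof (rule disjCI)
    assume "\<not> (m \<in> P \<or> - m \<in> P)"
    show "m = 0"
    proof (rule ccontr)
      assume "m \<noteq> 0"
      then obtain i where i: "m i \<noteq> 0"
        by (auto simp: fun_eq_iff lattice_apply)
      define k where "k = arg_min r (\<lambda>i. m i \<noteq> 0)"
      have k: "m k \<noteq> 0" "\<And>j. r j < r k \<Longrightarrow> m j = 0"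
        using arg_min_natI[of "\<lambda>i. m i \<noteq> 0" i r] arg_min_nat_le[of "\<lambda>i. m i \<noteq> 0" _ r] i k_def
        by (auto simp: not_le[symmetric])
      then have "m \<in> P \<or> - m \<in> P"
        unfolding P_def by (cases "m k > 0") (auto intro!: exI[of _ k])
      then show False
        using \<open>\<not> (m \<in> P \<or> - m \<in> P)\<close> by blast
    qed
  qed
  moreover have "m + n \<in> P" if mn: "m \<in> P" "n \<in> P" for m n
  proof -
    obtain i where i: "m i > 0" "\<And>j. r j < r i \<Longrightarrow> m j = 0"
      using mn P_def by auto
    obtain j where j: "n j > 0" "\<And>i. r i < r j \<Longrightarrow> n i = 0"
      using mn P_def by auto
    consider "r i < r j" | "r j < r i" | "i = j"
      using r by (metis injD linorder_neqE_nat)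
    then show ?thesis
    proof cases
      case 1
      then show ?thesis
        unfolding P_def using i j(2)[of i] j(2) by (auto simp: lattice_apply intro!: exI[of _ i])
    next
      case 2
      then show ?thesis
        unfolding P_def using j i(2)[of j] i(2) by (auto simp: lattice_apply intro!: exI[of _ j])
    next
      case 3
      then show ?thesis
        unfolding P_def using i j by (auto simp: lattice_apply intro!: exI[of _ i] add_pos_pos)
    qed
  qed
  moreover have "0 \<notin> P"
    by (simp add: P_def lattice_apply)
  ultimately have P: "pos_cone P"
    unfolding pos_cone_def by blast
  have Q: "pos_cone (uminus ` P)"
    unfolding pos_cone_def
  proof (intro conjI ballI allI)
    show "0 \<notin> uminus ` P"
      using P by (auto simp: pos_cone_def image_iff)
    show "m + n \<in> uminus ` P" if "m \<in> uminus ` P" "n \<in> uminus ` P" for m n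
    proof -
      obtain x y where "x \<in> P" "y \<in> P" "m = - x" "n = - y"
        using \<open>m \<in> uminus ` P\<close> \<open>n \<in> uminus ` P\<close> by auto
      then show ?thesis
        using P by (intro image_eqI[of _ _ "x + y"]) (auto simp: pos_cone_def)
    qed
    show "m = 0 \<or> m \<in> uminus ` P \<or> - m \<in> uminus ` P" for m
      using P unfolding pos_cone_def by (metis image_eqI minus_minus)
  qed
  have "e \<in> P \<or> e \<in> uminus ` P"
    using P assms unfolding pos_cone_def by (metis image_eqI minus_minus)
  then show ?thesis
    using that P Q by blast
qed

lemma pos_cone_min:
  assumes P: "pos_cone P" and A: "finite A" "A \<noteq> {}"
  obtains a where "a \<in> A" "\<And>b. b \<in> A \<Longrightarrow> b = a \<or> b - a \<in> P"
proof -
  have "\<exists>a\<in>A. \<forall>b\<in>A. b = a \<or> b - a \<in> P"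
    using A
  proof (induction rule: finite_ne_induct)
    case (insert x A)
    then obtain a where a: "a \<in> A" "\<forall>b\<in>A. b = a \<or> b - a \<in> P"
      by blast
    have "x - a = 0 \<or> x - a \<in> P \<or> - (x - a) \<in> P"
      using P unfolding pos_cone_def by blast
    then consider "x = a \<or> x - a \<in> P" | "a - x \<in> P"
      by auto
    then show ?case
    proof cases
      case 2
      have "b - x \<in> P" if "b \<in> A" for b
      proof (cases "b = a")
        case False
        then have "(b - a) + (a - x) \<in> P"
          using P a that 2 unfolding pos_cone_def by blast
        then show ?thesis
          by simp
      qed (use 2 in simp)
      then show ?thesis
        by blast
    qed (use a in blast)
  qed simp
  then show ?thesis
    using that by blast
qed

lemma pos_cone_antisym: "pos_cone P \<Longrightarrow> m \<in> P \<Longrightarrow> - m \<notin> P"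
  unfolding pos_cone_def by (metis add.right_inverse)

subsection \<open>Homogeneous linear systems\<close>

text \<open>Gaussian elimination without division, by induction on the number of equations, which
  works over any integral domain.\<close>

lemma linear_system_nontrivial:
  fixes M :: "'e \<Rightarrow> 'v \<Rightarrow> 'k::comm_ring_1"
  assumes nzd: "\<And>x y :: 'k. x * y = 0 \<Longrightarrow> x = 0 \<or> y = 0"
    and "finite E" "finite V" "card E < card V"
  shows "\<exists>x. (\<exists>u\<in>V. x u \<noteq> 0) \<and> (\<forall>e\<in>E. (\<Sum>u\<in>V. M e u * x u) = 0)"
  using assms(2-)
proof (induction E arbitrary: V M rule: finite_induct)
  case empty
  then show ?case
    by (intro exI[of _ "\<lambda>_. 1"]) (auto simp: card_gt_0_iff)
next
  case (insert e0 E)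
  show ?case
  proof (cases "\<forall>u\<in>V. M e0 u = 0")
    case True
    obtain x where "\<exists>u\<in>V. x u \<noteq> 0" "\<forall>e\<in>E. (\<Sum>u\<in>V. M e u * x u) = 0"
      using insert.IH[of V M] insert.prems insert.hyps by fastforce
    then show ?thesis
      using True by (intro exI[of _ x]) auto
  next
    case False
    then obtain p where p: "p \<in> V" "M e0 p \<noteq> 0"
      by blast
    let ?V = "V - {p}"
    obtain x where x: "\<exists>u\<in>?V. x u \<noteq> 0"
        "\<forall>e\<in>E. (\<Sum>u\<in>?V. (M e0 p * M e u - M e p * M e0 u) * x u) = 0"
      using insert.IH[of ?V "\<lambda>e u. M e0 p * M e u - M e p * M e0 u"] insert.prems insert.hyps p by fastforce
    \<comment> \<open>The pivot unknown is chosen to solve \<open>e0\<close>; the others are scaled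
      by the pivot coefficient to avoid dividing by it. Row \<open>e\<close> then evaluates to row
      \<open>e\<close> of the reduced system, and row \<open>e0\<close> cancels identically.\<close>
    define y where "y u = (if u = p then - (\<Sum>u\<in>?V. M e0 u * x u) else M e0 p * x u)" for u
    have sum: "(\<Sum>u\<in>V. M e u * y u) = (\<Sum>u\<in>?V. (M e0 p * M e u - M e p * M e0 u) * x u)" for e
    proof -
      have "(\<Sum>u\<in>V. M e u * y u) = M e p * y p + (\<Sum>u\<in>?V. M e u * y u)"
        using p insert by (simp add: sum.remove)
      also have "(\<Sum>u\<in>?V. M e u * y u) = (\<Sum>u\<in>?V. M e u * (M e0 p * x u))"
        by (intro sum.cong) (auto simp: y_def)
      also have "M e p * y p = - (\<Sum>u\<in>?V. M e p * (M e0 u * x u))"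
        by (simp add: y_def sum_distrib_left)
      finally show ?thesis
        by (simp add: algebra_simps sum_subtractf)
    qed
    obtain u where u: "u \<in> ?V" "x u \<noteq> 0"
      using x(1) by blast
    then have "y u \<noteq> 0"
      using p(2) nzd[of "M e0 p" "x u"] by (auto simp: y_def)
    then have "\<exists>u\<in>V. y u \<noteq> 0"
      using u(1) by blast
    moreover have "\<forall>e\<in>insert e0 E. (\<Sum>u\<in>V. M e u * y u) = 0"
      using x(2) unfolding sum by (simp add: mult.commute[of "M e0 p"])
    ultimately show ?thesis
      by blast
  qed
qed

definition box :: "int \<Rightarrow> int \<Rightarrow> 'j lattice set" where
  "box a b = {m. \<forall>i. a \<le> m i \<and> m i \<le> b}"

lemma box_PiE: "box a b = PiE UNIV (\<lambda>_. {a..b})"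
  by (auto simp: box_def PiE_def Pi_def)

lemma finite_box: "finite (box a b :: ('j::finite) lattice set)"
  by (simp add: box_PiE finite_PiE)

lemma card_box: "card (box a b :: ('j::finite) lattice set) = nat (b - a + 1) ^ card (UNIV :: 'j set)"
  by (simp add: box_PiE card_PiE)

lemma finite_subset_box:
  fixes A :: "('j::finite) lattice set"
  assumes "finite A"
  obtains c where "c \<ge> 0" "A \<subseteq> box (- c) c"
proof -
  let ?S = "insert 0 ((\<lambda>(m, i). \<bar>m i\<bar>) ` (A \<times> (UNIV :: 'j set)))"
  have fin: "finite ?S"
    using assms by simp
  have "\<bar>m i\<bar> \<le> Max ?S" if "m \<in> A" for m i
    using that by (intro Max_ge[OF fin]) auto
  then have "A \<subseteq> box (- Max ?S) (Max ?S)"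
    unfolding box_def abs_le_iff mem_Collect_eq subset_iff by (metis minus_le_iff)
  moreover have "Max ?S \<ge> 0"
    by (intro Max_ge[OF fin]) auto
  ultimately show ?thesis
    using that by blast
qed

text \<open>\<open>(1 + c/M)^n\<close> tends to 1. The bound 2 is the number of unknown polynomials
  in the Ore condition, each with \<open>M^n\<close> coefficients.\<close>

lemma power_ratio_bound: "\<exists>M > 0. (M + c) ^ n < 2 * (M :: nat) ^ n"
proof -
  have "(\<lambda>M. (1 + real c / real M) ^ n) \<longlonglongrightarrow> (1 + 0) ^ n"
    by (intro tendsto_intros lim_const_over_n)
  then have "\<forall>\<^sub>F M in sequentially. (1 + real c / real M) ^ n < 2"
    by (rule order_tendstoD(2)) simp
  then have "\<forall>\<^sub>F M in sequentially. (1 + real c / real M) ^ n < 2 \<and> M > 0"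
    using eventually_gt_at_top[of 0] by (rule eventually_conj)
  then obtain M where M: "(1 + real c / real M) ^ n < 2" "M > 0"
    unfolding eventually_sequentially by blast
  have "real ((M + c) ^ n) = (1 + real c / real M) ^ n * real M ^ n"
  proof -
    have "real (M + c) = (1 + real c / real M) * real M"
      using M(2) by (simp add: field_simps)
    then show ?thesis
      by (simp only: of_nat_power power_mult_distrib)
  qed
  also have "\<dots> < 2 * real M ^ n"
    using M by (intro mult_strict_right_mono) auto
  finally have "real ((M + c) ^ n) < real (2 * M ^ n)"
    by simp
  then show ?thesis
    using M(2) of_nat_less_iff by blast
qed


subsection \<open>The twisted product\<close>

text \<open>\<open>\<chi>\<close> is an alternating bicharacter. Expanding
  \<open>\<chi> (m + n) (m + n)\<close> shows that it is skew, so its values are units.\<close>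

locale qtorus =
  fixes \<chi> :: "('j::finite) lattice \<Rightarrow> 'j lattice \<Rightarrow> 'k::comm_ring_1"
  assumes no_zero_div: "\<And>x y :: 'k. x * y = 0 \<Longrightarrow> x = 0 \<or> y = 0"
    and chi_add_left: "\<chi> (m + m') n = \<chi> m n * \<chi> m' n"
    and chi_add_right: "\<chi> m (n + n') = \<chi> m n * \<chi> m n'"
    and chi_alt: "\<chi> m m = 1"
begin

abbreviation times (infixl "\<star>" 70) where "f \<star> g \<equiv> tm \<chi> f g"

abbreviation T where "T \<equiv> torus \<chi>"

lemma chi_swap: "\<chi> m n * \<chi> n m = 1"
proof -
  have "1 = \<chi> (m + n) (m + n)"
    by (simp only: chi_alt)
  also have "\<dots> = \<chi> m n * \<chi> n m"
    by (simp only: chi_add_left chi_add_right) (simp add: chi_alt)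
  finally show ?thesis
    by simp
qed

lemma chi_nonzero: "\<chi> m n \<noteq> 0"
  using chi_swap[of m n] by force

lemma chi_zero_left [simp]: "\<chi> 0 n = 1"
proof -
  have "\<chi> 0 n * \<chi> 0 n = \<chi> 0 n * 1"
    using chi_add_left[of 0 0 n] by simp
  then have "\<chi> n 0 * \<chi> 0 n * \<chi> 0 n = \<chi> n 0 * \<chi> 0 n"
    by (simp only: mult.assoc mult_1_right)
  then show ?thesis
    by (simp add: chi_swap)
qed

lemma chi_zero_right [simp]: "\<chi> n 0 = 1"
  using chi_swap[of n 0] by simp

lemma tm_assoc: "f \<star> g \<star> h = f \<star> (g \<star> h)"
proof (induction f rule: laurent_induct)
  case f: (single m c)
  show ?case
  proof (induction g rule: laurent_induct)
    case g: (single n d)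
    show ?case
      by (induction h rule: laurent_induct)
         (simp_all add: tm_single_single tm_add_right chi_add_left chi_add_right add.assoc mult_ac)
  qed (simp add: tm_add_left tm_add_right)
qed (simp add: tm_add_left)

lemma tm_cst_single_left [simp]: "cst c \<star> f = cst c * f"
  by (induction f rule: laurent_induct) (simp_all add: tm_single_single tm_add_right distrib_left mult_single)

lemma tm_cst_single_right [simp]: "f \<star> cst c = cst c * f"
  by (induction f rule: laurent_induct) (simp_all add: tm_single_single tm_add_left distrib_left mult_single mult.commute[of c])

lemma tm_one [simp]: "1 \<star> f = f" "f \<star> 1 = f"
  using tm_cst_single_left[of 1 f] tm_cst_single_right[of f 1] by simp_all

text \<open>Lowest exponents add: \<open>m0 + n0\<close> decomposes in one way only, and its
  coefficient is a product of nonzero elements.\<close>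

lemma tm_nonzero:
  assumes "f \<noteq> 0" "g \<noteq> 0"
  shows "f \<star> g \<noteq> 0"
proof -
  obtain P :: "'j lattice set" where P: "pos_cone P"
    using pos_cone_ex[of "evec undefined :: 'j lattice"] by (metis evec_def zero_fun_apply zero_neq_one)
  obtain m0 where m0: "m0 \<in> keys f" "\<And>m. m \<in> keys f \<Longrightarrow> m = m0 \<or> m - m0 \<in> P"
    using pos_cone_min[OF P, of "keys f"] assms by auto
  obtain n0 where n0: "n0 \<in> keys g" "\<And>n. n \<in> keys g \<Longrightarrow> n = n0 \<or> n - n0 \<in> P"
    using pos_cone_min[OF P, of "keys g"] assms by auto
  have "m = m0 \<and> n = n0" if mn: "m \<in> keys f" "n \<in> keys g" "m + n = m0 + n0" for m n
  proof -
    have "n - n0 = - (m - m0)"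
      using mn(3) by (simp add: algebra_simps)
    then show ?thesis
      using m0(2)[OF mn(1)] n0(2)[OF mn(2)] pos_cone_antisym[OF P, of "m - m0"] mn(3) P
      by (auto simp: pos_cone_def)
  qed
  then have "lookup (f \<star> g) (m0 + n0) =
      \<chi> m0 n0 * lookup f m0 * lookup g n0"
    using m0 n0 by (intro lookup_tm_unique) blast+
  also have "\<dots> \<noteq> 0"
    using no_zero_div chi_nonzero m0(1) n0(1) by (metis in_keys_iff)
  finally show ?thesis
    by auto
qed

lemma ring_T: "ring T"
proof (rule ringI)
  show "abelian_group T"
    by (rule abelian_groupI) (auto simp: add_ac intro: exI[of _ "- x" for x] left_minus)
  show "Group.monoid T"
    by (rule monoidI) (auto simp: tm_assoc)
qed (auto simp: tm_add_left tm_add_right)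

text \<open>
  Multiplying a box of side \<open>M\<close> by fixed elements enlarges it by a bounded amount only, so for large
  \<open>M\<close> the condition \<open>b u = a w\<close> has more unknowns than equations.
\<close>

lemma common_multiple_T:
  assumes "a \<noteq> 0" "b \<noteq> 0"
  shows "\<exists>u w. u \<noteq> 0 \<and> w \<noteq> 0 \<and> b \<star> u = a \<star> w"
proof -
  obtain c where c: "c \<ge> 0" "keys a \<union> keys b \<subseteq> box (- c) c"
    using finite_subset_box[of "keys a \<union> keys b"] by auto
  obtain M where M: "M > 0" "(M + nat (2 * c)) ^ card (UNIV :: 'j set) < 2 * M ^ card (UNIV :: 'j set)"
    using power_ratio_bound by blast
  let ?B = "box 0 (int M - 1) :: 'j lattice set" and ?E = "box (- c) (c + int M - 1) :: 'j lattice set"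
  let ?V = "?B \<times> (UNIV :: bool set)"
  \<comment> \<open>The unknowns are the coefficients of \<open>u\<close> (flag \<open>True\<close>)
    and of \<open>w\<close> (flag \<open>False\<close>) on the box \<open>?B\<close>; row
    \<open>e\<close> is the coefficient of \<open>b u - a w\<close> at the exponent
    \<open>e\<close>.\<close>
  define M' where "M' e = (\<lambda>(m, s). lookup
      (if s then b \<star> single m 1 else - (a \<star> single m 1)) e)" for e
  have "nat (c + int M - 1 - - c + 1) = M + nat (2 * c)"
    using c(1) by simp
  then have "card ?E < card ?V"
    using M by (simp add: card_box card_cartesian_product)
  then obtain x where x: "\<exists>p\<in>?V. x p \<noteq> 0" "\<forall>e\<in>?E. (\<Sum>p\<in>?V. M' e p * x p) = 0"
    using linear_system_nontrivial[OF no_zero_div finite_box finite_cartesian_product[OF finite_box finite]]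
    by blast
  define u where "u = (\<Sum>m\<in>?B. single m (x (m, True)))"
  define w where "w = (\<Sum>m\<in>?B. single m (x (m, False)))"
  have expand: "f \<star> (\<Sum>m\<in>?B. single m (y m)) = (\<Sum>m\<in>?B. cst (y m) * (f \<star> single m 1))"
    for f y
  proof -
    have "f \<star> sum g A = (\<Sum>m\<in>A. f \<star> g m)" if "finite A" for g and A :: "'j lattice set"
      using that by induction (simp_all add: tm_add_right)
    then show ?thesis
      by (simp add: finite_box cst_mult_single flip: tm_cst_right)
  qed
  have "lookup (b \<star> u - a \<star> w) e = 0" for e
  proof (cases "e \<in> ?E")
    case True
    have "lookup (b \<star> u - a \<star> w) e = (\<Sum>p\<in>?V. M' e p * x p)"
    proof -
      have "(\<Sum>p\<in>?V. M' e p * x p) = (\<Sum>m\<in>?B. \<Sum>s\<in>UNIV. M' e (m, s) * x (m, s))"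
        by (simp add: sum.cartesian_product)
      then show ?thesis
        by (simp add: u_def w_def expand lookup_minus lookup_sum lookup_cst_mult M'_def UNIV_bool
              sum_subtractf mult.commute[of "lookup p e" for p e])
    qed
    then show ?thesis
      using x(2) True by simp
  next
    case False
    have "keys (f \<star> (\<Sum>m\<in>?B. single m (y m))) \<subseteq> ?E"
      if "f = a \<or> f = b" for f y
    proof
      fix e assume "e \<in> keys (f \<star> (\<Sum>m\<in>?B. single m (y m)))"
      then obtain p q where pq: "p \<in> keys f"
          "q \<in> keys (\<Sum>m\<in>?B. single m (y m))" "e = p + q"
        using keys_tm by blast
      have "p \<in> box (- c) c"
        using pq(1) c(2) that by blast
      moreover have "q \<in> ?B"
        using pq(2) by (rule rev_subsetD[OF _ keys_sum_subset]) simp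
      ultimately show "e \<in> ?E"
        unfolding pq(3) box_def mem_Collect_eq lattice_apply
      proof (intro allI)
        fix i assume "\<forall>i. - c \<le> p i \<and> p i \<le> c" "\<forall>i. 0 \<le> q i \<and> q i \<le> int M - 1"
        then have "- c \<le> p i \<and> p i \<le> c" "0 \<le> q i \<and> q i \<le> int M - 1"
          by blast+
        then show "- c \<le> p i + q i \<and> p i + q i \<le> c + int M - 1"
          by linarith
      qed
    qed
    from this[of b "\<lambda>m. x (m, True)"] this[of a "\<lambda>m. x (m, False)"] False show ?thesis
      unfolding u_def w_def lookup_minus
      by (metis (no_types, lifting) cancel_comm_monoid_add_class.diff_cancel in_keys_iff subsetD)
  qed
  then have eq: "b \<star> u = a \<star> w"
    by (metis eq_iff_diff_eq_0 lookup_zero poly_mapping_eqI)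
  have "lookup (\<Sum>m\<in>?B. single m (y m)) n = y n"
    if "n \<in> ?B" for y :: "'j lattice \<Rightarrow> 'k" and n
  proof -
    have "lookup (\<Sum>m\<in>?B. single m (y m)) n = (\<Sum>m\<in>?B. if m = n then y m else 0)"
      by (simp add: lookup_sum lookup_single when_def)
    also have "\<dots> = y n"
      using that by (subst sum.delta) (auto simp: finite_box)
    finally show ?thesis .
  qed
  note coeff = this
  obtain m s where ms: "m \<in> ?B" "x (m, s) \<noteq> 0"
    using x(1) by blast
  have "u \<noteq> 0 \<or> w \<noteq> 0"
  proof (cases s)
    case True
    then show ?thesis
      using ms coeff[OF ms(1), of "\<lambda>m. x (m, True)"] unfolding u_def by fastforce
  next
    case False
    then show ?thesis
      using ms coeff[OF ms(1), of "\<lambda>m. x (m, False)"] unfolding w_def by fastforce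
  qed
  then have "u \<noteq> 0 \<and> w \<noteq> 0"
    using eq tm_nonzero[OF assms(1), of w] tm_nonzero[OF assms(2), of u] by (metis tm_zero(2))
  then show ?thesis
    using eq by blast
qed

sublocale ore_domain T
proof (intro ore_domain.intro ring_T ore_domain_axioms.intro)
  show "\<one>\<^bsub>T\<^esub> \<noteq> \<zero>\<^bsub>T\<^esub>"
    by simp
  show "a = \<zero>\<^bsub>T\<^esub> \<or> b = \<zero>\<^bsub>T\<^esub>" if "a \<otimes>\<^bsub>T\<^esub> b = \<zero>\<^bsub>T\<^esub>" for a b
    using that tm_nonzero by auto
  show "\<exists>u\<in>carrier T. \<exists>w\<in>carrier T - {\<zero>\<^bsub>T\<^esub>}. b \<otimes>\<^bsub>T\<^esub> u = a \<otimes>\<^bsub>T\<^esub> w"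
    if "b \<in> carrier T - {\<zero>\<^bsub>T\<^esub>}" for a b
  proof (cases "a = 0")
    case True
    then show ?thesis
      by (intro bexI[of _ 0] bexI[of _ "cst 1"]) auto
  next
    case False
    then show ?thesis
      using common_multiple_T[of a b] that by auto
  qed
qed

abbreviation emb where "emb \<equiv> ore_embed T"
abbreviation cls where "cls \<equiv> ore_class T"

end

section \<open>Quantum binomials\<close>

text \<open>The symmetric Pascal rule; \<open>\<kappa> j\<close> plays the role of \<open>q^j\<close>.\<close>

fun gbinom :: "(int \<Rightarrow> 'k::comm_ring_1) \<Rightarrow> nat \<Rightarrow> nat \<Rightarrow> 'k" where
  "gbinom \<kappa> n 0 = 1"
| "gbinom \<kappa> 0 (Suc r) = 0"
| "gbinom \<kappa> (Suc n) (Suc r) =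
     \<kappa> (int r + 1) * gbinom \<kappa> n (Suc r) + \<kappa> (int r - int n) * gbinom \<kappa> n r"

lemma gbinom_eq_0: "n < r \<Longrightarrow> gbinom \<kappa> n r = 0"
  by (induction \<kappa> n r rule: gbinom.induct) auto

lemma sum_lessThan_add: "(\<Sum>i<a + b. f i) = (\<Sum>i<a. f i) + (\<Sum>i<b. f (a + i :: nat))"
  by (induction b) (auto simp: add.assoc)

locale q_powers =
  fixes v :: "rat \<Rightarrow> 'k::comm_ring_1" and x :: rat and \<kappa> :: "int \<Rightarrow> 'k"
  assumes kappa_def: "\<kappa> j = v (x * of_int j)"
    and kappa_add: "\<kappa> (i + j) = \<kappa> i * \<kappa> j"
    and kappa_0 [simp]: "\<kappa> 0 = 1"
    and qint_nonzero: "a > 0 \<Longrightarrow> qint v x a \<noteq> 0"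
    and nzd: "\<And>a b :: 'k. a * b = 0 \<Longrightarrow> a = 0 \<or> b = 0"
begin

lemma qint_kappa: "qint v x a = (\<Sum>i<a. \<kappa> (int a - 1 - 2 * int i))"
  by (simp add: qint_def kappa_def)

lemma qint_add: "qint v x (a + b) = \<kappa> (int b) * qint v x a + \<kappa> (- int a) * qint v x b"
  by (simp add: qint_kappa sum_lessThan_add sum_distrib_left algebra_simps flip: kappa_add)

lemma qfact_Suc: "qfact v x (Suc n) = qint v x (Suc n) * qfact v x n"
  by (simp add: qfact_def mult.commute)

lemma qfact_0: "qfact v x 0 = 1"
  by (simp add: qfact_def)

lemma qfact_nonzero: "qfact v x n \<noteq> 0"
  by (induction n) (use qint_nonzero nzd in \<open>auto simp: qfact_0 qfact_Suc\<close>)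

text \<open>Pascal's rule mirrors the splitting \<open>[n+1] = q^(s+1) [n-s] + q^(s-n) [s+1]\<close>
  of quantum integers, multiplied by \<open>[n]!\<close>.\<close>

lemma gbinom_qfact: "r \<le> n \<Longrightarrow> gbinom \<kappa> n r * (qfact v x r * qfact v x (n - r)) = qfact v x n"
proof (induction n arbitrary: r)
  case (Suc n)
  show ?case
  proof (cases r)
    case 0
    then show ?thesis
      by (simp add: qfact_0)
  next
    case r: (Suc s)
    have 1: "\<kappa> (int s - int n) * gbinom \<kappa> n s * (qfact v x (Suc s) * qfact v x (n - s))
        = \<kappa> (int s - int n) * qint v x (Suc s) * qfact v x n"
    proof -
      have IH: "qfact v x n = gbinom \<kappa> n s * (qfact v x s * qfact v x (n - s))"
        using Suc.IH[of s] Suc.prems r by simp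
      show ?thesis
        by (simp only: IH qfact_Suc mult_ac)
    qed
    have 2: "\<kappa> (int s + 1) * gbinom \<kappa> n (Suc s) * (qfact v x (Suc s) * qfact v x (n - s))
        = \<kappa> (int s + 1) * qint v x (n - s) * qfact v x n"
    proof (cases "s = n")
      case True
      then show ?thesis
        by (simp add: gbinom_eq_0 qint_def)
    next
      case False
      then have *: "n - s = Suc (n - Suc s)"
        using Suc.prems r by simp
      have IH: "qfact v x n = gbinom \<kappa> n (Suc s) * (qfact v x (Suc s) * qfact v x (n - Suc s))"
        using Suc.IH[of "Suc s"] Suc.prems r False by simp
      show ?thesis
        unfolding * qfact_Suc[of "n - Suc s"] by (simp only: IH mult_ac)
    qed
    have "qint v x (Suc n) = \<kappa> (int s + 1) * qint v x (n - s) + \<kappa> (int s - int n) * qint v x (Suc s)"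
      using qint_add[of "n - s" "Suc s"] Suc.prems r by (simp add: of_nat_diff algebra_simps)
    then show ?thesis
      using 1 2 r by (simp add: distrib_right qfact_Suc[of n])
  qed
qed (simp add: qfact_0)

text \<open>The definite description in \<open>qbinom\<close> has a unique solution because quantum
  factorials are nonzero and the base ring has no zero divisors.\<close>

lemma qbinom_eq: "r \<le> n \<Longrightarrow> qbinom v x n r = gbinom \<kappa> n r"
  unfolding qbinom_def
proof (rule the_equality)
  assume "r \<le> n"
  then show "gbinom \<kappa> n r * (qfact v x r * qfact v x (n - r)) = qfact v x n"
    by (rule gbinom_qfact)
  fix c assume "c * (qfact v x r * qfact v x (n - r)) = qfact v x n"
  then have "(c - gbinom \<kappa> n r) * (qfact v x r * qfact v x (n - r)) = 0"
    using gbinom_qfact[OF \<open>r \<le> n\<close>] by (simp add: left_diff_distrib)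
  then show "c = gbinom \<kappa> n r"
    using nzd qfact_nonzero by (metis eq_iff_diff_eq_0)
qed

end


section \<open>Uniqueness of homomorphisms on fractions\<close>

lemma lattice_expand: "m = (\<Sum>i\<in>UNIV. (\<lambda>j. m i * evec i j))" for m :: "('j::finite) lattice"
proof
  fix j
  have sum_apply: "(\<Sum>i\<in>A. f i) j = (\<Sum>i\<in>A. f i j)" for A and f :: "'j \<Rightarrow> 'j lattice"
    by (induction A rule: infinite_finite_induct) (auto simp: lattice_apply)
  show "m j = (\<Sum>i\<in>UNIV. (\<lambda>j. m i * evec i j)) j"
    by (simp add: sum_apply evec_def if_distrib[of "(*) _"] cong: if_cong)
qed

lemma lattice_induct [case_names zero evec add minus]:
  fixes m :: "('j::finite) lattice"
  assumes "P 0" "\<And>i. P (evec i)" "\<And>m n. P m \<Longrightarrow> P n \<Longrightarrow> P (m + n)" "\<And>m. P m \<Longrightarrow> P (- m)"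
  shows "P m"
proof -
  have nat: "P (\<lambda>j. int n * evec i j)" for n i
  proof (induction n)
    case 0
    then show ?case
      using assms(1) by (simp add: zero_fun_def)
  next
    case (Suc n)
    have "(\<lambda>j. int (Suc n) * evec i j) = evec i + (\<lambda>j. int n * evec i j)"
      by (auto simp: fun_eq_iff lattice_apply algebra_simps)
    then show ?case
      using assms(2,3) Suc by simp
  qed
  have int: "P (\<lambda>j. c * evec i j)" for c i
  proof (cases c rule: int_cases2)
    case (nonpos n)
    have "(\<lambda>j. c * evec i j) = - (\<lambda>j. int n * evec i j)"
      using nonpos by (auto simp: fun_eq_iff)
    then show ?thesis
      using nat assms(4) by simp
  qed (use nat in simp)
  have "P (\<Sum>i\<in>A. (\<lambda>j. m i * evec i j))" if "finite A" for A
    using that by induction (use assms int in auto)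
  then show ?thesis
    using lattice_expand[of m] by (metis finite)
qed

context qtorus
begin

lemma chi_minus: "\<chi> m (- m) = 1"
  using chi_add_right[of m m "- m"] chi_alt[of m] by simp

lemma emb_add: "emb (f + g) = emb f \<oplus>\<^bsub>F\<^esub> emb g"
  using ring_hom_add[OF embed_hom, of f g] by simp

lemma emb_mult: "emb (f \<star> g) = emb f \<otimes>\<^bsub>F\<^esub> emb g"
  using ring_hom_mult[OF embed_hom, of f g] by simp

lemma emb_one: "emb 1 = \<one>\<^bsub>F\<^esub>"
  using ring_hom_one[OF embed_hom] by simp

lemma emb_closed [simp]: "emb f \<in> carrier F"
  using ring_hom_closed[OF embed_hom, of f] by simp

text \<open>Constants and generators reach every monomial through inverses and through products,
  which cost only a scalar; fractions follow by \<open>frac_hom_class\<close>. This identifies a map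
  picked by \<open>SOME\<close> with one that is constructed explicitly.\<close>

lemma frac_hom_unique:
  assumes D: "division_ring D" and hom: "\<psi> \<in> ring_hom F D" "\<psi>' \<in> ring_hom F D"
    and cst: "\<And>c. \<psi> (emb (cst c)) = \<psi>' (emb (cst c))"
    and gen: "\<And>i. \<psi> (emb (single (evec i) 1)) = \<psi>' (emb (single (evec i) 1))"
    and x: "x \<in> carrier F"
  shows "\<psi> x = \<psi>' x"
proof -
  interpret D: division_ring D by fact
  note mult = ring_hom_mult[OF hom(1)] ring_hom_mult[OF hom(2)]
  note closed = ring_hom_closed[OF hom(1)] ring_hom_closed[OF hom(2)]
  have mono: "\<psi> (emb (single m 1)) = \<psi>' (emb (single m 1))" for m
  proof (induction m rule: lattice_induct)
    case zero
    then show ?case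
      by (rule cst)
  next
    case (add m n)
    \<comment> \<open>The scalar \<open>\<chi> n m\<close> undoes the twist
      \<open>\<chi> m n\<close> of the product.\<close>
    have "single (m + n) 1 = cst (\<chi> n m) \<star> (single m 1 \<star> single n 1)"
      using chi_swap[of n m] by (simp add: tm_single_single cst_mult_single)
    then show ?case
      using add cst by (simp add: emb_mult mult F_mult_closed del: tm_cst_single_left)
  next
    case (minus m)
    have "single m 1 \<star> single (- m) 1 = 1"
        "single (- m) 1 \<star> single m 1 = 1"
      using chi_minus[of m] chi_minus[of "- m"] by (simp_all add: tm_single_single)
    then have e: "emb (single m 1) \<otimes>\<^bsub>F\<^esub> emb (single (- m) 1) = \<one>\<^bsub>F\<^esub>"
        "emb (single (- m) 1) \<otimes>\<^bsub>F\<^esub> emb (single m 1) = \<one>\<^bsub>F\<^esub>"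
      by (simp_all add: emb_one flip: emb_mult)
    have 1: "\<psi> (emb (single (- m) 1)) \<otimes>\<^bsub>D\<^esub> \<psi> (emb (single m 1)) = \<one>\<^bsub>D\<^esub>"
      using ring_hom_one[OF hom(1)] e(2) by (simp flip: mult)
    have 2: "\<psi> (emb (single m 1)) \<otimes>\<^bsub>D\<^esub> \<psi>' (emb (single (- m) 1)) = \<one>\<^bsub>D\<^esub>"
      unfolding minus using ring_hom_one[OF hom(2)] e(1) by (simp flip: mult)
    show ?case
      by (rule D.inv_unique[OF 1 2]) (auto intro: closed)
  qed (rule gen)
  have emb: "\<psi> (emb f) = \<psi>' (emb f)" for f
  proof (induction f rule: laurent_induct)
    case (single m c)
    have "single m c = cst c \<star> single m 1"
      by (simp add: tm_single_single)
    then show ?case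
      using mono cst by (simp only: emb_mult mult[OF emb_closed emb_closed])
  next
    case (add f g)
    then show ?case
      by (simp add: emb_add ring_hom_add[OF hom(1)] ring_hom_add[OF hom(2)])
  qed
  obtain a b where "a \<in> carrier T" "b \<in> nz" "x = cls a b"
    using x by (rule F_cases)
  then show ?thesis
    using frac_hom_class[OF D hom(1)] frac_hom_class[OF D hom(2)] emb by simp
qed

end


section \<open>Mutation maps\<close>

text \<open>A factor of the quantum dilogarithm product. Moving a monomial past it only shifts the
  index \<open>i\<close>, see \<open>lfac_mono\<close>.\<close>

definition lfac :: "(int \<Rightarrow> 'k) \<Rightarrow> 'j lattice \<Rightarrow> int \<Rightarrow> ('j, 'k::comm_ring_1) laurent" where
  "lfac \<kappa> e i = 1 + single e (\<kappa> (2 * i + 1))"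

primrec lprod :: "('j lattice \<Rightarrow> 'j lattice \<Rightarrow> 'k) \<Rightarrow> (int \<Rightarrow> 'k) \<Rightarrow> 'j lattice \<Rightarrow> nat \<Rightarrow> int \<Rightarrow>
    ('j, 'k::comm_ring_1) laurent" where
  "lprod \<chi> \<kappa> e 0 a = 1"
| "lprod \<chi> \<kappa> e (Suc n) a = tm \<chi> (lfac \<kappa> e a) (lprod \<chi> \<kappa> e n (a + 1))"

text \<open>This is \<open>1\<close> for \<open>b < a\<close>.\<close>

definition Lprod :: "('j lattice \<Rightarrow> 'j lattice \<Rightarrow> 'k) \<Rightarrow> (int \<Rightarrow> 'k) \<Rightarrow> 'j lattice \<Rightarrow> int \<Rightarrow> int \<Rightarrow>
    ('j, 'k::comm_ring_1) laurent" where
  "Lprod \<chi> \<kappa> e a b = lprod \<chi> \<kappa> e (nat (b - a)) a"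

text \<open>
  A mutation sends \<open>X'^m\<close> to \<open>X^(\<tau> m) G(q^(2 h(\<tau> m)) X^e) / G(X^e)\<close> with the formal product
  \<open>G(x) = \<Prod>i\<ge>0. (1 + q^(2i+1) x)\<close>. Cutting both products off at \<open>N\<close> gives a fraction with
  numerator \<open>numer\<close> and a denominator that does not depend on \<open>m\<close>.
\<close>

definition numer :: "('j lattice \<Rightarrow> 'j lattice \<Rightarrow> 'k) \<Rightarrow> (int \<Rightarrow> 'k) \<Rightarrow> 'j lattice \<Rightarrow>
    ('j lattice \<Rightarrow> int) \<Rightarrow> ('j lattice \<Rightarrow> 'j lattice) \<Rightarrow> int \<Rightarrow>
    ('j, 'k) laurent \<Rightarrow> ('j, 'k::comm_ring_1) laurent" where
  "numer \<chi> \<kappa> e h \<tau> N = linext (\<lambda>m. tm \<chi> (single (\<tau> m) 1) (Lprod \<chi> \<kappa> e (h (\<tau> m)) N))"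

text \<open>The least admissible cut-off: below \<open>h (\<tau> m)\<close> the product
  \<open>Lprod\<close> is 1 where an inverse product would be required. The inserted 0 protects the
  common denominator, which starts at index 0, in the same way.\<close>

definition bnd :: "('j lattice \<Rightarrow> int) \<Rightarrow> ('j lattice \<Rightarrow> 'j lattice) \<Rightarrow> ('j, 'k::comm_ring_1) laurent \<Rightarrow> int" where
  "bnd h \<tau> f = Max (insert 0 ((\<lambda>m. h (\<tau> m)) ` keys f))"

lemma bnd_nonneg: "0 \<le> bnd h \<tau> f"
  unfolding bnd_def by (intro Max_ge) auto

lemma bnd_ge: "m \<in> keys f \<Longrightarrow> h (\<tau> m) \<le> bnd h \<tau> f"
  unfolding bnd_def by (intro Max_ge) auto

lemma keys_lprod:
  assumes "0 \<in> U" "e \<in> U" "\<And>m n. m \<in> U \<Longrightarrow> n \<in> U \<Longrightarrow> m + n \<in> U"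
  shows "keys (lprod \<chi> \<kappa> e n a) \<subseteq> U"
proof (induction n arbitrary: a)
  case (Suc n)
  have "keys (lfac \<kappa> e a) \<subseteq> U"
    unfolding lfac_def using Poly_Mapping.keys_add assms(1,2) by (fastforce split: if_splits)
  then show ?case
    using Suc keys_tm[of \<chi> "lfac \<kappa> e a" "lprod \<chi> \<kappa> e n (a + 1)"] assms(3) by fastforce
qed (use assms in simp)

lemma keys_Lprod:
  assumes "0 \<in> U" "e \<in> U" "\<And>m n. m \<in> U \<Longrightarrow> n \<in> U \<Longrightarrow> m + n \<in> U"
  shows "keys (Lprod \<chi> \<kappa> e a b) \<subseteq> U"
  unfolding Lprod_def using keys_lprod[OF assms] .

lemma keys_numer:
  assumes "0 \<in> U" "e \<in> U" "\<And>m n. m \<in> U \<Longrightarrow> n \<in> U \<Longrightarrow> m + n \<in> U"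
  shows "keys (numer \<chi> \<kappa> e h \<tau> N f) \<subseteq> {\<tau> m + n | m n. m \<in> keys f \<and> n \<in> U}"
  unfolding numer_def
proof (rule keys_linext)
  fix m assume "m \<in> keys f"
  then show "keys (tm \<chi> (single (\<tau> m) 1) (Lprod \<chi> \<kappa> e (h (\<tau> m)) N))
      \<subseteq> {\<tau> m + n | m n. m \<in> keys f \<and> n \<in> U}"
    using keys_tm[of \<chi> "single (\<tau> m) 1" "Lprod \<chi> \<kappa> e (h (\<tau> m)) N"] keys_Lprod[OF assms]
    by fastforce
qed

text \<open>The twists have to agree only for exponents of the right factor \<open>g\<close>. This
  one-sided form is what a pushforward that is not a ring homomorphism can still satisfy.\<close>

lemma push_tm:
  assumes "\<And>m n. \<theta> (m + n) = \<theta> m + \<theta> n"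
    and "\<And>m n. n \<in> keys g \<Longrightarrow> \<chi>2 (\<theta> m) (\<theta> n) = \<chi>1 m n"
  shows "push \<theta> (tm \<chi>1 f g) = tm \<chi>2 (push \<theta> f) (push \<theta> g)"
proof -
  have "push \<theta> (tm \<chi>1 (single m 1) g) = tm \<chi>2 (push \<theta> (single m 1)) (push \<theta> g)" for m
    unfolding tm_linext_right tm_single_left linext_cst_mult linext_linext
    using assms by (auto simp: tm_single_single cst_mult_single intro!: linext_cong)
  then have "push \<theta> (tm \<chi>1 (single m c) g) = tm \<chi>2 (push \<theta> (single m c)) (push \<theta> g)" for m c
    using tm_cst_left[of \<chi>1 c "single m 1" g]
      tm_cst_left[of \<chi>2 c "single (\<theta> m) 1" "push \<theta> g"]
    by (simp add: tm_cst_left cst_mult_single linext_cst_mult)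
  then show ?thesis
    by (induction f rule: laurent_induct) (simp_all add: tm_add_left linext_add)
qed

text \<open>\<open>U\<close> is a monoid of exponents that contains \<open>e\<close>, hence all
  exponents of the cut-off products. These always stand on the right, so agreement of the twists for
  \<open>n \<in> U\<close> suffices.\<close>

lemma push_numer:
  assumes add: "\<And>m n. \<theta> (m + n) = \<theta> m + \<theta> n"
    and U: "0 \<in> U" "e \<in> U" "\<And>m n. m \<in> U \<Longrightarrow> n \<in> U \<Longrightarrow> m + n \<in> U"
    and chi: "\<And>m n. n \<in> U \<Longrightarrow> \<chi>2 (\<theta> m) (\<theta> n) = \<chi>1 m n"
    and e: "\<theta> e = e2" and h: "\<And>m. h2 (\<theta> m) = h1 m" and tau: "\<And>m. \<theta> (\<tau>1 m) = \<tau>2 (\<theta>' m)"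
  shows "push \<theta> (numer \<chi>1 \<kappa> e h1 \<tau>1 N f) = numer \<chi>2 \<kappa> e2 h2 \<tau>2 N (push \<theta>' f)"
proof -
  have theta0: "\<theta> 0 = 0"
    using add[of 0 0] by simp
  have lfac: "push \<theta> (lfac \<kappa> e a) = lfac \<kappa> e2 a" for a
    using theta0 e by (simp add: lfac_def linext_add cst_mult_single flip: single_one)
  have "push \<theta> (lprod \<chi>1 \<kappa> e n a) = lprod \<chi>2 \<kappa> e2 n a" for n a
  proof (induction n arbitrary: a)
    case 0
    then show ?case
      using theta0 by (simp add: cst_mult_single flip: single_one)
  next
    case (Suc n)
    then show ?case
      using push_tm[of \<theta> "lprod \<chi>1 \<kappa> e n (a + 1)" \<chi>2 \<chi>1 "lfac \<kappa> e a"] add chi lfac keys_lprod[OF U]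
      by fastforce
  qed
  then have Lprod: "push \<theta> (Lprod \<chi>1 \<kappa> e a b) = Lprod \<chi>2 \<kappa> e2 a b" for a b
    by (simp add: Lprod_def)
  have "push \<theta> (tm \<chi>1 (single (\<tau>1 m) 1) (Lprod \<chi>1 \<kappa> e (h1 (\<tau>1 m)) N))
      = tm \<chi>2 (single (\<tau>2 (\<theta>' m)) 1) (Lprod \<chi>2 \<kappa> e2 (h2 (\<tau>2 (\<theta>' m))) N)" for m
    using push_tm[of \<theta> "Lprod \<chi>1 \<kappa> e (h1 (\<tau>1 m)) N" \<chi>2 \<chi>1 "single (\<tau>1 m) 1"]
      add chi keys_Lprod[OF U] h[of "\<tau>1 m"] tau[of m] Lprod by (fastforce simp: push_single)
  then show ?thesis
    by (simp add: numer_def linext_linext)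
qed

lemma bnd_push:
  assumes "\<And>m. h2 (\<tau>2 (\<theta>' m)) = h1 (\<tau>1 m)"
  shows "bnd h2 \<tau>2 (push \<theta>' f) \<le> bnd h1 \<tau>1 f"
proof -
  have "h2 (\<tau>2 m) \<in> (\<lambda>m. h1 (\<tau>1 m)) ` keys f" if "m \<in> keys (push \<theta>' f)" for m
    using that keys_push[of \<theta>' f] assms by auto
  then show ?thesis
    unfolding bnd_def by (intro Max_mono) auto
qed

section \<open>The fraction formula for an abstract mutation\<close>

locale mutation_map = T: qtorus \<chi> + T': qtorus \<chi>'
  for \<chi> \<chi>' :: "('j::finite) lattice \<Rightarrow> 'j lattice \<Rightarrow> 'k::comm_ring_1" +
  fixes \<tau> :: "'j lattice \<Rightarrow> 'j lattice" and h :: "'j lattice \<Rightarrow> int" and e :: "'j lattice"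
    and \<kappa> :: "int \<Rightarrow> 'k"
  assumes tau_add: "\<tau> (m + n) = \<tau> m + \<tau> n"
    and tau_inj: "inj \<tau>"
    and chi_tau: "\<chi>' m n = \<chi> (\<tau> m) (\<tau> n)"
    and h_add: "h (m + n) = h m + h n"
    and e_nonzero: "e \<noteq> 0"
    and kappa_add: "\<kappa> (i + j) = \<kappa> i * \<kappa> j"
    and kappa_0 [simp]: "\<kappa> 0 = 1"
    and chi_e: "\<chi> m e = \<kappa> (- h m)"
begin

abbreviation tmult (infixl "\<odot>" 70) where "f \<odot> g \<equiv> tm \<chi> f g"
abbreviation L where "L \<equiv> Lprod \<chi> \<kappa> e"
abbreviation num where "num \<equiv> numer \<chi> \<kappa> e h \<tau>"
abbreviation xpow where "xpow m \<equiv> single m (1 :: 'k)"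

lemma tau_0: "\<tau> 0 = 0" and h_0: "h 0 = 0"
  using tau_add[of 0 0] h_add[of 0 0] by simp_all

lemma lprod_add: "lprod \<chi> \<kappa> e (n + n') a = lprod \<chi> \<kappa> e n a \<odot> lprod \<chi> \<kappa> e n' (a + int n)"
proof (induction n arbitrary: a)
  case (Suc n)
  then show ?case
    by (simp add: T.tm_assoc add_ac)
qed simp

lemma L_refl [simp]: "L a a = 1"
  by (simp add: Lprod_def)

lemma L_split:
  assumes "a \<le> b" "b \<le> c"
  shows "L a c = L a b \<odot> L b c"
proof -
  have "nat (c - a) = nat (b - a) + nat (c - b)" "a + int (nat (b - a)) = b"
    using assms by auto
  then show ?thesis
    unfolding Lprod_def using lprod_add[of "nat (b - a)" "nat (c - b)" a] by simp
qed

lemma chi_e_left: "\<chi> e m = \<kappa> (h m)"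
proof -
  have "\<chi> e m = \<kappa> (h m + - h m) * \<chi> e m"
    by simp
  also have "\<dots> = \<kappa> (h m) * (\<chi> m e * \<chi> e m)"
    by (simp only: kappa_add chi_e mult.assoc)
  finally show ?thesis
    by (simp add: T.chi_swap)
qed

text \<open>Exchanging \<open>X^n\<close> and \<open>X^e\<close> costs \<open>q^(h n)\<close> in one
  order and \<open>q^(- h n)\<close> in the other; the quotient \<open>q^(2 h n)\<close> is a shift
  of the index by \<open>h n\<close>.\<close>

lemma lfac_mono: "lfac \<kappa> e i \<odot> xpow n = xpow n \<odot> lfac \<kappa> e (i + h n)"
proof -
  have "\<chi> e n * \<kappa> (2 * i + 1) = \<chi> n e * \<kappa> (2 * (i + h n) + 1)"
    unfolding chi_e chi_e_left kappa_add[symmetric] by (simp add: algebra_simps)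
  then show ?thesis
    by (simp add: lfac_def tm_add_left tm_add_right tm_single_single add.commute)
qed

lemma lprod_mono: "lprod \<chi> \<kappa> e k a \<odot> xpow n = xpow n \<odot> lprod \<chi> \<kappa> e k (a + h n)"
proof (induction k arbitrary: a)
  case (Suc k)
  have "lprod \<chi> \<kappa> e (Suc k) a \<odot> xpow n = lfac \<kappa> e a \<odot> xpow n \<odot> lprod \<chi> \<kappa> e k (a + 1 + h n)"
    using Suc[of "a + 1"] by (simp add: T.tm_assoc)
  then show ?case
    by (simp add: lfac_mono T.tm_assoc add_ac)
qed simp

lemma L_mono: "L a b \<odot> xpow n = xpow n \<odot> L (a + h n) (b + h n)"
  unfolding Lprod_def using lprod_mono by simp

text \<open>If \<open>e\<close> is positive, every factor has lowest term 1, hence so has the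
  product. The order must be adapted to \<open>e\<close>, which is why \<open>pos_cone_ex\<close>
  takes a vector.\<close>

lemma unipotent:
  assumes P: "pos_cone P" "e \<in> P"
  shows "keys (L a b) \<subseteq> insert 0 P" "lookup (L a b) 0 = 1"
proof -
  show "keys (L a b) \<subseteq> insert 0 P"
    using P by (intro keys_Lprod) (auto simp: pos_cone_def)
  have 1: "keys (lprod \<chi> \<kappa> e n a) \<subseteq> insert 0 P" for n a
    using P by (intro keys_lprod) (auto simp: pos_cone_def)
  have "lookup (lprod \<chi> \<kappa> e n a) 0 = 1" for n
  proof (induction n arbitrary: a)
    case (Suc n)
    have 2: "lookup (lfac \<kappa> e a) 0 = 1"
      using e_nonzero by (simp add: lfac_def lookup_add lookup_single when_def)
    have 3: "keys (lfac \<kappa> e a) \<subseteq> insert 0 P"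
      unfolding lfac_def using Poly_Mapping.keys_add P(2) by (fastforce split: if_splits)
    have "lookup (lfac \<kappa> e a \<odot> lprod \<chi> \<kappa> e n (a + 1)) (0 + 0) =
        \<chi> 0 0 * lookup (lfac \<kappa> e a) 0 * lookup (lprod \<chi> \<kappa> e n (a + 1)) 0"
    proof (rule lookup_tm_unique)
      fix m k assume m: "m \<in> keys (lfac \<kappa> e a)"
        "k \<in> keys (lprod \<chi> \<kappa> e n (a + 1))" "m + k = 0 + 0"
      then have k: "k = - m"
        by (simp add: eq_neg_iff_add_eq_0 add.commute)
      have "m = 0 \<or> m \<in> P" "k = 0 \<or> k \<in> P"
        using m 1 3 by blast+
      then show "m = 0 \<and> k = 0"
        using k pos_cone_antisym[OF P(1), of m] by auto
    qed (use 2 Suc in \<open>auto simp: in_keys_iff\<close>)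
    then show ?case
      using 2 Suc by simp
  qed simp
  then show "lookup (L a b) 0 = 1"
    by (simp add: Lprod_def)
qed

lemma L_nonzero: "L a b \<noteq> 0"
  using pos_cone_ex[OF e_nonzero] unipotent(2) by (metis lookup_zero zero_neq_one)

text \<open>Multiplication by a cut-off product keeps the lowest term of a monomial, and
  \<open>\<tau>\<close> is injective, so the term of \<open>f\<close> with the lowest image
  survives.\<close>

lemma num_nonzero:
  assumes "f \<noteq> 0"
  shows "num N f \<noteq> 0"
proof -
  obtain P where P: "pos_cone P" "e \<in> P"
    using pos_cone_ex[OF e_nonzero] .
  have "\<tau> ` keys f \<noteq> {}"
    using assms by simp
  then obtain k where k: "k \<in> \<tau> ` keys f"
      "\<And>n. n \<in> \<tau> ` keys f \<Longrightarrow> n = k \<or> n - k \<in> P"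
    using pos_cone_min[OF P(1) finite_imageI[OF finite_keys], of \<tau> f] by blast
  then obtain m0 where m0: "m0 \<in> keys f"
      "\<And>m. m \<in> keys f \<Longrightarrow> \<tau> m = \<tau> m0 \<or> \<tau> m - \<tau> m0 \<in> P"
    by blast
  have mult: "lookup (xpow n \<odot> L a b) p = (if p = n then 1 else 0)"
    if "p = n \<or> n - p \<in> P" for n a b p
  proof -
    have n: "n \<in> keys (xpow n)"
      by simp
    show ?thesis
    proof (cases "p = n")
      case True
      have "lookup (xpow n \<odot> L a b) (n + 0) =
          \<chi> n 0 * lookup (xpow n) n * lookup (L a b) 0"
        by (rule lookup_tm_unique) (use unipotent(2)[OF P] in \<open>auto simp: in_keys_iff lookup_single when_def\<close>)
      then show ?thesis
        using True unipotent(2)[OF P] by simp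
    next
      case False
      have "p \<notin> keys (xpow n \<odot> L a b)"
      proof
        assume "p \<in> keys (xpow n \<odot> L a b)"
        then obtain k where k: "k \<in> keys (L a b)" "p = n + k"
          using keys_tm[of \<chi> "xpow n" "L a b"] by auto
        then have "k = 0 \<or> k \<in> P" "- k = n - p"
          using unipotent(1)[OF P] by auto
        then show False
          using that False pos_cone_antisym[OF P(1), of k] k(2) by auto
      qed
      then show ?thesis
        using False by (simp add: in_keys_iff)
    qed
  qed
  have "lookup (num N f) (\<tau> m0) =
      (\<Sum>m\<in>keys f. lookup f m * lookup (xpow (\<tau> m) \<odot> L (h (\<tau> m)) N) (\<tau> m0))"
    by (simp add: numer_def linext_def lookup_sum lookup_cst_mult)
  also have "\<dots> = (\<Sum>m\<in>keys f. if m = m0 then lookup f m else 0)"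
    using m0(2) tau_inj by (intro sum.cong refl) (subst mult, auto simp: inj_eq)
  also have "\<dots> = lookup f m0"
    using m0(1) by (subst sum.delta) auto
  finally show ?thesis
    using m0(1) by (auto simp: in_keys_iff)
qed

lemma num_add: "num N (f + g) = num N f + num N g"
  by (simp add: numer_def linext_add)

lemma num_single: "num N (single m c) = cst c * (xpow (\<tau> m) \<odot> L (h (\<tau> m)) N)"
  by (simp add: numer_def)

text \<open>Every summand gains the same right factor. The denominator \<open>L 0 N\<close> gains it
  too, so the fraction does not depend on the cut-off.\<close>

lemma num_expand:
  assumes "bnd h \<tau> f \<le> N" "N \<le> N'"
  shows "num N' f = num N f \<odot> L N N'"
proof -
  have "xpow (\<tau> m) \<odot> L (h (\<tau> m)) N' = xpow (\<tau> m) \<odot> L (h (\<tau> m)) N \<odot> L N N'"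
    if "m \<in> keys f" for m
    using bnd_ge[OF that, of h \<tau>] assms L_split[of "h (\<tau> m)" N N'] by (simp add: T.tm_assoc)
  then show ?thesis
    unfolding numer_def tm_linext_left by (intro linext_cong) auto
qed

definition phi where "phi f = T.cls (num (bnd h \<tau> f) f) (L 0 (bnd h \<tau> f))"

lemma phi_eq:
  assumes "bnd h \<tau> f \<le> N"
  shows "phi f = T.cls (num N f) (L 0 N)"
proof -
  let ?b = "bnd h \<tau> f"
  have "num N f = num ?b f \<odot> L ?b N" "L 0 N = L 0 ?b \<odot> L ?b N"
    using num_expand[of f ?b N] L_split[of 0 ?b N] assms bnd_nonneg by auto
  then show ?thesis
    unfolding phi_def using T.ore_class_expand[of "num ?b f" "L 0 ?b" "L ?b N"] L_nonzero by simp
qed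

text \<open>\<open>u\<close> is \<open>num N' g\<close> without the factors of index at least
  \<open>h (\<tau> n)\<close> and below \<open>N + h (\<tau> n)\<close>, which are those that
  \<open>L 0 N\<close> turns into when moved past \<open>X^(\<tau> n)\<close>. Thus
  \<open>L 0 N \<odot> u = num N' g\<close>, and \<open>u\<close> is the Ore multiplier that
  computes the product of \<open>phi f\<close> and \<open>phi g\<close>.\<close>

lemma num_mult:
  assumes "bnd h \<tau> f \<le> N" "\<And>n. n \<in> keys g \<Longrightarrow> N + h (\<tau> n) \<le> N'"
  defines "u \<equiv> linext (\<lambda>n. xpow (\<tau> n) \<odot> L (N + h (\<tau> n)) N') g"
  shows "num N f \<odot> u = num N' (tm \<chi>' f g)"
proof -
  have *: "xpow (\<tau> m) \<odot> L (h (\<tau> m)) N \<odot> (xpow (\<tau> n) \<odot> L (N + h (\<tau> n)) N')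
      = cst (\<chi>' m n) * (xpow (\<tau> (m + n)) \<odot> L (h (\<tau> (m + n))) N')"
    if "m \<in> keys f" "n \<in> keys g" for m n
  proof -
    have "h (\<tau> m) \<le> N"
      using bnd_ge[OF that(1), of h \<tau>] assms(1) by simp
    then have s: "L (h (\<tau> m) + h (\<tau> n)) (N + h (\<tau> n)) \<odot> L (N + h (\<tau> n)) N' = L (h (\<tau> m) + h (\<tau> n)) N'"
      using L_split[of "h (\<tau> m) + h (\<tau> n)" "N + h (\<tau> n)" N'] assms(2)[OF that(2)] by simp
    have "xpow (\<tau> m) \<odot> L (h (\<tau> m)) N \<odot> (xpow (\<tau> n) \<odot> L (N + h (\<tau> n)) N')
        = xpow (\<tau> m) \<odot> (L (h (\<tau> m)) N \<odot> xpow (\<tau> n)) \<odot> L (N + h (\<tau> n)) N'"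
      by (simp add: T.tm_assoc)
    also have "\<dots> = xpow (\<tau> m) \<odot> xpow (\<tau> n) \<odot> L (h (\<tau> m) + h (\<tau> n)) N'"
      by (simp only: L_mono T.tm_assoc s)
    also have "xpow (\<tau> m) \<odot> xpow (\<tau> n) = cst (\<chi>' m n) * xpow (\<tau> (m + n))"
      by (simp add: tm_single_single tau_add chi_tau cst_mult_single)
    finally show ?thesis
      by (simp add: tm_cst_left tau_add h_add)
  qed
  have "num N f \<odot> u = linext (\<lambda>m. xpow (\<tau> m) \<odot> L (h (\<tau> m)) N \<odot> u) f"
    by (simp only: numer_def tm_linext_left)
  also have "\<dots> = linext (\<lambda>m. linext (\<lambda>n.
      xpow (\<tau> m) \<odot> L (h (\<tau> m)) N \<odot> (xpow (\<tau> n) \<odot> L (N + h (\<tau> n)) N')) g) f"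
    by (simp only: u_def tm_linext_right)
  also have "\<dots> = linext (\<lambda>m. linext (\<lambda>n. cst (\<chi>' m n) * (xpow (\<tau> (m + n)) \<odot> L (h (\<tau> (m + n))) N')) g) f"
    by (intro linext_cong *)
  also have "\<dots> = num N' (tm \<chi>' f g)"
    unfolding tm_def numer_def linext_linext by simp
  finally show ?thesis .
qed

lemma phi_hom: "phi \<in> ring_hom (torus \<chi>') T.F"
proof (rule ring_hom_memI)
  fix f g
  show "phi f \<in> carrier T.F"
    unfolding phi_def using L_nonzero by (intro T.ore_class_closed) auto
  show "phi (f \<oplus>\<^bsub>torus \<chi>'\<^esub> g) = phi f \<oplus>\<^bsub>T.F\<^esub> phi g"
  proof -
    define N where "N = max (bnd h \<tau> (f + g)) (max (bnd h \<tau> f) (bnd h \<tau> g))"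
    have "phi (f + g) = T.cls (num N f + num N g) (L 0 N)"
      "phi f = T.cls (num N f) (L 0 N)" "phi g = T.cls (num N g) (L 0 N)"
      using phi_eq[of "f + g" N] phi_eq[of f N] phi_eq[of g N] by (auto simp: N_def num_add)
    then show ?thesis
      using T.F_add[of "num N f" "num N g" "L 0 N"] L_nonzero by simp
  qed
  show "phi (f \<otimes>\<^bsub>torus \<chi>'\<^esub> g) = phi f \<otimes>\<^bsub>T.F\<^esub> phi g"
  proof -
    define N where "N = bnd h \<tau> f"
    \<comment> \<open>\<open>N'\<close> has to be at least \<open>N + h (\<tau> n)\<close> for
      \<open>num_mult\<close>, and an admissible cut-off for \<open>g\<close> and for the
      product.\<close>
    define N' where "N' = max (N + bnd h \<tau> g) (max (bnd h \<tau> g) (bnd h \<tau> (tm \<chi>' f g)))"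
    define u where "u = linext (\<lambda>n. xpow (\<tau> n) \<odot> L (N + h (\<tau> n)) N') g"
    have N': "N + h (\<tau> n) \<le> N'" if "n \<in> keys g" for n
      using bnd_ge[OF that, of h \<tau>] unfolding N'_def by simp
    have 1: "num N f \<odot> u = num N' (tm \<chi>' f g)"
      unfolding u_def by (rule num_mult) (use N' N_def in auto)
    have "L 0 N \<odot> (xpow (\<tau> n) \<odot> L (N + h (\<tau> n)) N') = xpow (\<tau> n) \<odot> L (h (\<tau> n)) N'"
      if "n \<in> keys g" for n
    proof -
      have "L (h (\<tau> n)) (N + h (\<tau> n)) \<odot> L (N + h (\<tau> n)) N' = L (h (\<tau> n)) N'"
        using L_split[of "h (\<tau> n)" "N + h (\<tau> n)" N'] N'[OF that] bnd_nonneg[of h \<tau> f] N_def by simp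
      then show ?thesis
        using L_mono[of 0 N "\<tau> n"] by (simp add: T.tm_assoc flip: T.tm_assoc[of "L 0 N"])
    qed
    then have 2: "L 0 N \<odot> u = num N' g"
      unfolding u_def numer_def tm_linext_right by (intro linext_cong) auto
    have "phi f \<otimes>\<^bsub>T.F\<^esub> phi g = T.cls (num N f) (L 0 N) \<otimes>\<^bsub>T.F\<^esub> T.cls (num N' g) (L 0 N')"
      using phi_eq[of f N] phi_eq[of g N'] by (simp add: N_def N'_def)
    also have "\<dots> = T.cls (num N f \<odot> u) (L 0 N' \<odot> 1)"
      using T.F_mult[of "num N f" "num N' g" "L 0 N" "L 0 N'" u 1] 2 L_nonzero by simp
    also have "\<dots> = phi (tm \<chi>' f g)"
      using phi_eq[of "tm \<chi>' f g" N'] 1 by (simp add: N'_def)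
    finally show ?thesis
      by simp
  qed
next
  have "phi 1 = T.cls (L 0 (bnd h \<tau> (1 :: ('j, 'k) laurent))) (L 0 (bnd h \<tau> (1 :: ('j, 'k) laurent)))"
    unfolding phi_def using num_single[of _ 0 1] by (simp add: tau_0 h_0)
  then show "phi \<one>\<^bsub>torus \<chi>'\<^esub> = \<one>\<^bsub>T.F\<^esub>"
    using T.F_one L_nonzero by simp
qed

lemma phi_cst: "phi (cst c) = T.emb (cst c)"
proof -
  let ?N = "bnd h \<tau> (cst c :: ('j, 'k) laurent)"
  have "num ?N (cst c) = cst c \<odot> L 0 ?N"
    by (simp add: num_single tau_0 h_0)
  then show ?thesis
    unfolding phi_def using T.embed_eq_class_iff[of "cst c" "num ?N (cst c)" "L 0 ?N"] L_nonzero by simp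
qed

text \<open>Here the cut-off 0 is admissible and makes the denominator an empty product, so the
  image is a Laurent polynomial.\<close>

lemma phi_mono_nonpos:
  assumes "h (\<tau> m) \<le> 0"
  shows "phi (xpow m) = T.emb (xpow (\<tau> m) \<odot> L (h (\<tau> m)) 0)"
proof -
  have "bnd h \<tau> (xpow m) \<le> 0"
    using assms by (simp add: bnd_def)
  from phi_eq[OF this] show ?thesis
    by (simp add: num_single ore_embed_def)
qed

lemma chi_multiple: "\<chi> m (\<lambda>i. int r * e i) = \<kappa> (- int r * h m)"
proof (induction r)
  case 0
  have "(\<lambda>i. int 0 * e i) = 0"
    by (simp add: zero_fun_def)
  then show ?case
    by simp
next
  case (Suc r)
  have "(\<lambda>i. int (Suc r) * e i) = e + (\<lambda>i. int r * e i)"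
    by (auto simp: fun_eq_iff lattice_apply algebra_simps)
  then have "\<chi> m (\<lambda>i. int (Suc r) * e i) = \<kappa> (- h m + - int r * h m)"
    by (simp only: T.chi_add_right chi_e Suc kappa_add)
  then show ?case
    by (simp add: algebra_simps)
qed

lemma chi_e_multiple: "\<chi> e (\<lambda>i. int r * e i) = 1"
proof (induction r)
  case 0
  have "(\<lambda>i. int 0 * e i) = 0"
    by (simp add: zero_fun_def)
  then show ?case
    by simp
next
  case (Suc r)
  have "(\<lambda>i. int (Suc r) * e i) = e + (\<lambda>i. int r * e i)"
    by (auto simp: fun_eq_iff lattice_apply algebra_simps)
  then show ?case
    by (simp only: T.chi_add_right T.chi_alt Suc mult_1)
qed

text \<open>The quantum binomial theorem for the factors with index from \<open>- n\<close> to
  \<open>- 1\<close>. Splitting off the index \<open>- n - 1\<close> in the induction step produces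
  the symmetric Pascal rule, up to the normalising power \<open>q^(- n r)\<close>.\<close>

lemma L_gbinom:
  "L (- int n) 0 = (\<Sum>r\<le>n. single (\<lambda>i. int r * e i) (\<kappa> (- int n * int r) * gbinom \<kappa> n r))"
proof (induction n)
  case 0
  have "(\<lambda>i. int 0 * e i) = 0"
    by (simp add: zero_fun_def)
  then show ?case
    by simp
next
  case (Suc n)
  let ?s = "\<lambda>r. single (\<lambda>i. int r * e i)"
  let ?c = "\<lambda>n r. \<kappa> (- int n * int r) * gbinom \<kappa> n r"
  have z: "(\<lambda>i. int 0 * e i) = 0" "(\<lambda>i. 0 * e i) = 0"
    by (simp_all add: zero_fun_def)
  have "nat (0 - - int (Suc n)) = Suc n" "nat (0 - - int n) = n" "- int (Suc n) + 1 = - int n"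
    by auto
  then have "L (- int (Suc n)) 0 = lfac \<kappa> e (- int (Suc n)) \<odot> L (- int n) 0"
    by (simp add: Lprod_def)
  also have "\<dots> = L (- int n) 0 + single e (\<kappa> (- 2 * int n - 1)) \<odot> L (- int n) 0"
  proof -
    have "2 * - int (Suc n) + 1 = - 2 * int n - 1"
      by simp
    then show ?thesis
      by (simp only: lfac_def tm_add_left T.tm_one)
  qed
  also have "single e (\<kappa> (- 2 * int n - 1)) \<odot> L (- int n) 0
      = (\<Sum>r\<le>n. ?s (Suc r) (\<kappa> (- 2 * int n - 1) * ?c n r))"
  proof -
    have sum: "f \<odot> sum g A = (\<Sum>r\<in>A. f \<odot> g r)" if "finite A" for f g and A :: "nat set"
      using that by induction (auto simp: tm_add_right)
    have "e + (\<lambda>i. int r * e i) = (\<lambda>i. int (Suc r) * e i)" for r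
      by (auto simp: fun_eq_iff lattice_apply algebra_simps)
    then show ?thesis
      unfolding Suc by (simp only: sum[OF finite_atMost] tm_single_single chi_e_multiple mult_1)
  qed
  also have "L (- int n) 0 = ?s 0 1 + (\<Sum>r\<le>n. ?s (Suc r) (?c n (Suc r)))"
  proof -
    \<comment> \<open>The term \<open>r = n + 1\<close> vanishes; with it the index can be shifted
      so that both sums run over \<open>Suc r\<close>.\<close>
    have "(\<Sum>r\<le>n. ?s r (?c n r)) = (\<Sum>r\<le>Suc n. ?s r (?c n r))"
      by (simp add: gbinom_eq_0)
    then show ?thesis
      unfolding Suc by (simp add: sum.atMost_Suc_shift z del: sum.atMost_Suc)
  qed
  also have "?s 0 1 + (\<Sum>r\<le>n. ?s (Suc r) (?c n (Suc r))) + (\<Sum>r\<le>n. ?s (Suc r) (\<kappa> (- 2 * int n - 1) * ?c n r))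
      = ?s 0 1 + (\<Sum>r\<le>n. ?s (Suc r) (?c (Suc n) (Suc r)))"
  proof -
    have "?c n (Suc r) + \<kappa> (- 2 * int n - 1) * ?c n r = ?c (Suc n) (Suc r)" for r
    proof -
      have "- int n * int (Suc r) = - int (Suc n) * int (Suc r) + (int r + 1)"
        "- 2 * int n - 1 + - int n * int r = - int (Suc n) * int (Suc r) + (int r - int n)"
        by (simp_all add: algebra_simps)
      then have eqs: "\<kappa> (- int n * int (Suc r)) = \<kappa> (- int (Suc n) * int (Suc r)) * \<kappa> (int r + 1)"
        "\<kappa> (- 2 * int n - 1) * \<kappa> (- int n * int r) = \<kappa> (- int (Suc n) * int (Suc r)) * \<kappa> (int r - int n)"
        unfolding kappa_add[symmetric] by (simp_all only:)
      show ?thesis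
        by (simp only: gbinom.simps distrib_left mult.assoc[symmetric] eqs)
    qed
    then show ?thesis
      by (simp add: add.assoc flip: sum.distrib single_add)
  qed
  also have "\<dots> = (\<Sum>r\<le>Suc n. ?s r (?c (Suc n) r))"
    by (simp add: sum.atMost_Suc_shift del: sum.atMost_Suc)
  finally show ?case .
qed

text \<open>The twist \<open>q^(n r)\<close> between \<open>X^m\<close> and \<open>X^(r e)\<close>
  cancels the normalising power in \<open>L_gbinom\<close>. What remains are the plain binomials and
  the commutative product of the mutation formula.\<close>

lemma mono_L_gbinom:
  assumes "h m = - int n"
  shows "xpow m \<odot> L (h m) 0 = (\<Sum>r\<le>n. single (\<lambda>i. m i + int r * e i) (gbinom \<kappa> n r))"
proof -
  have sum: "f \<odot> sum g A = (\<Sum>r\<in>A. f \<odot> g r)" if "finite A" for f g and A :: "nat set"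
    using that by induction (auto simp: tm_add_right)
  have "\<chi> m (\<lambda>i. int r * e i) * \<kappa> (- int n * int r) = 1" for r
    unfolding chi_multiple kappa_add[symmetric] assms by (simp add: algebra_simps)
  then have "\<chi> m (\<lambda>i. int r * e i) * 1 * (\<kappa> (- int n * int r) * gbinom \<kappa> n r) = gbinom \<kappa> n r" for r
    by (simp flip: mult.assoc)
  moreover have "m + (\<lambda>i. int r * e i) = (\<lambda>i. m i + int r * e i)" for r
    by (auto simp: fun_eq_iff lattice_apply)
  ultimately show ?thesis
    unfolding assms L_gbinom by (simp only: sum[OF finite_atMost] tm_single_single)
qed

lemma phi_mono_gbinom:
  assumes "h (\<tau> m) \<le> 0"
  shows "phi (xpow m) =
    T.emb (\<Sum>r\<le>nat (- h (\<tau> m)). single (\<lambda>i. \<tau> m i + int r * e i) (gbinom \<kappa> (nat (- h (\<tau> m))) r))"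
  using phi_mono_nonpos[OF assms] mono_L_gbinom[of "\<tau> m" "nat (- h (\<tau> m))"] assms by simp

text \<open>Reduces positive \<open>h\<close> to negative \<open>h\<close>, matching the inverse of
  a polynomial in the definition of X-mutation.\<close>

lemma phi_mono_inverse: "phi (xpow m) = inv\<^bsub>T.F\<^esub> (phi (xpow (- m)))"
proof -
  interpret F: ring T.F
    by (rule T.F_ring)
  have closed: "phi f \<in> carrier T.F" for f
    using ring_hom_closed[OF phi_hom, of f] by simp
  have "tm \<chi>' (xpow m) (xpow (- m)) = 1" "tm \<chi>' (xpow (- m)) (xpow m) = 1"
    using T'.chi_minus[of m] T'.chi_minus[of "- m"] by (simp_all add: tm_single_single)
  then show ?thesis
    using ring_hom_mult[OF phi_hom, of "xpow m" "xpow (- m)"] ring_hom_mult[OF phi_hom, of "xpow (- m)" "xpow m"]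
      ring_hom_one[OF phi_hom] closed by (intro F.inv_unique') auto
qed

text \<open>\<open>\<Phi>\<close>, the extension of \<open>phi\<close> to fractions, shows that the
  choice \<open>SOME\<close> is not void, and \<open>frac_hom_unique\<close> that it agrees with
  \<open>\<Phi>\<close>. In \<open>phi a\<close> times the inverse of \<open>phi b\<close> the
  common denominator \<open>L 0 N\<close> cancels.\<close>

lemma mutation_hom:
  assumes img: "\<And>i. img i = phi (xpow (evec i))"
  defines "M \<equiv> SOME \<psi>. \<psi> \<in> ring_hom T'.F T.F \<and> (\<forall>c. \<psi> (T'.emb (cst c)) = T.emb (cst c)) \<and>
      (\<forall>i. \<psi> (T'.emb (xpow (evec i))) = img i)"
  shows "M \<in> ring_hom T'.F T.F" "M (T'.emb (cst c)) = T.emb (cst c)"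
    "b \<noteq> 0 \<Longrightarrow> bnd h \<tau> a \<le> N \<Longrightarrow> bnd h \<tau> b \<le> N \<Longrightarrow> M (T'.cls a b) = T.cls (num N a) (num N b)"
proof -
  have phi0: "phi b \<noteq> \<zero>\<^bsub>T.F\<^esub>" if "b \<noteq> 0" for b
    using that T.F_eq_zero_iff[of "num (bnd h \<tau> b) b" "L 0 (bnd h \<tau> b)"] num_nonzero L_nonzero
    by (simp add: phi_def)
  obtain \<Phi> where Phi: "\<Phi> \<in> ring_hom T'.F T.F"
    and val: "\<And>a b. b \<noteq> 0 \<Longrightarrow> \<Phi> (T'.cls a b) = phi a \<otimes>\<^bsub>T.F\<^esub> inv\<^bsub>T.F\<^esub> (phi b)"
    using T'.extend_hom[OF T.F_division_ring phi_hom] phi0 by auto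
  have "inv\<^bsub>T.F\<^esub> \<one>\<^bsub>T.F\<^esub> = \<one>\<^bsub>T.F\<^esub>"
    using T.F_ring ring.is_monoid monoid.inv_one by blast
  then have emb: "\<Phi> (T'.emb f) = phi f" for f
    using val[of 1 f] ring_hom_one[OF phi_hom] ring_hom_closed[OF phi_hom, of f] T.F_r_one[of "phi f"]
    by (simp add: ore_embed_def)
  have spec: "\<Phi> \<in> ring_hom T'.F T.F \<and> (\<forall>c. \<Phi> (T'.emb (cst c)) = T.emb (cst c)) \<and>
      (\<forall>i. \<Phi> (T'.emb (xpow (evec i))) = img i)"
    using Phi emb phi_cst img by simp
  define Q where "Q \<psi> \<longleftrightarrow> \<psi> \<in> ring_hom T'.F T.F \<and> (\<forall>c. \<psi> (T'.emb (cst c)) = T.emb (cst c)) \<and>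
      (\<forall>i. \<psi> (T'.emb (xpow (evec i))) = img i)" for \<psi>
  have "Q \<Phi>" "M = (SOME \<psi>. Q \<psi>)"
    using spec unfolding Q_def M_def by auto
  then have "Q M"
    by (simp add: someI)
  then have M: "M \<in> ring_hom T'.F T.F \<and> (\<forall>c. M (T'.emb (cst c)) = T.emb (cst c)) \<and>
      (\<forall>i. M (T'.emb (xpow (evec i))) = img i)"
    unfolding Q_def .
  then show "M \<in> ring_hom T'.F T.F" "M (T'.emb (cst c)) = T.emb (cst c)"
    by auto
  assume b: "b \<noteq> 0" and N: "bnd h \<tau> a \<le> N" "bnd h \<tau> b \<le> N"
  have "M (T'.cls a b) = \<Phi> (T'.cls a b)"
    by (rule T'.frac_hom_unique[OF T.F_division_ring]) (use M spec b in auto)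
  also have "\<dots> = T.cls (num N a) (L 0 N) \<otimes>\<^bsub>T.F\<^esub> T.cls (L 0 N) (num N b)"
    using val[OF b] phi_eq[OF N(1)] phi_eq[OF N(2)] T.F_inv[of "num N b" "L 0 N"] num_nonzero[OF b] L_nonzero
    by simp
  also have "\<dots> = T.cls (num N a) (num N b)"
    using T.F_mult[of "num N a" "L 0 N" "L 0 N" "num N b" 1 1] num_nonzero[OF b] L_nonzero by simp
  finally show "M (T'.cls a b) = T.cls (num N a) (num N b)" .
qed

end

section \<open>The base ring\<close>

text \<open>\<open>\<Lambda>\<close> is a group of exponents on which \<open>v\<close> turns sums
  into products. It will be all rationals in the classical case and \<open>1/D\<close> times the
  integers in the quantum case, so that one development serves both.\<close>

locale base =
  fixes v :: "rat \<Rightarrow> 'k::comm_ring_1" and \<Lambda> :: "rat set"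
  assumes nzd: "\<And>x y :: 'k. x * y = 0 \<Longrightarrow> x = 0 \<or> y = 0"
    and v_0 [simp]: "v 0 = 1"
    and v_add: "a \<in> \<Lambda> \<Longrightarrow> b \<in> \<Lambda> \<Longrightarrow> v (a + b) = v a * v b"
    and Lam_0 [simp]: "0 \<in> \<Lambda>"
    and Lam_add: "a \<in> \<Lambda> \<Longrightarrow> b \<in> \<Lambda> \<Longrightarrow> a + b \<in> \<Lambda>"
    and Lam_minus: "a \<in> \<Lambda> \<Longrightarrow> - a \<in> \<Lambda>"
    and qint_nonzero: "x \<in> \<Lambda> \<Longrightarrow> n > 0 \<Longrightarrow> qint v x n \<noteq> 0"
begin

lemma Lam_sum: "(\<And>i. i \<in> A \<Longrightarrow> f i \<in> \<Lambda>) \<Longrightarrow> sum f A \<in> \<Lambda>"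
  by (induction A rule: infinite_finite_induct) (auto intro: Lam_add)

lemma Lam_nat_mult: "a \<in> \<Lambda> \<Longrightarrow> of_nat n * a \<in> \<Lambda>"
  by (induction n) (auto simp: distrib_right intro: Lam_add)

lemma Lam_int_mult: "a \<in> \<Lambda> \<Longrightarrow> of_int c * a \<in> \<Lambda>"
  by (cases c rule: int_cases2) (auto intro: Lam_nat_mult Lam_minus)

lemma q_powers:
  assumes "x \<in> \<Lambda>"
  shows "q_powers v x (\<lambda>j. v (x * of_int j))"
proof
  fix i j
  show "v (x * of_int (i + j)) = v (x * of_int i) * v (x * of_int j)"
    using v_add[of "x * of_int i" "x * of_int j"] Lam_int_mult[OF assms]
    by (simp add: distrib_left mult.commute)
qed (use assms qint_nonzero nzd in auto)

end

lemma classical_base_base: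
  assumes "classical_base (v :: rat \<Rightarrow> 'k::comm_ring_1)"
  shows "base v UNIV"
proof
  have v: "v = (\<lambda>_. 1)" and bij: "bij (of_int :: int \<Rightarrow> 'k)"
    using assms by (auto simp: classical_base_def)
  have inj: "of_int a = (of_int b :: 'k) \<longleftrightarrow> a = b" for a b
    using bij by (simp add: bij_def inj_eq)
  show "x = 0 \<or> y = 0" if xy: "x * y = 0" for x y :: 'k
  proof -
    obtain a b where ab: "x = of_int a" "y = of_int b"
      using bij by (metis bij_pointE)
    then have "a * b = 0"
      using xy inj[of "a * b" 0] by simp
    then show ?thesis
      using ab by auto
  qed
  show "qint v x a \<noteq> 0" if "a > 0" for x a
    using that inj[of "int a" 0] by (simp add: qint_def v)
qed (use assms in \<open>auto simp: classical_base_def\<close>)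

lemma quantum_base_base:
  assumes "quantum_base D (v :: rat \<Rightarrow> 'k::comm_ring_1)"
  shows "base v {a. of_int D * a \<in> \<int>}"
proof -
  from assms obtain \<phi> :: "(int \<Rightarrow>\<^sub>0 int) \<Rightarrow> 'k" where D: "D > 0" and bij: "bij \<phi>" and one: "\<phi> 1 = 1"
    and add: "\<And>x y. \<phi> (x + y) = \<phi> x + \<phi> y" and mult: "\<And>x y. \<phi> (x * y) = \<phi> x * \<phi> y"
    and v: "\<And>a. v (of_int a / of_int D) = \<phi> (single a 1)"
    unfolding quantum_base_def by blast
  have zero: "\<phi> 0 = 0"
    using add[of 0 0] by simp
  have inj: "\<phi> x = \<phi> y \<longleftrightarrow> x = y" for x y
    using bij by (simp add: bij_def inj_eq)
  have v': "v a = \<phi> (single i 1)" if "of_int D * a = of_int i" for a i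
  proof -
    have "a = of_int i / of_int D"
      using that D by (simp add: field_simps)
    then show ?thesis
      using v by simp
  qed
  show ?thesis
  proof
    show "x = 0 \<or> y = 0" if xy: "x * y = 0" for x y :: 'k
    proof -
      obtain a b where ab: "x = \<phi> a" "y = \<phi> b"
        using bij by (metis bij_pointE)
      then have "\<phi> (a * b) = \<phi> 0"
        using xy zero mult by simp
      then have "a = 0 \<or> b = 0"
        by (simp add: inj)
      then show ?thesis
        using ab zero by auto
    qed
    show "v 0 = 1"
      using v[of 0] one by simp
    show "v (a + b) = v a * v b" if ab: "a \<in> {a. of_int D * a \<in> \<int>}" "b \<in> {a. of_int D * a \<in> \<int>}" for a b
    proof -
      obtain i j where ij: "of_int D * a = of_int i" "of_int D * b = of_int j"
        using ab by (auto elim!: Ints_cases)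
      then have "of_int D * (a + b) = of_int (i + j)"
        by (simp add: distrib_left)
      from v'[OF this] v'[OF ij(1)] v'[OF ij(2)] show ?thesis
        unfolding \<open>v a = _\<close> \<open>v b = _\<close> mult[symmetric] by (simp add: mult_single)
    qed
    show "qint v x a \<noteq> 0" if x: "x \<in> {a. of_int D * a \<in> \<int>}" and a: "a > 0" for x a
    proof -
      obtain c where c: "of_int D * x = of_int c"
        using x by (auto elim!: Ints_cases)
      define k where "k i = c * (int a - 1 - 2 * int i)" for i
      have vk: "v (x * (of_nat a - 1 - 2 * of_nat i)) = \<phi> (single (k i) 1)" for i
        by (rule v') (simp add: k_def flip: c)
      have phi_sum: "\<phi> (sum f A) = (\<Sum>i\<in>A. \<phi> (f i))" for f and A :: "nat set"
        by (induction A rule: infinite_finite_induct) (auto simp: zero add)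
      \<comment> \<open>The coefficients of \<open>?S\<close> count indices, so nothing cancels; the
        one at \<open>k 0\<close> counts at least \<open>i = 0\<close>.\<close>
      let ?S = "\<Sum>i<a. single (k i) (1 :: int)"
      have "lookup ?S (k 0) = (\<Sum>i<a. if k 0 = k i then 1 else 0)"
        by (simp add: lookup_sum lookup_single when_def)
      also have "\<dots> > 0"
        using a by (intro sum_pos2[of _ 0]) auto
      finally have "?S \<noteq> 0"
        by auto
      then show ?thesis
        using inj[of ?S 0] zero by (simp add: qint_def vk phi_sum)
    qed
  qed (auto simp: distrib_left)
qed


section \<open>Bilinear forms attached to a seed\<close>

text \<open>The evaluation pairing of \<open>M\<degree>\<close> with \<open>N\<close>: the basis
  vector \<open>f_i\<close> is the dual vector of \<open>e_i\<close> divided by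
  \<open>d_i\<close>.\<close>

definition pair :: "('j \<Rightarrow> int) \<Rightarrow> ('j::finite) lattice \<Rightarrow> 'j lattice \<Rightarrow> rat" where
  "pair d m n = (\<Sum>i\<in>UNIV. of_int (m i) * of_int (n i) / of_int (d i))"

lemma pair_add:
  "pair d (m + m') n = pair d m n + pair d m' n" "pair d m (n + n') = pair d m n + pair d m n'"
  by (simp_all add: pair_def lattice_apply sum.distrib[symmetric] add_divide_distrib algebra_simps)

lemma pair_evec: "pair d m (evec k) = of_int (m k) / of_int (d k)"
  by (simp add: pair_def evec_def if_distrib[of of_int] if_distrib[of "(*) _"] if_distrib[of "\<lambda>x. x / _"] cong: if_cong)

lemma pstar_add: "pstar s (m + n) = pstar s m + pstar s n"
  by (auto simp: pstar_def fun_eq_iff lattice_apply sum.distrib distrib_left)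

lemma pstar_evec: "pstar s (evec k) = (\<lambda>i. Bmat s i k)"
  by (auto simp: pstar_def evec_def fun_eq_iff if_distrib[of "(*) _"] cong: if_cong)

lemma omega_pair: "omega s n n' = pair (dvec s) (pstar s n) n'"
proof -
  have "omega s n n' = (\<Sum>j\<in>UNIV. \<Sum>i\<in>UNIV. of_int (n i) * of_int (n' j) * (of_int (Bmat s j i) / of_int (dvec s j)))"
    unfolding omega_def by (rule sum.swap)
  also have "\<dots> = (\<Sum>j\<in>UNIV. (\<Sum>i\<in>UNIV. of_int (Bmat s j i) * of_int (n i)) * of_int (n' j) / of_int (dvec s j))"
    by (simp add: sum_distrib_left sum_distrib_right sum_divide_distrib mult_ac)
  finally show ?thesis
    by (simp add: pair_def pstar_def)
qed

lemma omega_add: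
  "omega s (m + m') n = omega s m n + omega s m' n" "omega s m (n + n') = omega s m n + omega s m n'"
  by (simp_all add: omega_pair pstar_add pair_add)

lemma form_add:
  "form lam (m + m') n = form lam m n + form lam m' n" "form lam m (n + n') = form lam m n + form lam m n'"
  by (simp_all add: form_def lattice_apply sum.distrib[symmetric] algebra_simps)

lemma form_skew:
  assumes "\<And>i j. lam i j = - lam j i"
  shows "form lam m n = - form lam n m"
proof -
  have "form lam m n = (\<Sum>j\<in>UNIV. \<Sum>i\<in>UNIV. of_int (m i) * of_int (n j) * lam i j)"
    unfolding form_def by (rule sum.swap)
  also have "\<dots> = (\<Sum>j\<in>UNIV. \<Sum>i\<in>UNIV. - (of_int (n j) * of_int (m i) * lam j i))"
    by (intro sum.cong refl, subst assms) simp
  finally show ?thesis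
    by (simp add: form_def sum_negf)
qed

lemma form_combination_left:
  "form lam (\<lambda>a. \<Sum>i\<in>UNIV. m i * f i a) n = (\<Sum>i\<in>UNIV. of_int (m i) * form lam (f i) n)"
proof -
  have "form lam (\<lambda>a. \<Sum>i\<in>UNIV. m i * f i a) n =
      (\<Sum>a\<in>UNIV. \<Sum>i\<in>UNIV. of_int (m i) * (\<Sum>b\<in>UNIV. of_int (f i a) * of_int (n b) * lam a b))"
    unfolding form_def
    by (intro sum.cong refl) (simp add: sum_distrib_left sum_distrib_right mult_ac, rule sum.swap)
  also have "\<dots> = (\<Sum>i\<in>UNIV. \<Sum>a\<in>UNIV. of_int (m i) * (\<Sum>b\<in>UNIV. of_int (f i a) * of_int (n b) * lam a b))"
    by (rule sum.swap)
  finally show ?thesis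
    by (simp add: form_def sum_distrib_left)
qed

lemma form_combination_right:
  "form lam n (\<lambda>a. \<Sum>i\<in>UNIV. m i * f i a) = (\<Sum>i\<in>UNIV. of_int (m i) * form lam n (f i))"
proof -
  have "form lam n (\<lambda>a. \<Sum>i\<in>UNIV. m i * f i a) =
      (\<Sum>b\<in>UNIV. \<Sum>i\<in>UNIV. of_int (m i) * (of_int (n b) * (\<Sum>a\<in>UNIV. of_int (f i a) * lam b a)))"
    unfolding form_def
    by (intro sum.cong refl) (simp add: sum_distrib_left sum_distrib_right mult_ac, rule sum.swap)
  also have "\<dots> = (\<Sum>i\<in>UNIV. \<Sum>b\<in>UNIV. of_int (m i) * (of_int (n b) * (\<Sum>a\<in>UNIV. of_int (f i a) * lam b a)))"
    by (rule sum.swap)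
  finally show ?thesis
    by (simp add: form_def sum_distrib_left mult_ac)
qed

lemma valid_seed_skew:
  "valid_seed s \<Longrightarrow> (of_int (Bmat s i j) / of_int (dvec s i) :: rat) = - (of_int (Bmat s j i) / of_int (dvec s j))"
  unfolding valid_seed_def by blast

lemma dvec_pos: "valid_seed s \<Longrightarrow> dvec s i > 0"
  unfolding valid_seed_def by blast

lemma Bmat_diag:
  assumes "valid_seed s"
  shows "Bmat s k k = 0"
proof -
  have "(of_int (Bmat s k k) / of_int (dvec s k) :: rat) = 0"
    using valid_seed_skew[OF assms, of k k] by linarith
  then show ?thesis
    using dvec_pos[OF assms, of k] by simp
qed

lemma omega_skew:
  assumes "valid_seed s"
  shows "omega s m n = - omega s n m"
proof -
  have "omega s m n = form (\<lambda>i j. of_int (Bmat s j i) / of_int (dvec s j)) m n" for m n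
    by (simp add: omega_def form_def)
  moreover have "form (\<lambda>i j. of_int (Bmat s j i) / of_int (dvec s j)) m n =
      - form (\<lambda>i j. of_int (Bmat s j i) / of_int (dvec s j)) n m"
    by (rule form_skew) (rule valid_seed_skew[OF assms])
  ultimately show ?thesis
    by simp
qed


subsection \<open>Mutation of lattices\<close>

text \<open>The monomial part of X-mutation: \<open>e_k\<close> goes to \<open>- e_k\<close>, and
  any other \<open>e_i\<close> to \<open>e_i + [b_ki]_+ e_k\<close>, the lowest exponent in powers
  of \<open>X_k\<close> of the image of \<open>X_i\<close>.\<close>

definition tauX :: "('j::finite) seed \<Rightarrow> 'j \<Rightarrow> 'j lattice \<Rightarrow> 'j lattice" where
  "tauX s k n = (\<lambda>i. if i = k then - n k + (\<Sum>j\<in>UNIV. pos_part (Bmat s k j) * n j) else n i)"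

definition tauA :: "'j seed \<Rightarrow> 'j \<Rightarrow> 'j lattice \<Rightarrow> 'j lattice" where
  "tauA s k m = (\<lambda>j. if j = k then - m k else m j + m k * pos_part (- Bmat s j k))"

lemma pos_part_0 [simp]: "pos_part 0 = 0"
  by (simp add: pos_part_def)

lemma pos_part_scale: "c > 0 \<Longrightarrow> (of_int (pos_part x) :: rat) / c = max (of_int x / c) 0"
  by (auto simp: pos_part_def max_def divide_le_0_iff)

lemma sum_remove: "(\<Sum>i\<in>UNIV. f i) = f (k :: 'j::finite) + (\<Sum>i\<in>UNIV - {k}. f i)"
  by (rule sum.remove) auto

lemma tauX_tauX:
  assumes "valid_seed s"
  shows "tauX s k (tauX s k n) = n"
proof -
  have "(\<Sum>j\<in>UNIV. pos_part (Bmat s k j) * tauX s k n j) = (\<Sum>j\<in>UNIV. pos_part (Bmat s k j) * n j)"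
    by (intro sum.cong refl) (auto simp: tauX_def Bmat_diag[OF assms])
  then have "tauX s k (tauX s k n) k = n k"
    by (subst tauX_def) (simp add: tauX_def)
  moreover have "tauX s k (tauX s k n) i = n i" if "i \<noteq> k" for i
    using that by (simp add: tauX_def)
  ultimately show ?thesis
    by (metis ext)
qed

lemma tauA_tauA: "tauA s k (tauA s k m) = m"
  by (auto simp: tauA_def fun_eq_iff)

lemma inj_tauX: "valid_seed s \<Longrightarrow> inj (tauX s k)"
  by (metis injI tauX_tauX)

lemma inj_tauA: "inj (tauA s k)"
  by (metis injI tauA_tauA)

lemma tauX_add: "tauX s k (m + n) = tauX s k m + tauX s k n"
  by (auto simp: tauX_def fun_eq_iff lattice_apply sum.distrib distrib_left)

lemma tauA_add: "tauA s k (m + n) = tauA s k m + tauA s k n"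
  by (auto simp: tauA_def fun_eq_iff lattice_apply algebra_simps)

lemma mut_simps [simp]:
  "unfrozen (mut k s) = unfrozen s" "dvec (mut k s) = dvec s"
  "Bmat (mut k s) i j = (if k = i \<or> k = j then - Bmat s i j
     else Bmat s i j + Bmat s i k * pos_part (Bmat s k j) + pos_part (- Bmat s i k) * Bmat s k j)"
  by (simp_all add: mut_def)

lemma tauA_combination:
  fixes s :: "('j::finite) seed"
  assumes "valid_seed s"
  shows "(\<lambda>j. \<Sum>i\<in>UNIV. m i * mut_basis s k i j) = tauA s k m"
proof
  fix j
  have "(\<Sum>i\<in>UNIV. m i * mut_basis s k i j) = m k * mut_basis s k k j + (\<Sum>i\<in>UNIV - {k}. m i * mut_basis s k i j)"
    by (rule sum_remove)
  also have "(\<Sum>i\<in>UNIV - {k}. m i * mut_basis s k i j) = (\<Sum>i\<in>UNIV - {k}. if i = j then m j else 0)"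
    by (intro sum.cong) (auto simp: mut_basis_def evec_def)
  finally show "(\<Sum>i\<in>UNIV. m i * mut_basis s k i j) = tauA s k m j"
    by (auto simp: mut_basis_def tauA_def evec_def Bmat_diag[OF assms] algebra_simps)
qed

lemma pmut_eq: "pmut k (s, lam) = (mut k s, \<lambda>i j. form lam (mut_basis s k i) (mut_basis s k j))"
  by (simp add: pmut_def)

lemma form_pmut:
  assumes "valid_seed s"
  shows "form (snd (pmut k (s, lam))) m n = form lam (tauA s k m) (tauA s k n)"
proof -
  have "form lam (tauA s k m) (tauA s k n) =
    (\<Sum>i\<in>UNIV. of_int (m i) * (\<Sum>j\<in>UNIV. of_int (n j) * form lam (mut_basis s k i) (mut_basis s k j)))"
    by (simp only: tauA_combination[OF assms, symmetric] form_combination_left form_combination_right)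
  also have "\<dots> = form (snd (pmut k (s, lam))) m n"
    by (simp add: pmut_eq form_def[of "\<lambda>i j. form lam (mut_basis s k i) (mut_basis s k j)"]
        sum_distrib_left mult_ac)
  finally show ?thesis
    by simp
qed

text \<open>In a row \<open>i \<noteq> k\<close> the term \<open>[-b_ik]_+ b_kj\<close> of the
  mutated matrix is cancelled by the multiple \<open>[-b_ik]_+\<close> of row \<open>k\<close>,
  whose sign has changed. The terms with \<open>b_ik\<close> that are left collect to
  \<open>b_ik\<close> times the \<open>k\<close>-th coordinate of \<open>tauX s k n\<close>.\<close>

lemma tauA_pstar:
  assumes "valid_seed s"
  shows "tauA s k (pstar (mut k s) n) = pstar s (tauX s k n)"
proof
  note diag = Bmat_diag[OF assms, of k]
  have k: "pstar (mut k s) n k = - (\<Sum>j\<in>UNIV. Bmat s k j * n j)"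
    by (simp add: pstar_def sum_negf)
  fix i
  show "tauA s k (pstar (mut k s) n) i = pstar s (tauX s k n) i"
  proof (cases "i = k")
    case True
    have "pstar s (tauX s k n) k = (\<Sum>j\<in>UNIV. Bmat s k j * n j)"
      unfolding pstar_def by (intro sum.cong refl) (auto simp: tauX_def diag)
    then show ?thesis
      using True k by (simp add: tauA_def)
  next
    case False
    let ?R = "UNIV - {k}"
    have "pstar (mut k s) n i = - Bmat s i k * n k +
        (\<Sum>j\<in>?R. (Bmat s i j + Bmat s i k * pos_part (Bmat s k j) + pos_part (- Bmat s i k) * Bmat s k j) * n j)"
      unfolding pstar_def sum_remove[of _ k] using False by (auto intro!: sum.cong)
    moreover have "pstar (mut k s) n k = - (\<Sum>j\<in>?R. Bmat s k j * n j)"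
      unfolding k sum_remove[of _ k] by (simp add: diag)
    moreover have "pstar s (tauX s k n) i =
        Bmat s i k * (- n k + (\<Sum>j\<in>?R. pos_part (Bmat s k j) * n j)) + (\<Sum>j\<in>?R. Bmat s i j * n j)"
    proof -
      have "(\<Sum>j\<in>?R. Bmat s i j * tauX s k n j) = (\<Sum>j\<in>?R. Bmat s i j * n j)"
        by (intro sum.cong) (auto simp: tauX_def)
      moreover have "tauX s k n k = - n k + (\<Sum>j\<in>?R. pos_part (Bmat s k j) * n j)"
        unfolding tauX_def sum_remove[of _ k] by (simp add: diag)
      ultimately show ?thesis
        unfolding pstar_def sum_remove[of _ k] by simp
    qed
    ultimately show ?thesis
      using False by (simp add: tauA_def algebra_simps sum.distrib sum_distrib_left)
  qed
qed

text \<open>Skew-symmetrizability gives \<open>[-b_ik]_+ / d_i = [b_ki]_+ / d_k\<close>, so the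
  correction to the \<open>k\<close>-th coordinate of \<open>n\<close> cancels against those to the
  other coordinates of \<open>m\<close>.\<close>

lemma pair_tau:
  assumes "valid_seed s"
  shows "pair (dvec s) (tauA s k m) (tauX s k n) = pair (dvec s) m n"
proof -
  let ?R = "UNIV - {k}" and ?d = "dvec s"
  have pos: "(of_int (pos_part (- Bmat s i k)) / of_int (?d i) :: rat) = of_int (pos_part (Bmat s k i)) / of_int (?d k)" for i
    using pos_part_scale[of "of_int (?d i)" "- Bmat s i k"] pos_part_scale[of "of_int (?d k)" "Bmat s k i"]
      dvec_pos[OF assms] valid_seed_skew[OF assms, of i k] by simp
  have 1: "tauX s k n k = - n k + (\<Sum>j\<in>?R. pos_part (Bmat s k j) * n j)"
    unfolding tauX_def sum_remove[of _ k] by (simp add: Bmat_diag[OF assms])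
  have "(\<Sum>i\<in>?R. of_int (tauA s k m i) * of_int (tauX s k n i) / of_int (?d i) :: rat) =
      (\<Sum>i\<in>?R. of_int (m i) * of_int (n i) / of_int (?d i) +
         of_int (m k) * (of_int (pos_part (- Bmat s i k)) / of_int (?d i)) * of_int (n i))"
    by (intro sum.cong refl) (auto simp: tauA_def tauX_def add_divide_distrib algebra_simps)
  also have "\<dots> = (\<Sum>i\<in>?R. of_int (m i) * of_int (n i) / of_int (?d i)) +
      of_int (m k) * (\<Sum>i\<in>?R. of_int (pos_part (Bmat s k i)) * of_int (n i)) / of_int (?d k)"
    unfolding pos by (simp add: sum.distrib sum_distrib_left sum_divide_distrib mult.assoc)
  finally show ?thesis
    unfolding pair_def sum_remove[of _ k] 1
    by (simp add: tauA_def add_divide_distrib diff_divide_distrib algebra_simps)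
qed

lemma valid_seed_mut:
  assumes "valid_seed s"
  shows "valid_seed (mut k s)"
  unfolding valid_seed_def
proof (intro conjI allI)
  fix i j
  note skew = valid_seed_skew[OF assms]
  \<comment> \<open>In terms of the skew-symmetric \<open>\<beta>\<close> the mutated entry is
    \<open>\<beta> i j + d_k (\<beta> i k [\<beta> k j]_+ + [- \<beta> i k]_+ \<beta> k j)\<close>,
    which changes sign when \<open>i\<close> and \<open>j\<close> are swapped.\<close>
  define \<beta> :: "'a \<Rightarrow> 'a \<Rightarrow> rat" where "\<beta> i j = of_int (Bmat s i j) / of_int (dvec s i)" for i j
  have \<beta>: "\<beta> i j = - \<beta> j i" for i j
    unfolding \<beta>_def by (rule skew)
  show "of_int (Bmat (mut k s) i j) / of_int (dvec (mut k s) i)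
      = - (of_int (Bmat (mut k s) j i) / of_int (dvec (mut k s) j) :: rat)"
  proof (cases "k = i \<or> k = j")
    case True
    then have "Bmat (mut k s) i j = - Bmat s i j" "Bmat (mut k s) j i = - Bmat s j i"
      by auto
    then show ?thesis
      unfolding mut_simps(2) using skew[of i j] by (simp only: of_int_minus divide_minus_left)
  next
    case False
    have d: "of_int (dvec s i) > (0 :: rat)" for i
      using dvec_pos[OF assms] by simp
    have B: "of_int (Bmat s i j) = \<beta> i j * of_int (dvec s i)" for i j
      using d[of i] by (simp add: \<beta>_def)
    have pos: "of_int (pos_part (Bmat s i j)) = max (\<beta> i j) 0 * of_int (dvec s i)"
      "of_int (pos_part (- Bmat s i j)) = max (- \<beta> i j) 0 * of_int (dvec s i)" for i j
      using pos_part_scale[OF d[of i], of "Bmat s i j"] pos_part_scale[OF d[of i], of "- Bmat s i j"] d[of i]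
      by (simp_all add: \<beta>_def field_simps)
    have "of_int (Bmat (mut k s) i j) / of_int (dvec s i) =
        \<beta> i j + of_int (dvec s k) * (\<beta> i k * max (\<beta> k j) 0 + max (- \<beta> i k) 0 * \<beta> k j)" if "k \<noteq> i" "k \<noteq> j" for i j
      using that d[of i] by (simp add: pos B field_simps)
    from this[of i j] this[of j i] show ?thesis
      using False unfolding \<beta>[of j i] \<beta>[of j k] \<beta>[of k i] mut_simps(2)
      by (simp only: minus_minus) (simp add: algebra_simps)
  qed
qed (use dvec_pos[OF assms] in simp)

lemma omega_mut:
  assumes "valid_seed s"
  shows "omega (mut k s) m n = omega s (tauX s k m) (tauX s k n)"
  using pair_tau[OF assms, of k "pstar (mut k s) m" n] tauA_pstar[OF assms, of k m]
  by (simp add: omega_pair)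

definition supp_unfrozen :: "'j seed \<Rightarrow> 'j lattice set" where
  "supp_unfrozen s = {n. \<forall>i. i \<notin> unfrozen s \<longrightarrow> n i = 0}"

lemma supp_unfrozen_closed:
  "0 \<in> supp_unfrozen s" "k \<in> unfrozen s \<Longrightarrow> evec k \<in> supp_unfrozen s"
  "m \<in> supp_unfrozen s \<Longrightarrow> n \<in> supp_unfrozen s \<Longrightarrow> m + n \<in> supp_unfrozen s"
  "k \<in> unfrozen s \<Longrightarrow> n \<in> supp_unfrozen s \<Longrightarrow> tauX s k n \<in> supp_unfrozen s"
  by (auto simp: supp_unfrozen_def lattice_apply evec_def tauX_def)


section \<open>The mutation maps of the X- and the A-side\<close>

context base
begin

definition X_ok :: "'j seed \<Rightarrow> bool" where
  "X_ok s \<longleftrightarrow> valid_seed s \<and> (\<forall>i. 1 / of_int (dvec s i) \<in> \<Lambda>)"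

abbreviation chiX :: "('j::finite) seed \<Rightarrow> 'j lattice \<Rightarrow> 'j lattice \<Rightarrow> 'k" where
  "chiX s m n \<equiv> v (- omega s m n)"

text \<open>For classical base rings \<open>v = 1\<close> and the last condition is void.\<close>

definition A_ok :: "('j::finite) pseed \<Rightarrow> bool" where
  "A_ok sl \<longleftrightarrow> X_ok (fst sl) \<and> (\<forall>i j. snd sl i j = - snd sl j i) \<and> (\<forall>i j. snd sl i j \<in> \<Lambda>) \<and>
    (\<forall>m. \<forall>n\<in>supp_unfrozen (fst sl).
       v (form (snd sl) m (pstar (fst sl) n)) = v (- pair (dvec (fst sl)) m n))"

abbreviation chiA :: "('j::finite) pseed \<Rightarrow> 'j lattice \<Rightarrow> 'j lattice \<Rightarrow> 'k" where
  "chiA sl m n \<equiv> v (form (snd sl) m n)"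

definition kap :: "int \<Rightarrow> int \<Rightarrow> 'k" where
  "kap d j = v (1 / of_int d * of_int j)"

lemma X_ok_mut: "X_ok s \<Longrightarrow> X_ok (mut k s)"
  by (auto simp: X_ok_def valid_seed_mut)

lemma form_Lam:
  assumes "\<And>i j. lam i j \<in> \<Lambda>"
  shows "form lam m n \<in> \<Lambda>"
  unfolding form_def
proof (intro Lam_sum)
  fix i j
  have "of_int (m i * n j) * lam i j \<in> \<Lambda>"
    by (intro Lam_int_mult assms)
  then show "of_int (m i) * of_int (n j) * lam i j \<in> \<Lambda>"
    by simp
qed

lemma omega_Lam:
  assumes "X_ok s"
  shows "omega s m n \<in> \<Lambda>"
proof -
  have "of_int (Bmat s j i) / of_int (dvec s j) \<in> \<Lambda>" for i j
    using Lam_int_mult[of "1 / of_int (dvec s j)" "Bmat s j i"] assms by (simp add: X_ok_def)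
  then show ?thesis
    using form_Lam[of "\<lambda>i j. of_int (Bmat s j i) / of_int (dvec s j)"] by (simp add: form_def omega_def)
qed

lemma qtorus_X:
  assumes "X_ok s"
  shows "qtorus (chiX s)"
proof
  fix m m' n n'
  note om = Lam_minus[OF omega_Lam[OF assms]]
  show "chiX s (m + m') n = chiX s m n * chiX s m' n" "chiX s m (n + n') = chiX s m n * chiX s m n'"
    using v_add[OF om om] by (simp_all add: omega_add)
  show "chiX s m m = 1"
  proof -
    have "omega s m m = - omega s m m"
      using omega_skew assms unfolding X_ok_def by blast
    then have "omega s m m = 0"
      by linarith
    then show ?thesis
      by simp
  qed
qed (use nzd in auto)

lemma qtorus_A:
  assumes "A_ok sl"
  shows "qtorus (chiA sl)"
proof
  fix m m' n n'
  have lam: "form (snd sl) m n \<in> \<Lambda>" for m n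
    using assms unfolding A_ok_def by (intro form_Lam) blast
  show "chiA sl (m + m') n = chiA sl m n * chiA sl m' n" "chiA sl m (n + n') = chiA sl m n * chiA sl m n'"
    using v_add[OF lam lam] by (simp_all add: form_add)
  have "form (snd sl) m m = - form (snd sl) m m"
    using assms unfolding A_ok_def by (intro form_skew) blast
  then have "form (snd sl) m m = 0"
    by linarith
  then show "chiA sl m m = 1"
    by simp
qed (use nzd in auto)

text \<open>Compatibility is transported because \<open>p^*\<close> and the pairing are: apply it to
  \<open>tauX s k n\<close>, which has unfrozen support again since \<open>k\<close> is
  unfrozen.\<close>

lemma A_ok_pmut:
  assumes "A_ok sl" "k \<in> unfrozen (fst sl)"
  shows "A_ok (pmut k sl)"
proof -
  obtain s lam where sl: "sl = (s, lam)"
    by fastforce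
  have s: "X_ok s" "valid_seed s" and lam: "\<And>i j. lam i j = - lam j i" "\<And>i j. lam i j \<in> \<Lambda>"
    and comp: "\<And>m n. n \<in> supp_unfrozen s \<Longrightarrow> v (form lam m (pstar s n)) = v (- pair (dvec s) m n)"
    using assms(1) unfolding A_ok_def X_ok_def sl fst_conv snd_conv by blast+
  have comp': "v (form (snd (pmut k (s, lam))) m (pstar (mut k s) n)) = v (- pair (dvec s) m n)"
    if "n \<in> supp_unfrozen s" for m n
  proof -
    have "tauX s k n \<in> supp_unfrozen s"
      using that assms(2) supp_unfrozen_closed(4) sl by simp
    then show ?thesis
      using comp[of "tauX s k n" "tauA s k m"]
      by (simp add: form_pmut[OF s(2)] tauA_pstar[OF s(2)] pair_tau[OF s(2)])
  qed
  have "supp_unfrozen (mut k s) = supp_unfrozen s"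
    by (simp add: supp_unfrozen_def)
  then have 1: "\<forall>m. \<forall>n\<in>supp_unfrozen (fst (pmut k sl)). v (form (snd (pmut k sl)) m (pstar (fst (pmut k sl)) n))
      = v (- pair (dvec (fst (pmut k sl))) m n)"
    using comp' by (simp add: sl pmut_eq)
  have 2: "\<forall>i j. snd (pmut k sl) i j = - snd (pmut k sl) j i"
    unfolding sl pmut_eq snd_conv by (intro allI form_skew lam(1))
  have 3: "\<forall>i j. snd (pmut k sl) i j \<in> \<Lambda>"
    unfolding sl pmut_eq snd_conv by (intro allI form_Lam lam(2))
  have "X_ok (fst (pmut k sl))"
    using X_ok_mut[OF s(1)] by (simp add: sl pmut_eq)
  then show ?thesis
    unfolding A_ok_def using 1 2 3 by blast
qed

lemma kap_q_powers: "X_ok s \<Longrightarrow> q_powers v (1 / of_int (dvec s k)) (kap (dvec s k))"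
  using q_powers[of "1 / of_int (dvec s k)"] unfolding kap_def[abs_def] X_ok_def by blast

lemma mutation_map_X:
  assumes "X_ok s"
  shows "mutation_map (chiX s) (chiX (mut k s)) (tauX s k) (\<lambda>n. pstar s n k) (evec k) (kap (dvec s k))"
proof -
  interpret T: qtorus "chiX s"
    by (rule qtorus_X[OF assms])
  interpret T': qtorus "chiX (mut k s)"
    by (rule qtorus_X[OF X_ok_mut[OF assms]])
  interpret q: q_powers v "1 / of_int (dvec s k)" "kap (dvec s k)"
    by (rule kap_q_powers[OF assms])
  have s: "valid_seed s"
    using assms by (simp add: X_ok_def)
  show ?thesis
  proof
    show "evec k \<noteq> 0"
      by (auto simp: evec_def fun_eq_iff lattice_apply intro!: exI[of _ k])
    show "chiX s m (evec k) = kap (dvec s k) (- pstar s m k)" for m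
      by (simp add: omega_pair pair_evec kap_def)
  qed (use s q.kappa_add in \<open>simp_all add: tauX_add inj_tauX omega_mut pstar_add lattice_apply\<close>)
qed

text \<open>By compatibility the twist of \<open>m\<close> with \<open>p^* e_k\<close> is
  \<open>v\<close> to the power \<open>- m_k / d_k\<close>, hence \<open>h m = m k\<close>. In the
  classical case \<open>p^* e_k\<close> can vanish for a general seed; for linked seeds it is
  nonzero by injectivity of \<open>qmap\<close>.\<close>

lemma mutation_map_A:
  assumes "A_ok (s, lam)" "k \<in> unfrozen s" "pstar s (evec k) \<noteq> 0"
  shows "mutation_map (chiA (s, lam)) (chiA (pmut k (s, lam))) (tauA s k) (\<lambda>m. m k) (pstar s (evec k)) (kap (dvec s k))"
proof -
  interpret T: qtorus "chiA (s, lam)"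
    by (rule qtorus_A[OF assms(1)])
  interpret T': qtorus "chiA (pmut k (s, lam))"
    by (rule qtorus_A[OF A_ok_pmut]) (use assms in auto)
  have s: "X_ok s" "valid_seed s"
    using assms(1) unfolding A_ok_def X_ok_def fst_conv by blast+
  interpret q: q_powers v "1 / of_int (dvec s k)" "kap (dvec s k)"
    by (rule kap_q_powers[OF s(1)])
  show ?thesis
  proof
    show "chiA (s, lam) m (pstar s (evec k)) = kap (dvec s k) (- m k)" for m
    proof -
      have "v (form lam m (pstar s (evec k))) = v (- pair (dvec s) m (evec k))"
        using assms(1) supp_unfrozen_closed(2)[OF assms(2)] unfolding A_ok_def fst_conv snd_conv by blast
      then show ?thesis
        by (simp add: pair_evec kap_def)
    qed
  qed (use s q.kappa_add assms(3) in \<open>simp_all add: tauA_add inj_tauA form_pmut lattice_apply\<close>)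
qed

lemma LPX_eq: "LPX v s = torus (chiX s)"
  by (simp add: LPX_def quantum_torus_eq)

lemma LPA_eq: "LPA v sl = torus (chiA sl)"
  by (simp add: LPA_def quantum_torus_eq)

lemma tauX_evec:
  assumes "valid_seed s"
  shows "tauX s k (evec i) = (if i = k then - evec k else (\<lambda>j. evec i j + pos_part (Bmat s k i) * evec k j))"
proof -
  have "(\<Sum>j\<in>UNIV. pos_part (Bmat s k j) * evec i j) = pos_part (Bmat s k i)"
    by (simp add: evec_def if_distrib[of "(*) _"] cong: if_cong)
  then show ?thesis
    by (auto simp: tauX_def fun_eq_iff evec_def Bmat_diag[OF assms])
qed

lemma tauX_minus: "tauX s k (- n) = - tauX s k n"
  by (auto simp: tauX_def fun_eq_iff sum_negf)

lemma pstar_minus: "pstar s (- n) = - pstar s n"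
  by (auto simp: pstar_def fun_eq_iff sum_negf)

lemma mutX_image_phi:
  assumes "X_ok s"
  shows "mutX_image v s k i = mutation_map.phi (chiX s) (tauX s k) (\<lambda>n. pstar s n k) (evec k) (kap (dvec s k))
    (single (evec i) 1)"
proof -
  interpret M: mutation_map "chiX s" "chiX (mut k s)" "tauX s k" "\<lambda>n. pstar s n k" "evec k" "kap (dvec s k)"
    by (rule mutation_map_X[OF assms])
  interpret q: q_powers v "1 / of_int (dvec s k)" "kap (dvec s k)"
    by (rule kap_q_powers[OF assms])
  have s: "valid_seed s"
    using assms by (simp add: X_ok_def)
  \<comment> \<open>Adding multiples of \<open>e_k\<close> does not change \<open>h\<close>, because
    \<open>b_kk = 0\<close>. So the case distinction in the mutation rule is one by the sign of
    \<open>h\<close>.\<close>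
  have h: "pstar s (tauX s k (evec i)) k = (if i = k then 0 else Bmat s k i)"
  proof (cases "i = k")
    case False
    have "pstar s (\<lambda>j. c * evec k j) k = 0" for c
      unfolding pstar_def by (intro sum.neutral) (auto simp: evec_def Bmat_diag[OF s])
    then show ?thesis
      using False pstar_add[of s "evec i" "\<lambda>j. pos_part (Bmat s k i) * evec k j"]
      by (simp add: tauX_evec[OF s] pstar_evec lattice_apply plus_fun_def)
  qed (simp add: tauX_evec[OF s] pstar_minus pstar_evec Bmat_diag[OF s])
  consider "i = k" | "i \<noteq> k" "Bmat s k i \<le> 0" | "i \<noteq> k" "Bmat s k i > 0"
    by force
  then show ?thesis
  proof cases
    case 1
    have "M.phi (single (evec i) 1) = M.T.emb (single (tauX s k (evec i)) 1)"
      using M.phi_mono_nonpos[of "evec i"] h 1 by simp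
    moreover have "tauX s k (evec i) = (\<lambda>j. - evec k j)"
      using 1 by (auto simp: tauX_evec[OF s])
    ultimately show ?thesis
      using 1 by (simp add: mutX_image_def embX_def LPX_eq)
  next
    case 2
    have "tauX s k (evec i) = evec i"
      using 2 by (auto simp: tauX_evec[OF s] pos_part_def)
    then show ?thesis
      using M.phi_mono_gbinom[of "evec i"] h 2
      by (simp add: mutX_image_def embX_def LPX_eq q.qbinom_eq Let_def)
  next
    case 3
    \<comment> \<open>Here \<open>h = b > 0\<close>, so the image is computed through the inverse
      monomial, which has \<open>h = - b\<close> and falls under the binomial formula.\<close>
    let ?b = "Bmat s k i"
    have tau: "tauX s k (- evec i) = (\<lambda>j. - evec i j - ?b * evec k j)"
      using 3 by (auto simp: tauX_minus tauX_evec[OF s] pos_part_def)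
    have h': "pstar s (tauX s k (- evec i)) k = - ?b"
      using h 3 by (simp add: tauX_minus pstar_minus)
    have "M.phi (single (- evec i) 1) = M.T.emb (\<Sum>r\<le>nat ?b.
        single (\<lambda>j. - evec i j + (int r - ?b) * evec k j) (gbinom (kap (dvec s k)) (nat ?b) r))"
      using M.phi_mono_gbinom[of "- evec i"] h' 3 by (simp add: tau algebra_simps)
    then have "M.phi (single (evec i) 1) = inv\<^bsub>M.T.F\<^esub> (M.T.emb (\<Sum>r\<le>nat ?b.
        single (\<lambda>j. - evec i j + (int r - ?b) * evec k j) (gbinom (kap (dvec s k)) (nat ?b) r)))"
      using M.phi_mono_inverse[of "evec i"] by simp
    then show ?thesis
      using 3 by (simp add: mutX_image_def embX_def FX_def LPX_eq q.qbinom_eq Let_def)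
  qed
qed

lemma tauA_evec:
  assumes "valid_seed s"
  shows "tauA s k (evec i) = mut_basis s k i"
  by (auto simp: tauA_def mut_basis_def fun_eq_iff evec_def Bmat_diag[OF assms])

lemma mutA_image_phi:
  assumes "A_ok (s, lam)" "k \<in> unfrozen s" "pstar s (evec k) \<noteq> 0"
  shows "embA v (s, lam) (mutA_image s k i) =
    mutation_map.phi (chiA (s, lam)) (tauA s k) (\<lambda>m. m k) (pstar s (evec k)) (kap (dvec s k))
    (single (evec i) 1)"
proof -
  interpret M: mutation_map "chiA (s, lam)" "chiA (pmut k (s, lam))" "tauA s k" "\<lambda>m. m k" "pstar s (evec k)" "kap (dvec s k)"
    by (rule mutation_map_A[OF assms])
  have s: "valid_seed s"
    using assms(1) unfolding A_ok_def X_ok_def fst_conv by blast+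
  show ?thesis
  proof (cases "i = k")
    case True
    have h: "tauA s k (evec i) k = - 1"
      using True by (simp add: tauA_def evec_def)
    \<comment> \<open>Since \<open>[-b]_+ + b = [b]_+\<close>, the two terms of the binomial for
      \<open>h = - 1\<close> are the two exchange monomials. The factor 1 in front of
      \<open>pstar\<close> is \<open>int r\<close> at \<open>r = 1\<close>.\<close>
    have e: "(\<lambda>j. tauA s k (evec i) j + 1 * pstar s (evec k) j) = (\<lambda>j. - evec k j + pos_part (Bmat s j k))"
      using True by (auto simp: tauA_evec[OF s] mut_basis_def pstar_evec fun_eq_iff pos_part_def)
    have "(\<Sum>r\<le>nat (- tauA s k (evec i) k).
        single (\<lambda>j. tauA s k (evec i) j + int r * pstar s (evec k) j)
          (gbinom (kap (dvec s k)) (nat (- tauA s k (evec i) k)) r))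
        = single (tauA s k (evec i)) 1
          + single (\<lambda>j. tauA s k (evec i) j + 1 * pstar s (evec k) j) 1"
      unfolding h by simp
    then have "M.phi (single (evec i) 1) = M.T.emb (single (tauA s k (evec i)) 1
          + single (\<lambda>j. tauA s k (evec i) j + 1 * pstar s (evec k) j) 1)"
      using M.phi_mono_gbinom[of "evec i"] h by simp
    then show ?thesis
      unfolding e using True tauA_evec[OF s, of k i]
      by (simp add: mutA_image_def embA_def LPA_eq mut_basis_def)
  next
    case False
    have "tauA s k (evec i) = evec i"
      unfolding tauA_evec[OF s] mut_basis_def using False by simp
    moreover have "evec i k = 0"
      using False by (simp add: evec_def)
    ultimately have "M.phi (single (evec i) 1) = M.T.emb (single (evec i) 1)"
      using M.phi_mono_nonpos[of "evec i"] by (simp only: order_refl M.L_refl M.T.tm_one)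
    then show ?thesis
      using False by (simp add: mutA_image_def embA_def LPA_eq)
  qed
qed

abbreviation numX where
  "numX s k \<equiv> numer (chiX s) (kap (dvec s k)) (evec k) (\<lambda>n. pstar s n k) (tauX s k)"

abbreviation bndX where
  "bndX s k \<equiv> bnd (\<lambda>n. pstar s n k) (tauX s k)"

abbreviation numA where
  "numA sl k \<equiv> numer (chiA sl) (kap (dvec (fst sl) k)) (pstar (fst sl) (evec k)) (\<lambda>m. m k) (tauA (fst sl) k)"

abbreviation bndA where
  "bndA sl k \<equiv> bnd (\<lambda>m. m k) (tauA (fst sl) k)"

lemma mutX_hom:
  assumes "X_ok s"
  shows "mutX v s k \<in> ring_hom (FX v (mut k s)) (FX v s)"
    and "mutX v s k (embX v (mut k s) (cst c)) = embX v s (cst c)"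
    and "b \<noteq> 0 \<Longrightarrow> bndX s k a \<le> N \<Longrightarrow> bndX s k b \<le> N \<Longrightarrow>
      mutX v s k (ore_class (LPX v (mut k s)) a b) = ore_class (LPX v s) (numX s k N a) (numX s k N b)"
    and "b \<noteq> 0 \<Longrightarrow> numX s k N b \<noteq> 0"
proof -
  interpret M: mutation_map "chiX s" "chiX (mut k s)" "tauX s k" "\<lambda>n. pstar s n k" "evec k" "kap (dvec s k)"
    by (rule mutation_map_X[OF assms])
  have eq: "mutX v s k = (SOME \<psi>. \<psi> \<in> ring_hom M.T'.F M.T.F \<and> (\<forall>c. \<psi> (M.T'.emb (cst c)) = M.T.emb (cst c)) \<and>
      (\<forall>i. \<psi> (M.T'.emb (single (evec i) 1)) = mutX_image v s k i))"
    by (simp add: mutX_def FX_def embX_def LPX_eq)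
  note hom = M.mutation_hom[OF mutX_image_phi[OF assms], folded eq]
  show "mutX v s k \<in> ring_hom (FX v (mut k s)) (FX v s)"
    and "mutX v s k (embX v (mut k s) (cst c)) = embX v s (cst c)"
    and "b \<noteq> 0 \<Longrightarrow> bndX s k a \<le> N \<Longrightarrow> bndX s k b \<le> N \<Longrightarrow>
      mutX v s k (ore_class (LPX v (mut k s)) a b) = ore_class (LPX v s) (numX s k N a) (numX s k N b)"
    using hom by (simp_all add: FX_def embX_def LPX_eq)
  show "b \<noteq> 0 \<Longrightarrow> numX s k N b \<noteq> 0"
    by (rule M.num_nonzero)
qed

lemma mutA_hom:
  assumes "A_ok sl" "k \<in> unfrozen (fst sl)" "pstar (fst sl) (evec k) \<noteq> 0"
  shows "b \<noteq> 0 \<Longrightarrow> bndA sl k a \<le> N \<Longrightarrow> bndA sl k b \<le> N \<Longrightarrow>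
      mutA v sl k (ore_class (LPA v (pmut k sl)) a b) = ore_class (LPA v sl) (numA sl k N a) (numA sl k N b)"
    and "b \<noteq> 0 \<Longrightarrow> numA sl k N b \<noteq> 0"
proof -
  obtain s lam where sl: "sl = (s, lam)"
    by fastforce
  note assms' = assms[unfolded sl fst_conv]
  interpret M: mutation_map "chiA (s, lam)" "chiA (pmut k (s, lam))" "tauA s k" "\<lambda>m. m k" "pstar s (evec k)" "kap (dvec s k)"
    by (rule mutation_map_A[OF assms'])
  have eq: "mutA v (s, lam) k = (SOME \<psi>. \<psi> \<in> ring_hom M.T'.F M.T.F \<and> (\<forall>c. \<psi> (M.T'.emb (cst c)) = M.T.emb (cst c)) \<and>
      (\<forall>i. \<psi> (M.T'.emb (single (evec i) 1)) = embA v (s, lam) (mutA_image s k i)))"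
    by (simp add: mutA_def FA_def embA_def LPA_eq)
  note hom = M.mutation_hom[OF mutA_image_phi[OF assms'], folded eq]
  show "b \<noteq> 0 \<Longrightarrow> bndA sl k a \<le> N \<Longrightarrow> bndA sl k b \<le> N \<Longrightarrow>
      mutA v sl k (ore_class (LPA v (pmut k sl)) a b) = ore_class (LPA v sl) (numA sl k N a) (numA sl k N b)"
    using hom(3) by (simp add: LPA_eq sl)
  show "b \<noteq> 0 \<Longrightarrow> numA sl k N b \<noteq> 0"
    using M.num_nonzero by (simp add: sl)
qed

end

section \<open>Comparing a seed with its principal coefficient seed\<close>

definition iota :: "'i lattice \<Rightarrow> ('i + 'i) lattice" where
  "iota n = case_sum n (\<lambda>_. 0)"

definition qmap :: "('i::finite + 'i) pseed \<Rightarrow> 'i lattice \<Rightarrow> ('i + 'i) lattice" where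
  "qmap sl n = pstar (fst sl) (iota n)"

lemma iota_simps [simp]: "iota n (Inl i) = n i" "iota n (Inr i) = 0"
  by (simp_all add: iota_def)

lemma sum_type_ext: "f = g \<longleftrightarrow> (\<forall>i. f (Inl i) = g (Inl i)) \<and> (\<forall>i. f (Inr i) = g (Inr i))"
  by (auto simp: fun_eq_iff) (metis sum.exhaust)

lemma sum_UNIV_sum: "(\<Sum>x\<in>UNIV. f x) = (\<Sum>i\<in>UNIV. f (Inl i)) + (\<Sum>i\<in>UNIV. f (Inr i))"
  for f :: "'a::finite + 'b::finite \<Rightarrow> 'c::comm_monoid_add"
  using sum.Plus[of "UNIV :: 'a set" "UNIV :: 'b set" f] by (simp add: UNIV_Plus_UNIV comp_def)

lemma iota_add: "iota (m + n) = iota m + iota n"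
  by (simp add: sum_type_ext lattice_apply)

lemma iota_0 [simp]: "iota 0 = 0"
  by (simp add: sum_type_ext lattice_apply)

lemma inj_iota: "inj iota"
  by (rule injI) (auto simp: sum_type_ext)

lemma iota_evec: "iota (evec i) = evec (Inl i)"
  by (simp add: sum_type_ext evec_def)

lemma qmap_add: "qmap sl (m + n) = qmap sl m + qmap sl n"
  by (simp add: qmap_def iota_add pstar_add)

lemma qmap_0 [simp]: "qmap sl 0 = 0"
  using qmap_add[of sl 0 0] by simp

lemma pair_iota:
  assumes "\<And>i. d (Inl i) = d' i"
  shows "pair d m (iota n) = pair d' (\<lambda>i. m (Inl i)) n"
  by (simp add: pair_def sum_UNIV_sum assms)

lemma fst_pmut [simp]: "fst (pmut k sl) = mut k (fst sl)"
  by (cases sl) (simp add: pmut_eq)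

lemma seq_simps [simp]:
  "mut_seq [] s = s" "mut_seq (k # ks) s = mut_seq ks (mut k s)"
  "pmut_seq [] sl = sl" "pmut_seq (k # ks) sl = pmut_seq ks (pmut k sl)"
  by (simp_all add: mut_seq_def pmut_seq_def)

lemma supp_unfrozen_mut [simp]: "supp_unfrozen (mut k s) = supp_unfrozen s"
  by (simp add: supp_unfrozen_def)

context base
begin

lemma A_okD: "A_ok sl \<Longrightarrow> X_ok (fst sl)"
  unfolding A_ok_def by (elim conjE)

lemma X_okD: "X_ok s \<Longrightarrow> valid_seed s"
  unfolding X_ok_def by (elim conjE)

text \<open>Holds for \<open>s\<close> and \<open>s'\<close> obtained from \<open>t\<close> and \<open>prin t\<close> by the same mutations.\<close>

definition linked :: "('i::finite) seed \<Rightarrow> ('i + 'i) pseed \<Rightarrow> bool" where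
  "linked s sl \<longleftrightarrow> X_ok s \<and> A_ok sl \<and> unfrozen (fst sl) = Inl ` unfrozen s \<and>
     (\<forall>i. dvec (fst sl) (Inl i) = dvec s i) \<and>
     (\<forall>i j. Bmat (fst sl) (Inl i) (Inl j) = Bmat s i j) \<and> inj (qmap sl)"

context
  fixes s :: "('i::finite) seed" and sl :: "('i + 'i) pseed"
  assumes linked: "linked s sl"
begin

lemma linkedD:
  "X_ok s" "A_ok sl" "X_ok (fst sl)" "valid_seed s" "valid_seed (fst sl)"
  "unfrozen (fst sl) = Inl ` unfrozen s" "dvec (fst sl) (Inl i) = dvec s i"
  "Bmat (fst sl) (Inl i) (Inl j) = Bmat s i j" "inj (qmap sl)"
  using linked A_okD[of sl] X_okD[of s] X_okD[of "fst sl"] unfolding linked_def by simp_all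

lemma qmap_Inl: "qmap sl n (Inl k) = pstar s n k"
  by (simp add: qmap_def pstar_def sum_UNIV_sum linkedD)

lemma omega_iota: "omega (fst sl) (iota m) (iota n) = omega s m n"
  unfolding omega_pair pair_iota[of "dvec (fst sl)" "dvec s", OF linkedD(7)]
  by (simp add: qmap_Inl flip: qmap_def)

lemma tauX_iota: "tauX (fst sl) (Inl k) (iota n) = iota (tauX s k n)"
  by (simp add: sum_type_ext tauX_def sum_UNIV_sum linkedD)

lemma qmap_tau: "qmap sl (tauX s k n) = tauA (fst sl) (Inl k) (qmap (pmut (Inl k) sl) n)"
  by (simp add: qmap_def tauA_pstar[OF linkedD(5)] tauX_iota)

lemma iota_supp: "n \<in> supp_unfrozen s \<Longrightarrow> iota n \<in> supp_unfrozen (fst sl)"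
  by (auto simp: supp_unfrozen_def linkedD image_iff split: sum.splits)
     (metis iota_simps old.sum.exhaust)

text \<open>Compatibility evaluates the form only against \<open>p^*\<close> of vectors with
  unfrozen support, hence the condition on the right argument. The pairing with
  \<open>iota n\<close> sees only the \<open>Inl\<close> part of \<open>qmap sl m\<close>, which is
  \<open>pstar s m\<close>.\<close>

lemma chi_qmap:
  assumes "n \<in> supp_unfrozen s"
  shows "chiA sl (qmap sl m) (qmap sl n) = chiX s m n"
proof -
  have "chiA sl (qmap sl m) (qmap sl n) = v (- pair (dvec (fst sl)) (qmap sl m) (iota n))"
    using linkedD(2) iota_supp[OF assms] unfolding A_ok_def qmap_def[of sl n] by blast
  then show ?thesis
    unfolding omega_pair pair_iota[of "dvec (fst sl)" "dvec s", OF linkedD(7)] by (simp add: qmap_Inl)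
qed

lemma qmap_evec: "qmap sl (evec k) = pstar (fst sl) (evec (Inl k))"
  by (simp add: qmap_def iota_evec)

lemma pstar_evec_nonzero: "pstar (fst sl) (evec (Inl k)) \<noteq> 0"
proof
  assume "pstar (fst sl) (evec (Inl k)) = 0"
  then have "qmap sl (evec k) = qmap sl 0"
    by (simp add: qmap_evec)
  then have "evec k = (0 :: 'i lattice)"
    using linkedD(9) by (simp only: inj_eq)
  then have "evec k k = (0 :: 'i lattice) k"
    by simp
  then show False
    by (simp add: evec_def lattice_apply)
qed

text \<open>Injectivity of \<open>qmap\<close> is inherited because the maps before and after
  mutation differ by the injective changes of basis \<open>tauX\<close> and
  \<open>tauA\<close>.\<close>

lemma linked_mut:
  assumes "k \<in> unfrozen s"
  shows "linked (mut k s) (pmut (Inl k) sl)"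
  unfolding linked_def
proof (intro conjI allI)
  show "X_ok (mut k s)"
    by (rule X_ok_mut[OF linkedD(1)])
  show "A_ok (pmut (Inl k) sl)"
    by (rule A_ok_pmut[OF linkedD(2)]) (use assms linkedD(6) in simp)
  show "inj (qmap (pmut (Inl k) sl))"
  proof (rule injI)
    fix m n assume "qmap (pmut (Inl k) sl) m = qmap (pmut (Inl k) sl) n"
    then have "qmap sl (tauX s k m) = qmap sl (tauX s k n)"
      by (simp only: qmap_tau)
    then show "m = n"
      using linkedD(9) inj_tauX[OF linkedD(4)] by (simp only: inj_eq)
  qed
qed (simp_all add: linkedD)

text \<open>The exponents of the cut-off products are multiples of \<open>e_k\<close> with
  \<open>k\<close> unfrozen, so \<open>chi_qmap\<close> applies to them although \<open>f\<close> is
  arbitrary.\<close>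

lemma push_numX_qmap:
  assumes "k \<in> unfrozen s"
  shows "push (qmap sl) (numX s k N f) = numA sl (Inl k) N (push (qmap (pmut (Inl k) sl)) f)"
  unfolding linkedD(7)
proof (rule push_numer)
  show "0 \<in> supp_unfrozen s" "evec k \<in> supp_unfrozen s"
    "\<And>m n. m \<in> supp_unfrozen s \<Longrightarrow> n \<in> supp_unfrozen s \<Longrightarrow> m + n \<in> supp_unfrozen s"
    using supp_unfrozen_closed assms by blast+
qed (simp_all add: qmap_add chi_qmap qmap_evec qmap_Inl qmap_tau)

lemma push_numX_iota:
  assumes "k \<in> unfrozen s"
  shows "push iota (numX s k N f) = numX (fst sl) (Inl k) N (push iota f)"
  unfolding linkedD(7)
proof (rule push_numer)
  show "0 \<in> supp_unfrozen s" "evec k \<in> supp_unfrozen s"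
    "\<And>m n. m \<in> supp_unfrozen s \<Longrightarrow> n \<in> supp_unfrozen s \<Longrightarrow> m + n \<in> supp_unfrozen s"
    using supp_unfrozen_closed assms by blast+
  show "pstar (fst sl) (iota m) (Inl k) = pstar s m k" for m
    using qmap_Inl by (simp add: qmap_def)
qed (simp_all add: iota_add omega_iota iota_evec tauX_iota)

lemma keys_numX:
  assumes "k \<in> unfrozen s" "keys f \<subseteq> supp_unfrozen s"
  shows "keys (numX s k N f) \<subseteq> supp_unfrozen s"
proof -
  have "keys (numX s k N f) \<subseteq>
      {tauX s k m + n | m n. m \<in> keys f \<and> n \<in> supp_unfrozen s}"
    using supp_unfrozen_closed(1,2,3) assms(1) by (intro keys_numer) blast+
  then show ?thesis
    using assms supp_unfrozen_closed(3,4) by blast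
qed

end

text \<open>One numerator \<open>a\<close> and one denominator \<open>b\<close> serve all three
  tori. The unfrozen support of \<open>b\<close> is carried through the induction because only then
  can an equation with right factor \<open>b\<close> be moved along \<open>qmap\<close>.\<close>

lemma mutation_sequence:
  assumes "linked s sl" "set ks \<subseteq> unfrozen s" "keys g \<subseteq> supp_unfrozen s" "g \<noteq> 0"
  shows "\<exists>a b. keys b \<subseteq> supp_unfrozen s \<and> b \<noteq> 0 \<and>
    mutX_seq v ks s (ore_class (LPX v (mut_seq ks s)) f g) = ore_class (LPX v s) a b \<and>
    mutX_seq v (map Inl ks) (fst sl)
      (ore_class (LPX v (mut_seq (map Inl ks) (fst sl))) (push iota f) (push iota g))
      = ore_class (LPX v (fst sl)) (push iota a) (push iota b) \<and>
    mutA_seq v (map Inl ks) sl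
      (ore_class (LPA v (pmut_seq (map Inl ks) sl))
        (push (qmap (pmut_seq (map Inl ks) sl)) f) (push (qmap (pmut_seq (map Inl ks) sl)) g))
      = ore_class (LPA v sl) (push (qmap sl) a) (push (qmap sl) b)"
  using assms
proof (induction ks arbitrary: s sl)
  case Nil
  then show ?case
    by (intro exI[of _ f] exI[of _ g]) simp
next
  case (Cons k ks)
  have k: "k \<in> unfrozen s"
    using Cons.prems by simp
  note link = Cons.prems(1)
  note D = linkedD[OF link]
  let ?sl' = "pmut (Inl k) sl"
  have "linked (mut k s) ?sl'"
    by (rule linked_mut[OF link k])
  then obtain a' b' where ab: "keys b' \<subseteq> supp_unfrozen s" "b' \<noteq> 0"
      "mutX_seq v ks (mut k s) (ore_class (LPX v (mut_seq ks (mut k s))) f g) = ore_class (LPX v (mut k s)) a' b'"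
      "mutX_seq v (map Inl ks) (mut (Inl k) (fst sl))
        (ore_class (LPX v (mut_seq (map Inl ks) (mut (Inl k) (fst sl)))) (push iota f) (push iota g))
        = ore_class (LPX v (mut (Inl k) (fst sl))) (push iota a') (push iota b')"
      "mutA_seq v (map Inl ks) ?sl'
        (ore_class (LPA v (pmut_seq (map Inl ks) ?sl'))
          (push (qmap (pmut_seq (map Inl ks) ?sl')) f) (push (qmap (pmut_seq (map Inl ks) ?sl')) g))
        = ore_class (LPA v ?sl') (push (qmap ?sl') a') (push (qmap ?sl') b')"
    using Cons.IH[of "mut k s" ?sl'] Cons.prems by auto
  \<comment> \<open>Pushing forward does not raise \<open>bnd\<close>, so one cut-off is admissible
    on all three sides.\<close>
  define N where "N = max (bndX s k a') (bndX s k b')"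
  have N: "bndX s k a' \<le> N" "bndX s k b' \<le> N"
    by (auto simp: N_def)
  have bX: "bndX (fst sl) (Inl k) (push iota f) \<le> bndX s k f" for f :: "('a, 'k) laurent"
    using qmap_Inl[OF link] tauX_iota[OF link] by (intro bnd_push) (simp add: qmap_def)
  have bA: "bndA sl (Inl k) (push (qmap ?sl') f) \<le> bndX s k f" for f :: "('a, 'k) laurent"
    using qmap_Inl[OF link] by (intro bnd_push) (simp flip: qmap_tau[OF link])
  have nz: "push iota b' \<noteq> 0" "push (qmap ?sl') b' \<noteq> 0"
    using ab(2) linkedD(9)[OF \<open>linked (mut k s) ?sl'\<close>]
    by (simp_all add: push_eq_0_iff push_eq_0_iff[OF inj_iota])
  have 1: "mutX v s k (ore_class (LPX v (mut k s)) a' b') = ore_class (LPX v s) (numX s k N a') (numX s k N b')"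
    by (rule mutX_hom(3)[OF D(1) ab(2) N])
  have 2: "mutX v (fst sl) (Inl k) (ore_class (LPX v (mut (Inl k) (fst sl))) (push iota a') (push iota b'))
      = ore_class (LPX v (fst sl)) (push iota (numX s k N a')) (push iota (numX s k N b'))"
    unfolding push_numX_iota[OF link k]
    by (rule mutX_hom(3)[OF D(3) nz(1)]) (use bX N order_trans in blast)+
  have 3: "mutA v sl (Inl k) (ore_class (LPA v ?sl') (push (qmap ?sl') a') (push (qmap ?sl') b'))
      = ore_class (LPA v sl) (push (qmap sl) (numX s k N a')) (push (qmap sl) (numX s k N b'))"
    unfolding push_numX_qmap[OF link k]
    by (rule mutA_hom(1)[OF D(2) _ pstar_evec_nonzero[OF link] nz(2)])
       (use D(6) k bA N order_trans in \<open>blast | simp\<close>)+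
  show ?case
    by (rule exI[of _ "numX s k N a'"], rule exI[of _ "numX s k N b'"])
       (use 1 2 3 ab keys_numX[OF link k ab(1)] mutX_hom(4)[OF D(1) ab(2)] in simp)
qed

text \<open>Mutation maps preserve the grading since \<open>\<delta>\<close> vanishes on the exponents \<open>p^* e_k\<close>.\<close>

lemma graded_mutation_sequence:
  fixes s :: "('i::finite) seed"
  assumes "linked s sl" "set ks \<subseteq> unfrozen s"
    and "\<And>m n. \<delta> (m + n) = \<delta> m + (\<delta> n :: 'c::ab_group_add)"
    and "\<And>m. \<delta> m = 0 \<longleftrightarrow> m \<in> range (qmap sl)"
  obtains \<delta>' where "\<And>m n. \<delta>' (m + n) = \<delta>' m + \<delta>' n"
    "\<And>m. \<delta>' m = 0 \<longleftrightarrow> m \<in> range (qmap (pmut_seq (map Inl ks) sl))"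
    "\<And>f g d. \<lbrakk>\<forall>m\<in>keys f. \<delta>' m = d; \<forall>m\<in>keys g. \<delta>' m = 0; g \<noteq> 0\<rbrakk> \<Longrightarrow>
      \<exists>a b. (\<forall>m\<in>keys a. \<delta> m = d) \<and> (\<forall>m\<in>keys b. \<delta> m = 0) \<and> b \<noteq> 0 \<and>
        mutA_seq v (map Inl ks) sl (ore_class (LPA v (pmut_seq (map Inl ks) sl)) f g) = ore_class (LPA v sl) a b"
  using assms
proof (induction ks arbitrary: s sl \<delta> thesis)
  case Nil
  then show ?case
    by (intro Nil.prems(1)[of \<delta>]) (auto intro: exI[of _ f for f])
next
  case (Cons k ks)
  note link = Cons.prems(2)
  have k: "k \<in> unfrozen s"
    using Cons.prems(3) by simp
  note D = linkedD[OF link]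
  let ?sl' = "pmut (Inl k) sl" and ?\<tau> = "tauA (fst sl) (Inl k)"
  have link': "linked (mut k s) ?sl'"
    by (rule linked_mut[OF link k])
  \<comment> \<open>At the mutated seed the grading is \<open>\<delta>\<close> composed with
    \<open>?\<tau>\<close>; its kernel is the new image of \<open>qmap\<close>, by
    \<open>qmap_tau\<close> and because \<open>tauX\<close> is an involution.\<close>
  have ker: "\<delta> (?\<tau> m) = 0 \<longleftrightarrow> m \<in> range (qmap ?sl')" for m
  proof
    assume "\<delta> (?\<tau> m) = 0"
    then obtain n where "?\<tau> m = qmap sl n"
      using Cons.prems(5) by auto
    then have "?\<tau> m = qmap sl (tauX s k (tauX s k n))"
      by (simp add: tauX_tauX[OF D(4)])
    then have "?\<tau> m = ?\<tau> (qmap ?sl' (tauX s k n))"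
      by (simp only: qmap_tau[OF link])
    then have "m = qmap ?sl' (tauX s k n)"
      using inj_tauA by (rule injD[rotated])
    then show "m \<in> range (qmap ?sl')"
      by simp
  next
    assume "m \<in> range (qmap ?sl')"
    then obtain n where "m = qmap ?sl' n"
      by blast
    then show "\<delta> (?\<tau> m) = 0"
      using Cons.prems(5) by (simp flip: qmap_tau[OF link])
  qed
  have add: "\<delta> (?\<tau> (m + n)) = \<delta> (?\<tau> m) + \<delta> (?\<tau> n)" for m n
    by (simp add: tauA_add Cons.prems(4))
  have ks: "set ks \<subseteq> unfrozen (mut k s)"
    using Cons.prems(3) by simp
  show ?case
  proof (rule Cons.IH[OF _ link' ks add ker])
    fix \<delta>' assume \<delta>': "\<And>m n. \<delta>' (m + n) = \<delta>' m + \<delta>' n"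
      "\<And>m. \<delta>' m = 0 \<longleftrightarrow> m \<in> range (qmap (pmut_seq (map Inl ks) ?sl'))"
      "\<And>f g d. \<lbrakk>\<forall>m\<in>keys f. \<delta>' m = d; \<forall>m\<in>keys g. \<delta>' m = 0; g \<noteq> 0\<rbrakk> \<Longrightarrow>
        \<exists>a b. (\<forall>m\<in>keys a. \<delta> (?\<tau> m) = d) \<and> (\<forall>m\<in>keys b. \<delta> (?\<tau> m) = 0) \<and> b \<noteq> 0 \<and>
          mutA_seq v (map Inl ks) ?sl' (ore_class (LPA v (pmut_seq (map Inl ks) ?sl')) f g)
          = ore_class (LPA v ?sl') a b"
    \<comment> \<open>The cut-off products only add multiples of \<open>p^* e_k\<close>, which
      equals \<open>qmap sl (evec k)\<close> and so has degree 0.\<close>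
    have deg: "\<forall>m\<in>keys (numA sl (Inl k) N f). \<delta> m = d"
      if "\<forall>m\<in>keys f. \<delta> (?\<tau> m) = d" for N f d
    proof -
      have e: "\<delta> (pstar (fst sl) (evec (Inl k))) = 0"
        using Cons.prems(5) by (simp flip: qmap_evec[OF link])
      have "\<delta> 0 = 0"
        using Cons.prems(4)[of 0 0] by simp
      then have "keys (numA sl (Inl k) N f) \<subseteq>
          {?\<tau> m + n | m n. m \<in> keys f \<and> n \<in> {n. \<delta> n = 0}}"
        using e Cons.prems(4) by (intro keys_numer) auto
      then show ?thesis
        using that Cons.prems(4) by fastforce
    qed
    show thesis
    proof (rule Cons.prems(1)[of \<delta>'])
      fix f g :: "('i + 'i, 'k) laurent" and d
      assume fg: "\<forall>m\<in>keys f. \<delta>' m = d" "\<forall>m\<in>keys g. \<delta>' m = 0" "g \<noteq> 0"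
      obtain a b where ab: "\<forall>m\<in>keys a. \<delta> (?\<tau> m) = d" "\<forall>m\<in>keys b. \<delta> (?\<tau> m) = 0"
          "b \<noteq> 0" "mutA_seq v (map Inl ks) ?sl' (ore_class (LPA v (pmut_seq (map Inl ks) ?sl')) f g)
          = ore_class (LPA v ?sl') a b"
        using \<delta>'(3)[OF fg] by blast
      define N where "N = max (bndA sl (Inl k) a) (bndA sl (Inl k) b)"
      have k': "Inl k \<in> unfrozen (fst sl)"
        using D(6) k by simp
      have "mutA v sl (Inl k) (ore_class (LPA v ?sl') a b)
          = ore_class (LPA v sl) (numA sl (Inl k) N a) (numA sl (Inl k) N b)"
        by (rule mutA_hom(1)[OF D(2) k' pstar_evec_nonzero[OF link] ab(3)]) (auto simp: N_def)
      moreover have "numA sl (Inl k) N b \<noteq> 0"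
        by (rule mutA_hom(2)[OF D(2) k' pstar_evec_nonzero[OF link] ab(3)])
      ultimately show "\<exists>a b. (\<forall>m\<in>keys a. \<delta> m = d) \<and> (\<forall>m\<in>keys b. \<delta> m = 0) \<and> b \<noteq> 0 \<and>
        mutA_seq v (map Inl (k # ks)) sl (ore_class (LPA v (pmut_seq (map Inl (k # ks)) sl)) f g)
        = ore_class (LPA v sl) a b"
        using ab(4) deg[OF ab(1)] deg[OF ab(2)]
        by (intro exI[of _ "numA sl (Inl k) N a"] exI[of _ "numA sl (Inl k) N b"]) simp
    qed (use \<delta>' in simp_all)
  qed
qed

section \<open>Upper cluster algebras: module structure and pushforward\<close>

lemma mutX_seq_hom:
  assumes "X_ok s"
  shows "mutX_seq v ks s \<in> ring_hom (FX v (mut_seq ks s)) (FX v s)"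
    and "mutX_seq v ks s (embX v (mut_seq ks s) (cst c)) = embX v s (cst c)"
proof -
  have "mutX_seq v ks s \<in> ring_hom (FX v (mut_seq ks s)) (FX v s) \<and>
      mutX_seq v ks s (embX v (mut_seq ks s) (cst c)) = embX v s (cst c)"
    using assms
  proof (induction ks arbitrary: s)
    case Nil
    then show ?case
      by (auto simp: ring_hom_def)
  next
    case (Cons k ks)
    have IH: "mutX_seq v ks (mut k s) \<in> ring_hom (FX v (mut_seq ks (mut k s))) (FX v (mut k s))"
      "mutX_seq v ks (mut k s) (embX v (mut_seq ks (mut k s)) (cst c)) = embX v (mut k s) (cst c)"
      using Cons.IH[OF X_ok_mut[OF Cons.prems]] by auto
    show ?case
      using ring_hom_trans[OF IH(1) mutX_hom(1)[OF Cons.prems]] IH(2) mutX_hom(2)[OF Cons.prems]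
      by (simp add: comp_def)
  qed
  then show "mutX_seq v ks s \<in> ring_hom (FX v (mut_seq ks s)) (FX v s)"
    "mutX_seq v ks s (embX v (mut_seq ks s) (cst c)) = embX v s (cst c)"
    by auto
qed

lemma X_ok_mut_seq: "X_ok (s :: ('j::finite) seed) \<Longrightarrow> X_ok (mut_seq ks s)"
  by (induction ks arbitrary: s) (simp_all add: X_ok_mut)

lemma embX_simps:
  assumes "X_ok s"
  shows "embX v s (f + g) = embX v s f \<oplus>\<^bsub>FX v s\<^esub> embX v s g"
    "embX v s (cst c * f) = embX v s (cst c) \<otimes>\<^bsub>FX v s\<^esub> embX v s f"
    "embX v s f \<in> carrier (FX v s)"
proof -
  interpret qtorus "chiX s"
    by (rule qtorus_X[OF assms])
  show "embX v s (f + g) = embX v s f \<oplus>\<^bsub>FX v s\<^esub> embX v s g"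
    "embX v s (cst c * f) = embX v s (cst c) \<otimes>\<^bsub>FX v s\<^esub> embX v s f"
    "embX v s f \<in> carrier (FX v s)"
    using emb_add emb_mult[of "cst c" f] emb_closed by (simp_all add: embX_def FX_def LPX_eq)
qed

lemma carrier_LP [simp]: "carrier (LPX v s) = UNIV" "carrier (LPA v sl) = UNIV"
  by (simp_all add: LPX_eq LPA_eq)

lemma mem_UX: "f \<in> UX v s \<longleftrightarrow>
    (\<forall>ks. set ks \<subseteq> unfrozen s \<longrightarrow> (\<exists>g. embX v s f = mutX_seq v ks s (embX v (mut_seq ks s) g)))"
  by (auto simp: UX_def image_iff)

lemma mem_UA: "f \<in> UA v sl \<longleftrightarrow>
    (\<forall>ks. set ks \<subseteq> unfrozen (fst sl) \<longrightarrow> (\<exists>g. embA v sl f = mutA_seq v ks sl (embA v (pmut_seq ks sl) g)))"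
  by (auto simp: UA_def image_iff)

lemma UX_add:
  assumes s: "X_ok s" and fg: "f \<in> UX v s" "g \<in> UX v s"
  shows "f + g \<in> UX v s"
  unfolding mem_UX
proof (intro allI impI)
  fix ks assume "set ks \<subseteq> unfrozen s"
  then obtain f' g' where "embX v s f = mutX_seq v ks s (embX v (mut_seq ks s) f')"
      "embX v s g = mutX_seq v ks s (embX v (mut_seq ks s) g')"
    using fg mem_UX by metis
  then show "\<exists>h. embX v s (f + g) = mutX_seq v ks s (embX v (mut_seq ks s) h)"
    using ring_hom_add[OF mutX_seq_hom(1)[OF s, of ks]] embX_simps[OF s] embX_simps[OF X_ok_mut_seq[OF s]]
    by (intro exI[of _ "f' + g'"]) simp
qed

lemma UX_scale:
  assumes s: "X_ok s" and f: "f \<in> UX v s"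
  shows "cst c * f \<in> UX v s"
  unfolding mem_UX
proof (intro allI impI)
  fix ks assume "set ks \<subseteq> unfrozen s"
  then obtain f' where "embX v s f = mutX_seq v ks s (embX v (mut_seq ks s) f')"
    using f mem_UX by metis
  then show "\<exists>h. embX v s (cst c * f) = mutX_seq v ks s (embX v (mut_seq ks s) h)"
    using ring_hom_mult[OF mutX_seq_hom(1)[OF s, of ks]] mutX_seq_hom(2)[OF s, of ks c]
      embX_simps[OF s] embX_simps[OF X_ok_mut_seq[OF s]]
    by (intro exI[of _ "cst c * f'"]) simp
qed

lemma embX_class: "embX v s f = ore_class (LPX v s) f 1"
  by (simp add: embX_def ore_embed_def LPX_eq)

lemma embA_class: "embA v sl f = ore_class (LPA v sl) f 1"
  by (simp add: embA_def ore_embed_def LPA_eq)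

text \<open>Trades an identity of fractions for one in the torus with the denominator as right
  factor, the kind of product that \<open>qmap\<close> respects.\<close>

lemma embX_eq_class_iff:
  assumes "X_ok s" "b \<noteq> 0"
  shows "embX v s f = ore_class (LPX v s) a b \<longleftrightarrow> tm (chiX s) f b = a"
proof -
  interpret qtorus "chiX s"
    by (rule qtorus_X[OF assms(1)])
  show ?thesis
    using embed_eq_class_iff[of f a b] assms(2) by (simp add: embX_def LPX_eq)
qed

lemma embA_eq_class_iff:
  assumes "A_ok sl" "b \<noteq> 0"
  shows "embA v sl f = ore_class (LPA v sl) a b \<longleftrightarrow> tm (chiA sl) f b = a"
proof -
  interpret qtorus "chiA sl"
    by (rule qtorus_A[OF assms(1)])
  show ?thesis
    using embed_eq_class_iff[of f a b] assms(2) by (simp add: embA_def LPA_eq)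
qed

lemma push_one: "\<theta> 0 = 0 \<Longrightarrow> push \<theta> 1 = 1"
  by (simp add: cst_mult_single flip: single_one)

lemma one_supp:
  fixes s :: "('i::finite) seed"
  shows "keys (1 :: ('i, 'k) laurent) \<subseteq> supp_unfrozen s"
  using supp_unfrozen_closed(1)[of s] by simp

lemma push_qmap_tm:
  assumes "linked s sl" "keys b \<subseteq> supp_unfrozen s"
  shows "push (qmap sl) (tm (chiX s) f b) = tm (chiA sl) (push (qmap sl) f) (push (qmap sl) b)"
  using assms(2) by (intro push_tm qmap_add chi_qmap[OF assms(1)]) blast

lemma push_iota_tm:
  assumes "linked s sl"
  shows "push iota (tm (chiX s) f b) = tm (chiX (fst sl)) (push iota f) (push iota b)"
  by (intro push_tm iota_add) (simp add: omega_iota[OF assms])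

lemma unfrozen_map_Inl:
  assumes "linked s sl" "set ks' \<subseteq> unfrozen (fst sl)"
  obtains ks where "ks' = map Inl ks" "set ks \<subseteq> unfrozen s"
proof -
  have *: "\<forall>k\<in>set ks'. Inl (projl k) = k \<and> projl k \<in> unfrozen s"
    using assms(2) linkedD(6)[OF assms(1)] by auto
  show ?thesis
    by (rule that[of "map projl ks'"]) (use * in \<open>auto simp: map_idI comp_def\<close>)
qed

text \<open>A Laurent expansion of \<open>f\<close> at another seed amounts to an equation
  \<open>f b = a\<close> with \<open>b\<close> of unfrozen support, and such an equation survives
  both \<open>iota\<close> and \<open>qmap\<close>. The two conclusions serve the two alternative
  hypotheses of the theorem, on \<open>U^X\<close> and on \<open>U^A\<close> of
  \<open>prin t\<close>.\<close>

lemma UX_push: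
  assumes link: "linked s sl" and f: "f \<in> UX v s"
  shows "push iota f \<in> UX v (fst sl)" "push (qmap sl) f \<in> UA v sl"
proof -
  note D = linkedD[OF link]
  have main: "\<exists>g. embX v (fst sl) (push iota f) = mutX_seq v (map Inl ks) (fst sl)
        (embX v (mut_seq (map Inl ks) (fst sl)) (push iota g)) \<and>
      embA v sl (push (qmap sl) f) = mutA_seq v (map Inl ks) sl (embA v (pmut_seq (map Inl ks) sl)
        (push (qmap (pmut_seq (map Inl ks) sl)) g))" if ks: "set ks \<subseteq> unfrozen s" for ks
  proof -
    obtain g where g: "embX v s f = mutX_seq v ks s (embX v (mut_seq ks s) g)"
      using f ks mem_UX by metis
    obtain a b where ab: "keys b \<subseteq> supp_unfrozen s" "b \<noteq> 0"
      "mutX_seq v ks s (embX v (mut_seq ks s) g) = ore_class (LPX v s) a b"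
      "mutX_seq v (map Inl ks) (fst sl) (embX v (mut_seq (map Inl ks) (fst sl)) (push iota g))
        = ore_class (LPX v (fst sl)) (push iota a) (push iota b)"
      "mutA_seq v (map Inl ks) sl
        (embA v (pmut_seq (map Inl ks) sl) (push (qmap (pmut_seq (map Inl ks) sl)) g))
        = ore_class (LPA v sl) (push (qmap sl) a) (push (qmap sl) b)"
      using mutation_sequence[OF link ks one_supp one_neq_zero, of g]
      unfolding embX_class embA_class by (auto simp: push_one simp del: linext_single)
    have "tm (chiX s) f b = a"
      using g ab(2,3) embX_eq_class_iff[OF D(1)] by simp
    then have eq: "embX v (fst sl) (push iota f) = ore_class (LPX v (fst sl)) (push iota a) (push iota b)"
      "embA v sl (push (qmap sl) f) = ore_class (LPA v sl) (push (qmap sl) a) (push (qmap sl) b)"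
      using embX_eq_class_iff[OF D(3), of "push iota b"] embA_eq_class_iff[OF D(2), of "push (qmap sl) b"]
        ab(2) D(9) push_iota_tm[OF link, of f b] push_qmap_tm[OF link ab(1), of f]
      by (simp_all add: push_eq_0_iff push_eq_0_iff[OF inj_iota])
    show ?thesis
      unfolding eq using ab(4,5) by metis
  qed
  show "push iota f \<in> UX v (fst sl)"
    unfolding mem_UX using main unfrozen_map_Inl[OF link] by metis
  show "push (qmap sl) f \<in> UA v sl"
    unfolding mem_UA using main unfrozen_map_Inl[OF link] by metis
qed

end

section \<open>The basis\<close>

lemma restrict_poly_eq: "restrict_poly F = push (\<lambda>n. n \<circ> Inl) F"
  by (simp add: restrict_poly_def linext_def cst_mult_single)

lemma pstar_map_eq: "pstar_map s F = push (pstar s) F"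
  by (simp add: pstar_map_def linext_def cst_mult_single)

lemma push_ident: "push (\<lambda>m. m) f = f"
  using laurent_expand[of f] by (simp add: linext_def cst_mult_single)

lemma push_iota_restrict:
  assumes "keys F \<subseteq> nonneg_unfrozen s" "unfrozen s = Inl ` U"
  shows "push iota (restrict_poly F) = F"
proof -
  have "iota (n \<circ> Inl) = n" if "n \<in> keys F" for n
  proof -
    have "n (Inr i) = 0" for i
      using that assms by (auto simp: nonneg_unfrozen_def)
    then show ?thesis
      by (simp add: sum_type_ext)
  qed
  then have "push iota (restrict_poly F) = push (\<lambda>m. m) F"
    unfolding restrict_poly_eq push_push by (intro linext_cong) simp
  then show ?thesis
    by (simp only: push_ident)
qed

lemma lookup_single_mult: "lookup (single n 1 * f) (n + k) = lookup f k"
  for f :: "('j, 'k::comm_ring_1) laurent"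
  by (induction f rule: laurent_induct)
     (simp_all add: mult_single distrib_left lookup_add lookup_single when_def)

lemma keys_single_mult: "keys (single n 1 * f) \<subseteq> (+) n ` keys f"
  for f :: "('j, 'k::comm_ring_1) laurent"
  using Poly_Mapping.keys_mult[of "single n 1" f] by (auto split: if_splits)

lemma module_lscale: "module (lscale :: 'k::comm_ring_1 \<Rightarrow> ('j, 'k) laurent \<Rightarrow> ('j, 'k) laurent)"
  by unfold_locales
     (simp_all add: lscale_eq distrib_left distrib_right single_add cst_mult_cst)

lemma qmap_prin: "qmap (prin t, lam) n = case_sum (pstar t n) n"
  by (simp add: sum_type_ext qmap_def pstar_def sum_UNIV_sum prin_def if_distrib[of "\<lambda>x. x * _"] cong: if_cong)

text \<open>The second component of \<open>(B n, n)\<close> recovers \<open>n\<close>, even when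
  \<open>B\<close> is singular.\<close>

lemma inj_qmap_prin: "inj (qmap (prin t, lam))"
  by (rule injI) (auto simp: qmap_prin sum_type_ext)

lemma S_elt_qmap:
  assumes "keys (F m) \<subseteq> nonneg_unfrozen (fst sl)" "unfrozen (fst sl) = Inl ` U"
  shows "S_elt (fst sl) F m = single m 1 * push (qmap sl) (restrict_poly (F m))"
proof -
  have "pstar_map (fst sl) (F m) = push (pstar (fst sl)) (push iota (restrict_poly (F m)))"
    by (simp only: push_iota_restrict[OF assms] pstar_map_eq)
  then show ?thesis
    by (simp add: S_elt_def push_push qmap_def[abs_def])
qed

lemma basis_assumptionD:
  assumes "basis_assumption v sl0 Fp" "sl \<in> reachable sl0"
  shows "keys (Fp sl m) \<subseteq> nonneg_unfrozen (fst sl)"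
    and "lookup (Fp sl m) 0 = 1"
    and "set ks \<subseteq> unfrozen (fst sl) \<Longrightarrow>
      mutA_seq v ks sl ` embA v (pmut_seq ks sl) ` S_set (pmut_seq ks sl) Fp = embA v sl ` S_set sl Fp"
proof -
  note b = assms(1)[unfolded basis_assumption_def]
  show "keys (Fp sl m) \<subseteq> nonneg_unfrozen (fst sl)" "lookup (Fp sl m) 0 = 1"
    using b[THEN conjunct1] assms(2) by blast+
  show "set ks \<subseteq> unfrozen (fst sl) \<Longrightarrow>
      mutA_seq v ks sl ` embA v (pmut_seq ks sl) ` S_set (pmut_seq ks sl) Fp = embA v sl ` S_set sl Fp"
    by (rule b[THEN conjunct2, THEN conjunct1, THEN bspec, OF assms(2), THEN spec, THEN mp])
qed

section \<open>The initial pair of seeds \<open>t\<close> and \<open>prin t\<close>\<close>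

lemma prin_simps [simp]:
  "unfrozen (prin t) = Inl ` unfrozen t" "dvec (prin t) (Inl i) = dvec t i" "dvec (prin t) (Inr i) = dvec t i"
  "Bmat (prin t) (Inl i) (Inl j) = Bmat t i j" "Bmat (prin t) (Inl i) (Inr j) = (if i = j then - 1 else 0)"
  "Bmat (prin t) (Inr i) (Inl j) = (if i = j then 1 else 0)" "Bmat (prin t) (Inr i) (Inr j) = 0"
  by (simp_all add: prin_def)

lemma valid_seed_prin:
  assumes "valid_seed t"
  shows "valid_seed (prin t)"
  unfolding valid_seed_def
proof (intro conjI allI)
  fix x y
  show "dvec (prin t) x > 0"
    using dvec_pos[OF assms] by (cases x) simp_all
  show "(of_int (Bmat (prin t) x y) / of_int (dvec (prin t) x) :: rat)
      = - (of_int (Bmat (prin t) y x) / of_int (dvec (prin t) y))"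
  proof (cases x; cases y)
    fix i j assume "x = Inl i" "y = Inl j"
    then show ?thesis
      unfolding \<open>x = Inl i\<close> \<open>y = Inl j\<close> prin_simps by (intro valid_seed_skew[OF assms])
  qed auto
qed

lemma (in base) linked_prin:
  assumes t: "valid_seed t" and d: "\<And>i. 1 / of_int (dvec t i) \<in> \<Lambda>"
    and lam: "\<And>i j. lam i j = - lam j i" "\<And>i j. lam i j \<in> \<Lambda>"
    and comp: "\<And>m n. n \<in> supp_unfrozen (prin t) \<Longrightarrow>
      v (form lam m (pstar (prin t) n)) = v (- pair (dvec (prin t)) m n)"
  shows "linked t (prin t, lam)"
proof -
  have "1 / of_int (dvec (prin t) x) \<in> \<Lambda>" for x
    using d by (cases x) simp_all
  then have "X_ok t" "X_ok (prin t)"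
    unfolding X_ok_def using t d valid_seed_prin by blast+
  moreover have "A_ok (prin t, lam)"
    unfolding A_ok_def fst_conv snd_conv using \<open>X_ok (prin t)\<close> lam comp by blast
  ultimately show ?thesis
    by (simp add: linked_def inj_qmap_prin)
qed

text \<open>Compatibility is stated on basis vectors; bilinearity extends it, and a frozen
  \<open>k\<close> contributes nothing since \<open>n k = 0\<close>.\<close>

lemma compatible_pair:
  assumes "compatible s lam" "n \<in> supp_unfrozen s"
  shows "form lam m (pstar s n) = - pair (dvec s) m n"
proof -
  have m: "m = (\<lambda>a. \<Sum>i\<in>UNIV. m i * evec i a)"
    by (simp add: fun_eq_iff evec_def if_distrib[of "(*) _"] cong: if_cong)
  have n: "pstar s n = (\<lambda>a. \<Sum>k\<in>UNIV. n k * pstar s (evec k) a)"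
    by (simp add: pstar_evec) (simp add: pstar_def mult.commute)
  have entry: "of_int (n k) * form lam (evec i) (pstar s (evec k)) =
      (if i = k then - (of_int (n i) / of_int (dvec s i)) else 0)" for i k
  proof (cases "k \<in> unfrozen s")
    case True
    then have "form lam (evec i) (pstar s (evec k)) = (if i = k then - (1 / of_int (dvec s k)) else 0)"
      using assms(1) unfolding compatible_def by blast
    then show ?thesis
      by simp
  next
    case False
    then show ?thesis
      using assms(2) by (auto simp: supp_unfrozen_def)
  qed
  have "form lam m (pstar s n) = form lam (\<lambda>a. \<Sum>i\<in>UNIV. m i * evec i a) (\<lambda>a. \<Sum>k\<in>UNIV. n k * pstar s (evec k) a)"
    using m n by simp
  also have "\<dots> = (\<Sum>i\<in>UNIV. of_int (m i) * (\<Sum>k\<in>UNIV. of_int (n k) * form lam (evec i) (pstar s (evec k))))"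
    by (simp only: form_combination_left form_combination_right)
  also have "\<dots> = - pair (dvec s) m n"
    unfolding entry by (simp add: pair_def sum_negf)
  finally show ?thesis .
qed

lemma base_setup_linked:
  assumes t: "valid_seed t" and "base_setup v (prin t) lam"
  obtains \<Lambda> where "base v \<Lambda>" "base.linked v \<Lambda> t (prin t, lam)"
proof -
  from assms(2) consider "classical_base v" "lam = (\<lambda>_ _. 0)"
    | D where "compatible (prin t) lam" "quantum_base D v" "sufficiently_divisible D (prin t) lam"
    unfolding base_setup_def by blast
  then show ?thesis
  proof cases
    case 1
    then have b: "base v UNIV"
      by (simp add: classical_base_base)
    \<comment> \<open>With \<open>v = 1\<close> the compatibility demanded by \<open>A_ok\<close>
      reads \<open>1 = 1\<close>, so the zero form satisfies it.\<close>
    have "base.linked v UNIV t (prin t, lam)"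
      by (rule base.linked_prin[OF b t]) (use 1 in \<open>auto simp: classical_base_def\<close>)
    then show ?thesis
      using that b by blast
  next
    case 2
    let ?\<Lambda> = "{a :: rat. of_int D * a \<in> \<int>}"
    have b: "base v ?\<Lambda>"
      by (rule quantum_base_base[OF 2(2)])
    have "base.linked v ?\<Lambda> t (prin t, lam)"
    proof (rule base.linked_prin[OF b t])
      fix i
      have "dvec (prin t) (Inl i) dvd D"
        using 2(3) unfolding sufficiently_divisible_def by blast
      then obtain c where c: "D = dvec t i * c"
        by auto
      have "of_int D * (1 / of_int (dvec t i)) = (of_int c :: rat)"
        using dvec_pos[OF t, of i] by (simp add: c)
      then have "of_int D * (1 / of_int (dvec t i) :: rat) \<in> \<int>"
        by (simp only: Ints_of_int)
      then show "1 / of_int (dvec t i) \<in> ?\<Lambda>"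
        by blast
    next
      fix i j
      show "lam i j = - lam j i"
        using 2(1) unfolding compatible_def by blast
      show "lam i j \<in> ?\<Lambda>"
        using 2(3) unfolding sufficiently_divisible_def by blast
    next
      fix m n assume "n \<in> supp_unfrozen (prin t)"
      then show "v (form lam m (pstar (prin t) n)) = v (- pair (dvec (prin t)) m n)"
        by (simp only: compatible_pair[OF 2(1)])
    qed
    then show ?thesis
      using that b by blast
  qed
qed

section \<open>Membership in the upper cluster algebra\<close>

context base
begin

lemma linked_mut_seq:
  "linked s sl \<Longrightarrow> set ks \<subseteq> unfrozen s \<Longrightarrow> linked (mut_seq ks s) (pmut_seq (map Inl ks) sl)"
proof (induction ks arbitrary: s sl)
  case (Cons k ks)
  then show ?case
    using linked_mut[of s sl k] by simp
qed simp

lemma reachableI: "linked s sl \<Longrightarrow> set ks \<subseteq> unfrozen s \<Longrightarrow> pmut_seq (map Inl ks) sl \<in> reachable sl"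
  unfolding reachable_def using linkedD(6) by fastforce

text \<open>
  If \<open>q Z\<close> lies in \<open>\<S>\<close> then it is \<open>\<mu>^* S'\<close> with \<open>S'\<close> in \<open>\<S>(\<mu> s)\<close>; comparing degrees shows that \<open>S'\<close>
  is of the form \<open>q z\<close>, and \<open>Z = \<mu>^* z\<close> follows by injectivity of \<open>q\<close>.
\<close>

lemma mem_UX_if_push_mem_S_set:
  assumes link: "linked s sl" and basis: "basis_assumption v sl Fp"
    and \<delta>: "\<And>m n. \<delta> (m + n) = \<delta> m + (\<delta> n :: 'c::ab_group_add)"
      "\<And>m. \<delta> m = 0 \<longleftrightarrow> m \<in> range (qmap sl)"
    and Z: "Z \<noteq> 0" "push (qmap sl) Z \<in> S_set sl Fp"
  shows "Z \<in> UX v s"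
  unfolding mem_UX
proof (intro allI impI)
  fix ks assume ks: "set ks \<subseteq> unfrozen s"
  note D = linkedD[OF link]
  let ?ks = "map Inl ks"
  let ?sl = "pmut_seq ?ks sl"
  have link': "linked (mut_seq ks s) ?sl"
    by (rule linked_mut_seq[OF link ks])
  have "sl \<in> reachable sl"
    using reachableI[OF link, of "[]"] by simp
  moreover have "set ?ks \<subseteq> unfrozen (fst sl)"
    using ks D(6) by auto
  ultimately have "mutA_seq v ?ks sl ` embA v ?sl ` S_set ?sl Fp = embA v sl ` S_set sl Fp"
    by (rule basis_assumptionD(3)[OF basis])
  then have "embA v sl (push (qmap sl) Z) \<in> mutA_seq v ?ks sl ` embA v ?sl ` S_set ?sl Fp"
    using Z(2) by blast
  then obtain m' where m': "embA v sl (push (qmap sl) Z) = mutA_seq v ?ks sl (embA v ?sl (S_elt (fst ?sl) (Fp ?sl) m'))"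
    unfolding S_set_def by blast
  define R where "R = restrict_poly (Fp ?sl m')"
  have "keys (Fp ?sl m') \<subseteq> nonneg_unfrozen (fst ?sl)"
    by (rule basis_assumptionD(1)[OF basis reachableI[OF link ks]])
  then have S: "S_elt (fst ?sl) (Fp ?sl) m' = single m' 1 * push (qmap ?sl) R"
    unfolding R_def by (rule S_elt_qmap) (rule linkedD(6)[OF link'])
  obtain \<delta>' where \<delta>': "\<And>m n. \<delta>' (m + n) = \<delta>' m + \<delta>' n"
    "\<And>m. \<delta>' m = 0 \<longleftrightarrow> m \<in> range (qmap ?sl)"
    "\<And>f g d. \<lbrakk>\<forall>m\<in>keys f. \<delta>' m = d; \<forall>m\<in>keys g. \<delta>' m = 0; g \<noteq> 0\<rbrakk> \<Longrightarrow>
      \<exists>a b. (\<forall>m\<in>keys a. \<delta> m = d) \<and> (\<forall>m\<in>keys b. \<delta> m = 0) \<and> b \<noteq> 0 \<and>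
        mutA_seq v ?ks sl (ore_class (LPA v ?sl) f g) = ore_class (LPA v sl) a b"
    apply (rule graded_mutation_sequence[OF link ks \<delta>])
    subgoal premises p for \<delta>'
      by (rule p(1)[OF p(2-4)])
    done
  have "\<delta>' m = \<delta>' m'" if m: "m \<in> keys (single m' 1 * push (qmap ?sl) R)" for m
  proof -
    obtain n where "m = m' + qmap ?sl n"
      using m keys_single_mult[of m' "push (qmap ?sl) R"] keys_push[of "qmap ?sl" R] by blast
    moreover have "\<delta>' (qmap ?sl n) = 0"
      using \<delta>'(2) by blast
    ultimately show ?thesis
      using \<delta>'(1) by simp
  qed
  moreover have "\<forall>m\<in>keys (1 :: ('a + 'a, 'k) laurent). \<delta>' m = 0"
    using \<delta>'(1)[of 0 0] by simp
  moreover have "(1 :: ('a + 'a, 'k) laurent) \<noteq> 0"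
    by (rule one_neq_zero)
  ultimately obtain a b where ab: "\<forall>m\<in>keys a. \<delta> m = \<delta>' m'" "\<forall>m\<in>keys b. \<delta> m = 0" "b \<noteq> 0"
      "mutA_seq v ?ks sl (ore_class (LPA v ?sl) (single m' 1 * push (qmap ?sl) R) 1) = ore_class (LPA v sl) a b"
    using \<delta>'(3)[of "single m' 1 * push (qmap ?sl) R" "\<delta>' m'" 1] by blast
  interpret A: qtorus "chiA sl"
    by (rule qtorus_A[OF D(2)])
  have "embA v sl (push (qmap sl) Z) = ore_class (LPA v sl) a b"
    using m' ab(4) by (simp add: S embA_class[of ?sl])
  then have a: "tm (chiA sl) (push (qmap sl) Z) b = a"
    using embA_eq_class_iff[OF D(2) ab(3)] by blast
  have qZ: "push (qmap sl) Z \<noteq> 0"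
    using Z(1) push_eq_0_iff[OF D(9)] by blast
  then have "a \<noteq> 0"
    using a A.tm_nonzero[OF _ ab(3)] by blast
  \<comment> \<open>One exponent of the nonzero \<open>a\<close> decides the degree: it has degree
    \<open>\<delta>' m'\<close> as part of the image of the homogeneous element, and degree 0 as a
    sum of exponents of \<open>push (qmap sl) Z\<close> and \<open>b\<close>.\<close>
  then obtain m where m: "m \<in> keys a"
    by (metis equals0I keys_eq_empty poly_mapping_eqI in_keys_iff lookup_zero)
  then obtain x y where xy: "x \<in> keys (push (qmap sl) Z)" "y \<in> keys b" "m = x + y"
    using keys_tm[of "chiA sl" "push (qmap sl) Z" b] a by blast
  have "\<delta> x = 0"
    using xy(1) keys_push[of "qmap sl" Z] \<delta>(2) by blast
  then have "\<delta>' m' = 0"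
    using ab(1,2) m xy \<delta>(1) by fastforce
  then obtain n' where n': "m' = qmap ?sl n'"
    using \<delta>'(2) by blast
  define z where "z = single n' 1 * R"
  have z: "single m' 1 * push (qmap ?sl) R = push (qmap ?sl) z"
    unfolding z_def n' by (simp add: push_mult[OF qmap_add] push_single del: linext_single)
  \<comment> \<open>The earlier denominator was only known to have degree 0; the new one has
    unfrozen support, so the equation can be pulled back along \<open>qmap\<close>.\<close>
  obtain a b where ab: "keys b \<subseteq> supp_unfrozen s" "b \<noteq> 0"
      "mutX_seq v ks s (embX v (mut_seq ks s) z) = ore_class (LPX v s) a b"
      "mutA_seq v ?ks sl (embA v ?sl (push (qmap ?sl) z)) = ore_class (LPA v sl) (push (qmap sl) a) (push (qmap sl) b)"
    using mutation_sequence[OF link ks one_supp one_neq_zero, of z]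
    unfolding embX_class embA_class by (auto simp: push_one simp del: linext_single)
  have "embA v sl (push (qmap sl) Z) = ore_class (LPA v sl) (push (qmap sl) a) (push (qmap sl) b)"
    using m' ab(4) by (simp add: S z)
  then have "tm (chiA sl) (push (qmap sl) Z) (push (qmap sl) b) = push (qmap sl) a"
    using embA_eq_class_iff[OF D(2)] push_eq_0_iff[OF D(9)] ab(2) by blast
  then have "push (qmap sl) (tm (chiX s) Z b) = push (qmap sl) a"
    by (simp only: push_qmap_tm[OF link ab(1)])
  then have "tm (chiX s) Z b = a"
    using push_eq_iff[OF D(9)] by blast
  then have "embX v s Z = ore_class (LPX v s) a b"
    using embX_eq_class_iff[OF D(1) ab(2)] by blast
  then show "\<exists>g. embX v s Z = mutX_seq v ks s (embX v (mut_seq ks s) g)"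
    using ab(3) by metis
qed

end

text \<open>The exponents of \<open>X^n R_n\<close> are \<open>n\<close> plus nonnegative vectors.
  Among the indices in a relation, at one with smallest coordinate sum no other term contributes,
  and its own coefficient there is 1.\<close>

lemma Z_elt_independent:
  fixes R :: "'j::finite lattice \<Rightarrow> ('j, 'k::comm_ring_1) laurent"
  assumes R: "\<And>n k. k \<in> keys (R n) \<Longrightarrow> \<forall>i. k i \<ge> 0" "\<And>n. lookup (R n) 0 = 1"
  shows "\<not> module.dependent lscale (range (\<lambda>n. single n 1 * R n))"
proof
  let ?Z = "\<lambda>n. single n 1 * R n"
  interpret module "lscale :: 'k \<Rightarrow> ('j, 'k) laurent \<Rightarrow> ('j, 'k) laurent"
    by (rule module_lscale)
  assume "dependent (range ?Z)"
  then obtain T u where T: "finite T" "T \<subseteq> range ?Z" "(\<Sum>z\<in>T. lscale (u z) z) = 0" "\<exists>z\<in>T. u z \<noteq> 0"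
    unfolding dependent_explicit by blast
  \<comment> \<open>Dependence is a property of a set of elements, so an index has to be chosen for
    each of them.\<close>
  define \<nu> where "\<nu> z = (SOME n. z = ?Z n)" for z
  have \<nu>: "z = ?Z (\<nu> z)" if "z \<in> T" for z
  proof -
    have "\<exists>n. z = ?Z n"
      using subsetD[OF T(2) that] by (simp add: image_iff)
    then show ?thesis
      unfolding \<nu>_def by (rule someI_ex[of "\<lambda>n. z = ?Z n"])
  qed
  let ?T = "{z \<in> T. u z \<noteq> 0}"
  define deg where "deg z = (\<Sum>i\<in>UNIV. \<nu> z i)" for z
  have "finite ?T" "?T \<noteq> {}"
    using T by auto
  note fin = this
  have "Min (deg ` ?T) \<in> deg ` ?T"
    using fin by (intro Min_in) simp_all
  then obtain z where z: "z \<in> ?T" "deg z = Min (deg ` ?T)"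
    by (metis (no_types, lifting) imageE)
  then have min: "deg z \<le> deg w" if "w \<in> ?T" for w
    using Min_le[of "deg ` ?T" "deg w"] fin(1) that by simp
  have "u w * lookup w (\<nu> z) = 0" if w: "w \<in> T" "w \<noteq> z" for w
  proof (rule ccontr)
    assume nz: "u w * lookup w (\<nu> z) \<noteq> 0"
    then have wT: "w \<in> ?T"
      using w by auto
    have "lookup w (\<nu> z) = lookup (?Z (\<nu> w)) (\<nu> w + (\<nu> z - \<nu> w))"
      using \<nu>[OF w(1)] by simp
    then have "lookup (R (\<nu> w)) (\<nu> z - \<nu> w) \<noteq> 0"
      using nz by (simp only: lookup_single_mult) auto
    then have "\<nu> z - \<nu> w \<in> keys (R (\<nu> w))"
      by (simp add: in_keys_iff)
    then have ge: "(\<nu> z - \<nu> w) i \<ge> 0" for i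
      using R(1) by blast
    have "(\<Sum>i\<in>UNIV. (\<nu> z - \<nu> w) i) = deg z - deg w"
      by (simp add: deg_def sum_subtractf)
    also have "\<dots> \<le> 0"
      using min[OF wT] by simp
    finally have "(\<Sum>i\<in>UNIV. (\<nu> z - \<nu> w) i) = 0"
      using ge by (intro antisym sum_nonneg) auto
    then have "(\<nu> z - \<nu> w) i = 0" for i
      using ge by (subst (asm) sum_nonneg_eq_0_iff) auto
    then have "\<nu> z = \<nu> w"
      by (auto simp: fun_eq_iff)
    then show False
      using \<nu>[OF w(1)] \<nu>[of z] z(1) w(2) by simp
  qed
  then have "(\<Sum>w\<in>T. u w * lookup w (\<nu> z)) = u z * lookup z (\<nu> z)"
    using T(1) z(1) by (subst sum.remove[of _ z]) auto
  moreover have "(\<Sum>w\<in>T. u w * lookup w (\<nu> z)) = 0"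
    using arg_cong[OF T(3), of "\<lambda>f. lookup f (\<nu> z)"]
    by (simp add: lookup_sum lscale_eq lookup_cst_mult)
  moreover have "lookup z (\<nu> z) = 1"
  proof -
    have "lookup z (\<nu> z) = lookup (?Z (\<nu> z)) (\<nu> z + 0)"
      using \<nu>[of z] z(1) by simp
    then show ?thesis
      by (simp only: lookup_single_mult R(2))
  qed
  ultimately show False
    using z(1) by simp
qed

section \<open>Projection to degree 0 and the basis property\<close>

context base
begin

text \<open>The assumption \<open>span\<close> concerns only the images of \<open>UX v t\<close>
  under \<open>qmap\<close>; both hypotheses of the theorem reduce to it.\<close>

lemma Z_set_basis:
  fixes t :: "('i::finite) seed" and lam :: "'i + 'i \<Rightarrow> 'i + 'i \<Rightarrow> rat"
  defines "sl \<equiv> (prin t, lam)"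
  assumes link: "linked t sl" and basis: "basis_assumption v sl Fp"
    and span: "\<And>f. f \<in> UX v t \<Longrightarrow> push (qmap sl) f \<in> lspan (S_set sl Fp)"
  shows "is_basis (UX v t) (Z_set t (Fp sl))"
proof -
  note D = linkedD[OF link]
  define R where "R m = restrict_poly (Fp sl m)" for m
  \<comment> \<open>\<open>(m1, m2)\<close> is sent to \<open>B m2 - m1\<close>, which identifies
    the cokernel of \<open>n \<mapsto> (B n, n)\<close> with the lattice of
    \<open>t\<close>.\<close>
  define \<delta> where "\<delta> m = pstar t (m \<circ> Inr) + - (m \<circ> Inl)" for m :: "('i + 'i) lattice"
  have \<delta>_add: "\<delta> (m + n) = \<delta> m + \<delta> n" for m n
  proof -
    have "(m + n) \<circ> Inr = (m \<circ> Inr) + (n \<circ> Inr)" "(m + n) \<circ> Inl = (m \<circ> Inl) + (n \<circ> Inl)"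
      by (simp_all add: fun_eq_iff lattice_apply)
    then show ?thesis
      by (simp add: \<delta>_def pstar_add)
  qed
  have \<delta>_ker: "\<delta> m = 0 \<longleftrightarrow> m \<in> range (qmap sl)" for m
  proof
    assume "\<delta> m = 0"
    then have "m \<circ> Inl = pstar t (m \<circ> Inr)"
      by (simp add: \<delta>_def)
    then have "m = qmap sl (m \<circ> Inr)"
      unfolding sl_def qmap_prin by (simp add: sum_type_ext fun_eq_iff)
    then show "m \<in> range (qmap sl)"
      by blast
  next
    assume "m \<in> range (qmap sl)"
    then obtain n where "m = case_sum (pstar t n) n"
      unfolding sl_def qmap_prin by blast
    then have "m \<circ> Inl = pstar t n" "m \<circ> Inr = n"
      by (auto simp: fun_eq_iff)
    then show "\<delta> m = 0"
      by (simp add: \<delta>_def)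
  qed
  have "sl \<in> reachable sl"
    using reachableI[OF link, of "[]"] by simp
  then have F: "keys (Fp sl m) \<subseteq> nonneg_unfrozen (fst sl)" "lookup (Fp sl m) 0 = 1" for m
    using basis_assumptionD(1,2)[OF basis] by blast+
  have iR: "push iota (R m) = Fp sl m" for m
    unfolding R_def by (rule push_iota_restrict[OF F(1) D(6)])
  have lookR: "lookup (R m) k = lookup (Fp sl m) (iota k)" for m k
    using lookup_push[OF inj_iota, of "R m" k] by (simp add: iR)
  have R0: "lookup (R m) 0 = 1" for m
    by (simp add: lookR F(2))
  have Rpos: "\<forall>i. k i \<ge> 0" if "k \<in> keys (R m)" for m k
  proof
    fix i
    have "iota k \<in> nonneg_unfrozen (fst sl)"
      using subsetD[OF F(1), of "iota k" m] that by (simp add: in_keys_iff lookR)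
    then have "iota k (Inl i) \<ge> 0"
      unfolding nonneg_unfrozen_def by blast
    then show "k i \<ge> 0"
      by simp
  qed
  have S: "S_elt (fst sl) (Fp sl) m = single m 1 * push (qmap sl) (R m)" for m
    unfolding R_def by (rule S_elt_qmap[OF F(1) D(6)])
  define Z where "Z n = single n 1 * R (qmap sl n)" for n
  have Z_set: "Z_set t (Fp sl) = range Z"
    unfolding Z_set_def Z_elt_def[abs_def] Z_def[abs_def] R_def by (simp add: prin_degree_def qmap_prin sl_def)
  have qZ: "push (qmap sl) (Z n) = S_elt (fst sl) (Fp sl) (qmap sl n)" for n
    unfolding S Z_def by (simp add: push_mult[OF qmap_add] push_single del: linext_single)
  interpret Lt: module "lscale :: 'k \<Rightarrow> ('i, 'k) laurent \<Rightarrow> ('i, 'k) laurent"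
    by (rule module_lscale)
  interpret Lp: module "lscale :: 'k \<Rightarrow> ('i + 'i, 'k) laurent \<Rightarrow> ('i + 'i, 'k) laurent"
    by (rule module_lscale)
  have indep: "\<not> Lt.dependent (range Z)"
    unfolding Z_def[abs_def] by (rule Z_elt_independent) (use Rpos R0 in auto)
  have Z0: "Z n \<noteq> 0" for n
    using lookup_single_mult[of n "R (qmap sl n)" 0] R0 by (auto simp: Z_def)
  have "Z n \<in> UX v t" for n
    by (rule mem_UX_if_push_mem_S_set[OF link basis \<delta>_add \<delta>_ker Z0]) (simp add: qZ S_set_def)
  moreover have "0 \<in> UX v t"
    using UX_scale[OF D(1), of "Z 0" 0] calculation by simp
  ultimately have sub: "lspan (range Z) \<subseteq> UX v t"
    by (intro Lt.span_minimal) (auto simp: Lt.subspace_def lscale_eq UX_add[OF D(1)] UX_scale[OF D(1)])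
  \<comment> \<open>Each \<open>S_m\<close> is homogeneous of degree \<open>\<delta> m\<close>, so
    this projection to degree 0 fixes it or kills it; those it fixes are the images of the
    \<open>Z n\<close>.\<close>
  define \<pi> :: "('i + 'i, 'k) laurent \<Rightarrow> ('i + 'i, 'k) laurent"
    where "\<pi> = linext (\<lambda>m. if \<delta> m = 0 then single m 1 else 0)"
  have \<pi>_id: "\<pi> f = f" if "\<forall>m\<in>keys f. \<delta> m = 0" for f
  proof -
    have "\<pi> f = push (\<lambda>m. m) f"
      unfolding \<pi>_def by (intro linext_cong) (use that in simp)
    then show ?thesis
      by (simp only: push_ident)
  qed
  have deg: "\<delta> k = \<delta> m" if k: "k \<in> keys (S_elt (fst sl) (Fp sl) m)" for k m
  proof -
    obtain n where "k = m + qmap sl n"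
      using k keys_single_mult[of m "push (qmap sl) (R m)"] keys_push[of "qmap sl" "R m"] unfolding S by blast
    moreover have "\<delta> (qmap sl n) = 0"
      using \<delta>_ker by blast
    ultimately show ?thesis
      by (simp add: \<delta>_add)
  qed
  have \<pi>_S: "\<exists>z\<in>lspan (range Z). push (qmap sl) z = \<pi> f" if "f \<in> lspan (S_set sl Fp)" for f
    using that
  proof (rule Lp.span_induct)
    show "Lp.subspace {f. \<exists>z\<in>lspan (range Z). push (qmap sl) z = \<pi> f}"
    proof (rule Lp.subspaceI)
      show "0 \<in> {f. \<exists>z\<in>lspan (range Z). push (qmap sl) z = \<pi> f}"
        by (auto simp: \<pi>_def intro!: bexI[of _ 0] Lt.span_zero)
    next
      fix f g assume "f \<in> {f. \<exists>z\<in>lspan (range Z). push (qmap sl) z = \<pi> f}"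
        "g \<in> {f. \<exists>z\<in>lspan (range Z). push (qmap sl) z = \<pi> f}"
      then obtain y z where "y \<in> lspan (range Z)" "z \<in> lspan (range Z)"
          "push (qmap sl) y = \<pi> f" "push (qmap sl) z = \<pi> g"
        by blast
      then show "f + g \<in> {f. \<exists>z\<in>lspan (range Z). push (qmap sl) z = \<pi> f}"
        by (auto simp: \<pi>_def linext_add intro!: bexI[of _ "y + z"] Lt.span_add)
    next
      fix c f assume "f \<in> {f. \<exists>z\<in>lspan (range Z). push (qmap sl) z = \<pi> f}"
      then obtain z where "z \<in> lspan (range Z)" "push (qmap sl) z = \<pi> f"
        by blast
      then show "lscale c f \<in> {f. \<exists>z\<in>lspan (range Z). push (qmap sl) z = \<pi> f}"
        using Lt.span_scale[of z "range Z" c]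
        by (auto simp: \<pi>_def lscale_eq linext_cst_mult intro!: bexI[of _ "cst c * z"])
    qed
    fix f assume "f \<in> S_set sl Fp"
    then obtain m where f: "f = S_elt (fst sl) (Fp sl) m"
      unfolding S_set_def by blast
    show "\<exists>z\<in>lspan (range Z). push (qmap sl) z = \<pi> f"
    proof (cases "\<delta> m = 0")
      case True
      then obtain n where n: "m = qmap sl n"
        using \<delta>_ker by blast
      have "\<pi> f = f"
        using deg True unfolding f by (intro \<pi>_id) auto
      then show ?thesis
        using qZ[of n] n f Lt.span_base[of "Z n" "range Z"] by auto
    next
      case False
      then have "\<pi> f = linext (\<lambda>m. 0) f"
        unfolding \<pi>_def using deg f by (intro linext_cong) auto
      then show ?thesis
        by (intro bexI[of _ 0]) (simp_all add: linext_def Lt.span_zero)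
    qed
  qed
  \<comment> \<open>The image of \<open>f\<close> has degree 0, so projecting its expansion gives it
    back, and injectivity of \<open>qmap\<close> lifts the result to \<open>f\<close>.\<close>
  have "f \<in> lspan (range Z)" if f: "f \<in> UX v t" for f
  proof -
    have "\<pi> (push (qmap sl) f) = push (qmap sl) f"
      using keys_push[of "qmap sl" f] \<delta>_ker by (intro \<pi>_id) blast
    then obtain z where z: "z \<in> lspan (range Z)" "push (qmap sl) z = push (qmap sl) f"
      using \<pi>_S[OF span[OF f]] by auto
    have "z = f"
      using z(2) by (simp only: push_eq_iff[OF D(9)])
    then show ?thesis
      using z(1) by simp
  qed
  then show ?thesis
    unfolding is_basis_def Z_set using indep sub by blast
qed

end

theorem theorem6p6:
  fixes t :: "('i::finite) seed"
    and lam :: "'i + 'i \<Rightarrow> 'i + 'i \<Rightarrow> rat"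
    and v :: "rat \<Rightarrow> 'k::comm_ring_1"
    and Fp :: "('i + 'i) pseed \<Rightarrow> ('i + 'i) lattice \<Rightarrow> ('i + 'i, 'k) laurent"
  assumes "valid_seed t"
    and "base_setup v (prin t) lam"
    and "S_set (prin t, lam) Fp \<subseteq> UA v (prin t, lam)"
    and "basis_assumption v (prin t, lam) Fp"
  shows "(pstar_map (prin t) ` UX v (prin t) \<subseteq> lspan (S_set (prin t, lam) Fp) \<longrightarrow>
            is_basis (UX v t) (Z_set t (Fp (prin t, lam)))) \<and>
         (is_basis (UA v (prin t, lam)) (S_set (prin t, lam) Fp) \<longrightarrow>
            is_basis (UX v t) (Z_set t (Fp (prin t, lam))))"
proof -
  obtain \<Lambda> where \<Lambda>: "base v \<Lambda>" "base.linked v \<Lambda> t (prin t, lam)"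
    using base_setup_linked[OF assms(1,2)] .
  interpret base v \<Lambda>
    by (rule \<Lambda>(1))
  have basis: "is_basis (UX v t) (Z_set t (Fp (prin t, lam)))"
    if "\<And>f. f \<in> UX v t \<Longrightarrow> push (qmap (prin t, lam)) f \<in> lspan (S_set (prin t, lam) Fp)"
    by (rule Z_set_basis[OF \<Lambda>(2) assms(4) that])
  show ?thesis
  proof (intro conjI impI)
    assume sub: "pstar_map (prin t) ` UX v (prin t) \<subseteq> lspan (S_set (prin t, lam) Fp)"
    show "is_basis (UX v t) (Z_set t (Fp (prin t, lam)))"
    proof (rule basis)
      fix f assume "f \<in> UX v t"
      then have "push iota f \<in> UX v (prin t)"
        using UX_push(1)[OF \<Lambda>(2)] by simp
      moreover have "pstar_map (prin t) (push iota f) = push (qmap (prin t, lam)) f"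
        by (simp add: pstar_map_eq push_push qmap_def[abs_def])
      ultimately show "push (qmap (prin t, lam)) f \<in> lspan (S_set (prin t, lam) Fp)"
        using sub by (metis image_subset_iff)
    qed
  next
    assume "is_basis (UA v (prin t, lam)) (S_set (prin t, lam) Fp)"
    then have "lspan (S_set (prin t, lam) Fp) = UA v (prin t, lam)"
      by (simp add: is_basis_def)
    then show "is_basis (UX v t) (Z_set t (Fp (prin t, lam)))"
      using UX_push(2)[OF \<Lambda>(2)] by (intro basis) simp
  qed
qed

end
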